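(* Let $\mathfrak{s}=\mathfrak{s}_1\dots\mathfrak{s}_{m+n}$ be a parity sequence with $m$ zeros and $n$ ones, and let $L(\lambda(u))$ be the irreducible highest weight $\mathrm{Y}(\mathfrak{gl}^{\mathfrak{s}}_{m|n})$-module with highest weight $\lambda(u)=(\lambda_1(u),\dots,\lambda_{m+n}(u))$, where $\lambda_j(u)\in 1+u^{-1}\mathbb{C}[[u^{-1}]]$. Suppose that for some $i$ we have $\mathfrak{s}_i\mathfrak{s}_{i+1}=01$ or $\mathfrak{s}_i\mathfrak{s}_{i+1}=10$, and that $\lambda_i(u)$ and $\lambda_{i+1}(u)$ are polynomials in $u^{-1}$, $$\lambda_i(u)=(1+\lambda_i^{(1)}u^{-1})\cdots(1+\lambda_i^{(k)}u^{-1}),\qquad \lambda_{i+1}(u)=(1+\lambda_{i+1}^{(1)}u^{-1})\cdots(1+\lambda_{i+1}^{(k)}u^{-1}),$$ without common roots, i.e. $\lambda_i^{(r)}\neq\lambda_{i+1}^{(s)}$ for all $r,s\in\{1,\dots,k\}$. Set $$\lambda_i^{\pm}(u)=\big(1+(\lambda_{i+1}^{(1)}\pm1)u^{-1}\big)\cdots\big(1+(\lambda_{i+1}^{(k)}\pm1)u^{-1}\big),$$ $$\lambda_{i+1}^{\pm}(u)=\big(1+(\lambda_i^{(1)}\pm1)u^{-1}\big)\cdots\big(1+(\lambda_i^{(k)}\pm1)u^{-1}\big),$$ $\lambda_j^{\pm}(u)=\lambda_j(u)$ for $j\neq i,i+1$, and $\lambda^{\pm}(u)=(\lambda_1^{\pm}(u),\dots,\lambda_{m+n}^{\pm}(u))$.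 If $\mathfrak{s}_i\mathfrak{s}_{i+1}=10$, let $\mathfrak{s}^+$ be obtained from $\mathfrak{s}$ by replacing this pair of entries with $01$; if $\mathfrak{s}_i\mathfrak{s}_{i+1}=01$, let $\mathfrak{s}^-$ be obtained from $\mathfrak{s}$ by replacing this pair of entries with $10$. Then the $\mathrm{Y}(\mathfrak{gl}_{m|n})$-module $L(\lambda(u))$ associated with $\mathfrak{s}$ is isomorphic to the $\mathrm{Y}(\mathfrak{gl}_{m|n})$-module $L(\lambda^{\pm}(u))$ associated with $\mathfrak{s}^{\pm}$, where the plus and minus signs are chosen for $\mathfrak{s}_i\mathfrak{s}_{i+1}=10$ and $\mathfrak{s}_i\mathfrak{s}_{i+1}=01$, respectively.
   Context: A parity sequence is a sequence $\mathfrak{s}=\mathfrak{s}_1\dots\mathfrak{s}_{m+n}$ of $0$'s and $1$'s with exactly $m$ zeros ($m,n\geqslant 0$ integers). For a fixed $\mathfrak{s}$ write $\bar\imath=\mathfrak{s}_i$. The Yangian $\mathrm{Y}(\mathfrak{gl}^{\mathfrak{s}}_{m|n})$ is the unital associative $\mathbb{Z}_2$-graded algebra over $\mathbb{C}$ with generators $t_{ij}^{(r)}$ of parity $\bar\imath+\bar\jmath \bmod 2$, $1\leqslant i,j\leqslant m+n$, $r=1,2,\dots$. With $t_{ij}(u)=\delta_{ij}+\sum_{r\geqslant1}t_{ij}^{(r)}u^{-r}$, the defining relations are $$[t_{ij}(u),t_{kl}(v)]=\frac{1}{u-v}\big(t_{kj}(u)t_{il}(v)-t_{kj}(v)t_{il}(u)\big)(-1)^{\bar\imath\bar\jmath+\bar\imath\bar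 k+\bar\jmath\bar k},$$ where $[a,b]=ab-(-1)^{|a||b|}ba$ is the super-commutator on homogeneous elements, $|a|$ being the parity of $a$. A highest weight representation of $\mathrm{Y}(\mathfrak{gl}^{\mathfrak{s}}_{m|n})$ with highest weight $\lambda(u)=(\lambda_1(u),\dots,\lambda_{m+n}(u))$, $\lambda_j(u)\in1+u^{-1}\mathbb{C}[[u^{-1}]]$, is a representation generated by a nonzero vector $\xi$ such that $t_{ab}(u)\xi=0$ for $a<b$ and $t_{jj}(u)\xi=\lambda_j(u)\xi$ for all $j$. The Verma module $M(\lambda(u))$ is the quotient of the algebra by the left ideal generated by all coefficients of $t_{ab}(u)$, $a<b$, and $t_{jj}(u)-\lambda_j(u)$; $L(\lambda(u))$ is its irreducible quotient, said to be associated with $\mathfrak{s}$. Identification of algebras: for the transposition $\sigma_i=(i,i+1)$ and $\mathfrak{s}'$ the sequence obtained from $\mathfrak{s}$ by interchanging the entries $\mathfrak{s}_i$ and $\mathfrak{s}_{i+1}$, the re-labelling map $t_{ab}(u)\mapsto t_{\sigma_i(a)\,\sigma_i(b)}(u)$ is an algebra isomorphism $\mathrm{Y}(\mathfrak{gl}^{\mathfrak{s}'}_{m|n})\to\mathrm{Y}(\mathfrak{gl}^{\mathfrak{s}}_{m|n})$. A module over the second algebra is regarded as a module over the first via this map; the statement that a module associated with $\mathfrak{s}$ is isomorphic to a module associated with $\mathfrak{s}'$ means that there is an invertible linear map intertwining the actions under this identification. *)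

theory Defs
  imports
    "HOL-Algebra.QuotRing"
    "HOL-Algebra.Module"
    "HOL-Library.Poly_Mapping"
    "HOL-Combinatorics.Transposition"
    "HOL-Computational_Algebra.Formal_Power_Series"
begin

section \<open>Free associative algebras\<close>

text \<open>
  The free monoid is a copy of the list type, so that lists themselves are not given an addition.
  It is written additively because \<^typ>\<open>'w \<Rightarrow>\<^sub>0 complex\<close> is the monoid algebra of an additively
  written monoid \<^typ>\<open>'w\<close>.
\<close>

datatype 'a free_word = Word (letters: "'a list")

instantiation free_word :: (type) monoid_add
begin

definition zero_free_word :: "'a free_word" where
  "0 = Word []"

definition plus_free_word :: "'a free_word \<Rightarrow> 'a free_word \<Rightarrow> 'a free_word" where
  "v + w = Word (letters v @ letters w)"

instance
  by standard (simp_all add: zero_free_word_def plus_free_word_def)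

end

type_synonym 'a free_alg = "'a free_word \<Rightarrow>\<^sub>0 complex"

definition free_algebra :: "'a set \<Rightarrow> 'a free_alg ring" where
  "free_algebra G =
     \<lparr>carrier = {p. \<forall>w \<in> Poly_Mapping.keys p. set (letters w) \<subseteq> G},
      monoid.mult = times, one = 1, zero = 0, add = plus\<rparr>"

definition gen :: "'a \<Rightarrow> 'a free_alg" where
  "gen g = Poly_Mapping.single (Word [g]) 1"

definition scalar :: "complex \<Rightarrow> 'a free_alg" where
  "scalar c = Poly_Mapping.single 0 c"

definition relabel :: "('a \<Rightarrow> 'a) \<Rightarrow> 'a free_alg \<Rightarrow> 'a free_alg" where
  "relabel f p = (\<Sum>w\<in>Poly_Mapping.keys p. Poly_Mapping.single (map_free_word f w) (Poly_Mapping.lookup p w))"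


section \<open>Left modules over a noncommutative ring\<close>

text \<open>
  The record \<^typ>\<open>('a, 'b) module\<close> and the predicate \<^const>\<open>submodule\<close> make sense over any ring
  (unlike the locale \<^locale>\<open>module\<close>, which asks for a commutative one). The ring operations
  \<open>mult\<close> and \<open>one\<close> of the record play no role for modules.
  A ring containing the complex numbers as central scalars is intended below, so that additive maps
  compatible with the action are complex linear.
\<close>

definition regular_module :: "'a ring \<Rightarrow> ('a, 'a) module" where
  "regular_module R =
     \<lparr>carrier = carrier R, monoid.mult = undefined, one = undefined,
      zero = \<zero>\<^bsub>R\<^esub>, add = add R, smult = monoid.mult R\<rparr>"

definition generated_submodule :: "'a ring \<Rightarrow> ('a, 'b) module \<Rightarrow> 'b set \<Rightarrow> 'b set" where
  "generated_submodule R M S = \<Inter>{H. submodule H R M \<and> S \<subseteq> H}"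

definition quotient_module :: "('a, 'b) module \<Rightarrow> 'b set \<Rightarrow> ('a, 'b set) module" where
  "quotient_module M H =
     \<lparr>carrier = a_rcosets\<^bsub>M\<^esub> H, monoid.mult = undefined, one = undefined,
      zero = H, add = set_add M,
      smult = (\<lambda>a X. \<Union>x\<in>X. H +>\<^bsub>M\<^esub> (a \<odot>\<^bsub>M\<^esub> x))\<rparr>"

definition sum_of_proper_submodules :: "'a ring \<Rightarrow> ('a, 'b) module \<Rightarrow> 'b set" where
  "sum_of_proper_submodules R M =
     generated_submodule R M (\<Union>{H. submodule H R M \<and> H \<noteq> carrier M})"

definition restrict_scalars :: "('a \<Rightarrow> 'c) \<Rightarrow> ('c, 'b) module \<Rightarrow> ('a, 'b) module" where
  "restrict_scalars f M =
     \<lparr>carrier = carrier M, monoid.mult = undefined, one = undefined,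
      zero = \<zero>\<^bsub>M\<^esub>, add = add M, smult = (\<lambda>a x. f a \<odot>\<^bsub>M\<^esub> x)\<rparr>"

definition module_iso :: "'a ring \<Rightarrow> ('a, 'b) module \<Rightarrow> ('a, 'c) module \<Rightarrow> ('b \<Rightarrow> 'c) set" where
  "module_iso R M M' =
     {\<phi>. bij_betw \<phi> (carrier M) (carrier M') \<and>
         (\<forall>x\<in>carrier M. \<forall>y\<in>carrier M. \<phi> (x \<oplus>\<^bsub>M\<^esub> y) = \<phi> x \<oplus>\<^bsub>M'\<^esub> \<phi> y) \<and>
         (\<forall>a\<in>carrier R. \<forall>x\<in>carrier M. \<phi> (a \<odot>\<^bsub>M\<^esub> x) = a \<odot>\<^bsub>M'\<^esub> \<phi> x)}"


section \<open>The Yangian of a parity sequence\<close>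

text \<open>Parity sequences are indexed from 1; values outside \<open>{1..m + n}\<close> are irrelevant.\<close>

definition parity_sequence :: "nat \<Rightarrow> nat \<Rightarrow> (nat \<Rightarrow> nat) \<Rightarrow> bool" where
  "parity_sequence m n s \<longleftrightarrow>
     (\<forall>i\<in>{1..m + n}. s i = 0 \<or> s i = 1) \<and> card {i\<in>{1..m + n}. s i = 0} = m"

text \<open>The letter \<open>(i, j, r)\<close> stands for the generator $t_{ij}^{(r)}$.\<close>

type_synonym letter = "nat \<times> nat \<times> nat"

definition yangian_letters :: "nat \<Rightarrow> letter set" where
  "yangian_letters N = {1..N} \<times> {1..N} \<times> {1..}"

text \<open>The coefficient of $u^{-r}$ in $t_{ij}(u)$, including $r = 0$:\<close>

definition tcoeff :: "nat \<Rightarrow> nat \<Rightarrow> nat \<Rightarrow> letter free_alg" where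
  "tcoeff i j r = (if r = 0 then (if i = j then 1 else 0) else gen (i, j, r))"

text \<open>The super-commutator of the coefficients $t_{ij}^{(p)}$ and $t_{kl}^{(q)}$:\<close>

definition tbracket ::
  "(nat \<Rightarrow> nat) \<Rightarrow> nat \<Rightarrow> nat \<Rightarrow> nat \<Rightarrow> nat \<Rightarrow> nat \<Rightarrow> nat \<Rightarrow> letter free_alg" where
  "tbracket s i j p k l q =
     tcoeff i j p * tcoeff k l q
     - (- 1) ^ ((s i + s j) * (s k + s l)) * (tcoeff k l q * tcoeff i j p)"

text \<open>
  The coefficient of $u^{-p} v^{-q}$ in the defining relation multiplied by $u - v$, that is, in
  $(u - v) [t_{ij}(u), t_{kl}(v)] - (-1)^{\dots} (t_{kj}(u) t_{il}(v) - t_{kj}(v) t_{il}(u))$.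
  The remaining coefficients, those of $u v^{-q}$ and $u^{-p} v$, are super-commutators with
  $t_{ij}^{(0)} = \delta_{ij}$ or $t_{kl}^{(0)} = \delta_{kl}$ and vanish identically.
\<close>

definition yangian_relator ::
  "(nat \<Rightarrow> nat) \<Rightarrow> nat \<Rightarrow> nat \<Rightarrow> nat \<Rightarrow> nat \<Rightarrow> nat \<Rightarrow> nat \<Rightarrow> letter free_alg" where
  "yangian_relator s i j k l p q =
     tbracket s i j (p + 1) k l q - tbracket s i j p k l (q + 1)
     - (- 1) ^ (s i * s j + s i * s k + s j * s k)
       * (tcoeff k j p * tcoeff i l q - tcoeff k j q * tcoeff i l p)"

definition yangian_ideal :: "nat \<Rightarrow> (nat \<Rightarrow> nat) \<Rightarrow> letter free_alg set" where
  "yangian_ideal N s =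
     genideal (free_algebra (yangian_letters N))
       {yangian_relator s i j k l p q | i j k l p q.
          i \<in> {1..N} \<and> j \<in> {1..N} \<and> k \<in> {1..N} \<and> l \<in> {1..N}}"

definition yangian :: "nat \<Rightarrow> (nat \<Rightarrow> nat) \<Rightarrow> letter free_alg set ring" where
  "yangian N s = free_algebra (yangian_letters N) Quot yangian_ideal N s"

definition yangian_class :: "nat \<Rightarrow> (nat \<Rightarrow> nat) \<Rightarrow> letter free_alg \<Rightarrow> letter free_alg set" where
  "yangian_class N s x = yangian_ideal N s +>\<^bsub>free_algebra (yangian_letters N)\<^esub> x"

text \<open>
  The map of Yangians $t_{ab}(u) \mapsto t_{\sigma(a)\,\sigma(b)}(u)$. Elements of a Yangian are
  cosets; if \<open>\<sigma>\<close> is a permutation of \<open>{1..N}\<close>, then relabelling carries the ideal of the sequence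
  \<open>s \<circ> \<sigma>\<close> onto that of \<open>s\<close>, so the elementwise image of a coset is again a coset.
\<close>

definition yangian_relabel ::
  "(nat \<Rightarrow> nat) \<Rightarrow> letter free_alg set \<Rightarrow> letter free_alg set" where
  "yangian_relabel \<sigma> X = relabel (\<lambda>(a, b, r). (\<sigma> a, \<sigma> b, r)) ` X"


section \<open>Highest weight modules\<close>

text \<open>
  A series in $u^{-1}$ is a formal power series whose variable \<^const>\<open>fps_X\<close> is $u^{-1}$.
  Highest weights are indexed from 1; components outside \<open>{1..N}\<close> are irrelevant.
\<close>

definition verma_left_ideal ::
  "nat \<Rightarrow> (nat \<Rightarrow> nat) \<Rightarrow> (nat \<Rightarrow> complex fps) \<Rightarrow> letter free_alg set set" where
  "verma_left_ideal N s lam =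
     generated_submodule (yangian N s) (regular_module (yangian N s))
       ({yangian_class N s (tcoeff a b r) | a b r. 1 \<le> a \<and> a < b \<and> b \<le> N} \<union>
        {yangian_class N s (tcoeff j j r - scalar (fps_nth (lam j) r)) | j r. 1 \<le> j \<and> j \<le> N})"

type_synonym verma_carrier = "letter free_alg set set"

definition verma_module ::
  "nat \<Rightarrow> (nat \<Rightarrow> nat) \<Rightarrow> (nat \<Rightarrow> complex fps) \<Rightarrow>
     (letter free_alg set, verma_carrier) module" where
  "verma_module N s lam =
     quotient_module (regular_module (yangian N s)) (verma_left_ideal N s lam)"

text \<open>
  The unique maximal proper submodule of a Verma module is the sum of all its proper submodules:
  each of them is a sum of weight spaces for the $t_{jj}^{(1)}$ and does not meet the
  one-dimensional space of the highest weight, so their sum is proper. The quotient by it is the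
  irreducible quotient of the Verma module.
\<close>

definition irreducible_hw_module ::
  "nat \<Rightarrow> (nat \<Rightarrow> nat) \<Rightarrow> (nat \<Rightarrow> complex fps) \<Rightarrow>
     (letter free_alg set, verma_carrier set) module" where
  "irreducible_hw_module N s lam =
     quotient_module (verma_module N s lam)
       (sum_of_proper_submodules (yangian N s) (verma_module N s lam))"

text \<open>$(1 + c_1 u^{-1}) \cdots (1 + c_k u^{-1})$\<close>

definition weight_poly :: "nat \<Rightarrow> (nat \<Rightarrow> complex) \<Rightarrow> complex fps" where
  "weight_poly k c = (\<Prod>r = 1..k. 1 + fps_const (c r) * fps_X)"

text \<open>
  An irreducible module for the sequence \<open>s\<close>, regarded via the relabelling by the transposition
  $(i, i+1)$ as a module over the Yangian of the sequence \<open>s'\<close> (\<open>s\<close> with its entries at \<open>i\<close> and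
  \<open>i + 1\<close> interchanged), is isomorphic to an irreducible module for \<open>s'\<close>.
\<close>

definition isomorphic_after_swap ::
  "nat \<Rightarrow> nat \<Rightarrow> (nat \<Rightarrow> nat) \<Rightarrow> (nat \<Rightarrow> complex fps)
     \<Rightarrow> (nat \<Rightarrow> nat) \<Rightarrow> (nat \<Rightarrow> complex fps) \<Rightarrow> bool" where
  "isomorphic_after_swap N i s lam s' \<mu> \<longleftrightarrow>
     module_iso (yangian N s')
       (restrict_scalars (yangian_relabel (Transposition.transpose i (i + 1)))
          (irreducible_hw_module N s lam))
       (irreducible_hw_module N s' \<mu>) \<noteq> {}"

end

theory Submission
  imports Defs
begin

text \<open>
  Write $p, q$ for the positions $i, i + 1$, let \<open>\<epsilon>\<close> be $(-1)^{s_p}$ and let \<open>\<xi>\<close> be the highest vector of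
  \<open>L = L(\<lambda>)\<close>. The isomorphism comes from a nonzero vector \<open>\<zeta>\<close> of \<open>L\<close> which is highest for the order of
  indices with $p$ and $q$ interchanged: it is killed by $t_{qp}(u)$ and by all $t_{ab}(u)$ with
  $a < b$ and $(a, b)$ different from $(p, q)$, and it is an eigenvector of all $t_{jj}(u)$ with the
  eigenvalues named in the theorem. As \<open>L\<close> is irreducible, it is then a quotient of the Verma module of the
  new weight by a maximal submodule, and a Verma module has only one of these.
  If \<open>L\<close> is zero, then so is the irreducible module of the new weight, because otherwise that
  module could be reflected back.

  The vector is found in the subspace \<open>W\<close> generated from \<open>\<xi>\<close> by the four series with indices in
  $\{p, q\}$. Every vector of \<open>W\<close> satisfies all highest weight conditions that do not involve
  these four series. Since \<open>\<lambda>\<^sub>p\<close> and \<open>\<lambda>\<^sub>q\<close> are polynomials of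
  degree \<open>k\<close> in $u^{-1}$, the vectors $t_{qp}^{(r)}\<xi>$ with $r > k$ are singular of lower weight and
  hence zero in \<open>L\<close>; it follows that $u^k t_{ij}(u)$ acts on \<open>W\<close> as a polynomial in \<open>u\<close>, so that the
  defining relations may be used at complex numbers \<open>u\<close> and \<open>v\<close> (lemma \<open>RTT\<close>).

  Write $A, B, C, D$ for $u^k t_{ij}(u)$ with $(i, j)$ equal to $(p, p), (p, q), (q, p), (q, q)$.
  The roots of the eigenvalue of $A$ on \<open>\<xi>\<close> are the numbers $-a_r$. In the algebraic Bethe ansatz
  for $C(-a_1) \cdots C(-a_k)\<xi>$ there are therefore no unwanted terms: this is an eigenvector
  of $A(u)$, and each factor moves one root by \<open>\<epsilon>\<close> (\<open>chain_eigen\<close>). The same holds for the roots $-b_r$ and $D$.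
  On the other hand, words in the coefficients of $C$ straighten as in an
  exterior algebra with $k$ generators: all words of length $k + 1$ kill \<open>\<xi>\<close>, and all words of
  length \<open>k\<close> give multiples of one vector \<open>\<zeta>\<close> (\<open>lower_word_straighten\<close>). So $C$ kills \<open>\<zeta>\<close>, and both Bethe
  vectors are multiples of \<open>\<zeta>\<close>, which makes \<open>\<zeta>\<close> an eigenvector of both $A$ and $D$ as soon as both Bethe vectors are nonzero.

  They are nonzero because the roots are disjoint. If multiplication by $C(-a_r)$ gives zero for the first
  time at a nonzero vector \<open>x\<close> of the chain, then all of $A, B, C, D$ at the point $-a_r$ kill \<open>x\<close>
  (\<open>bethe_chain_nonzero\<close>). The vectors killed by all four at one point are stable under the
  coefficients of $B$, and these lead from \<open>x\<close> back to a nonzero multiple of \<open>\<xi>\<close>; so \<open>\<xi>\<close> is such a vector, and $-a_r$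
  is a common root (\<open>no_common_kernel\<close>).

  All modules are treated as quotients of the free algebra by left ideals, so that a vector $x\<xi>$ is
  an element \<open>x\<close> of the free algebra and an identity between vectors is membership of a
  difference in a left ideal.
\<close>

section \<open>The free algebra as a complex algebra\<close>

definition cscale :: "complex \<Rightarrow> 'a free_alg \<Rightarrow> 'a free_alg" (infixr "\<star>" 75) where
  "c \<star> x = scalar c * x"

definition word :: "'a list \<Rightarrow> 'a free_alg" where
  "word ls = Poly_Mapping.single (Word ls) 1"

abbreviation falg :: "nat \<Rightarrow> letter free_alg set" where
  "falg N \<equiv> carrier (free_algebra (yangian_letters N))"

lemma free_algebra_sel [simp]:
  "monoid.mult (free_algebra G) = times" "one (free_algebra G) = 1"
  "zero (free_algebra G) = 0" "add (free_algebra G) = plus"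
  by (simp_all add: free_algebra_def)

lemma sum_single_lookup: "(\<Sum>w\<in>Poly_Mapping.keys x. Poly_Mapping.single w (Poly_Mapping.lookup x w)) = x"
proof (rule poly_mapping_eqI)
  fix v
  have "Poly_Mapping.lookup (\<Sum>w\<in>Poly_Mapping.keys x. Poly_Mapping.single w (Poly_Mapping.lookup x w)) v
      = (\<Sum>w\<in>Poly_Mapping.keys x. if w = v then Poly_Mapping.lookup x v else 0)"
    unfolding lookup_sum by (intro sum.cong) (auto simp: lookup_single when_def)
  also have "\<dots> = Poly_Mapping.lookup x v"
    by (simp add: sum.delta in_keys_iff)
  finally show "Poly_Mapping.lookup (\<Sum>w\<in>Poly_Mapping.keys x. Poly_Mapping.single w (Poly_Mapping.lookup x w)) v
    = Poly_Mapping.lookup x v" .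
qed

lemma scalar_central: "x * scalar c = scalar c * (x :: 'a free_alg)"
proof -
  have 1: "Poly_Mapping.single w d * scalar c = scalar c * Poly_Mapping.single w d" for w :: "'a free_word" and d
    by (simp add: scalar_def mult_single mult.commute)
  show ?thesis
    by (subst (1 2) sum_single_lookup[of x, symmetric]) (simp add: sum_distrib_left sum_distrib_right 1)
qed

lemma scalar_simps:
  "scalar 0 = 0" "scalar 1 = 1" "scalar (c + d) = scalar c + scalar d"
  "scalar (c - d) = scalar c - scalar d" "scalar (- c) = - scalar c" "scalar (c * d) = scalar c * scalar d"
  by (simp_all add: scalar_def single_add single_diff single_uminus mult_single)

lemma cscale_simps:
  "c \<star> (x + y) = c \<star> x + c \<star> y" "c \<star> (x - y) = c \<star> x - c \<star> y" "c \<star> (- x) = - (c \<star> x)"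
  "(c + d) \<star> x = c \<star> x + d \<star> x" "(c - d) \<star> x = c \<star> x - d \<star> x" "(- c) \<star> x = - (c \<star> x)"
  "c \<star> d \<star> x = (c * d) \<star> x" "0 \<star> x = 0" "1 \<star> x = x" "c \<star> 0 = 0"
  "(c \<star> x) * y = c \<star> (x * y)" "x * (c \<star> y) = c \<star> (x * y)"
proof -
  show "x * (c \<star> y) = c \<star> (x * y)"
    unfolding cscale_def by (metis scalar_central mult.assoc)
qed (simp_all add: cscale_def scalar_simps algebra_simps)

lemma cscale_sum: "c \<star> (\<Sum>i\<in>A. f i) = (\<Sum>i\<in>A. c \<star> f i)"
  by (simp add: cscale_def sum_distrib_left)

lemma cscale_sum_left: "(\<Sum>i\<in>A. f i) \<star> x = (\<Sum>i\<in>A. f i \<star> x)"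
  by (induction A rule: infinite_finite_induct) (simp_all add: cscale_simps)

lemma scalar_eq_cscale: "scalar c = c \<star> 1"
  by (simp add: cscale_def)

lemma word_simps [simp]: "word [] = 1" "word (g # w) = gen g * word w"
  by (simp_all add: word_def gen_def mult_single plus_free_word_def flip: zero_free_word_def single_one)

lemma sum_cscale_word:
  "(\<Sum>w\<in>Poly_Mapping.keys x. Poly_Mapping.lookup x w \<star> word (letters w)) = x"
  by (subst (3) sum_single_lookup[of x, symmetric], intro sum.cong)
     (simp_all add: cscale_def scalar_def word_def mult_single)

lemma carrier_free_algebra:
  "x \<in> carrier (free_algebra G) \<longleftrightarrow> (\<forall>w \<in> Poly_Mapping.keys x. set (letters w) \<subseteq> G)"
  by (simp add: free_algebra_def)

lemma free_algebra_closed [simp, intro]: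
  fixes G :: "'a set"
  defines "A \<equiv> carrier (free_algebra G)"
  shows "0 \<in> A" "1 \<in> A" "x \<in> A \<Longrightarrow> y \<in> A \<Longrightarrow> x + y \<in> A" "x \<in> A \<Longrightarrow> y \<in> A \<Longrightarrow> x * y \<in> A"
    "x \<in> A \<Longrightarrow> - x \<in> A" "x \<in> A \<Longrightarrow> y \<in> A \<Longrightarrow> x - y \<in> A" "scalar c \<in> A"
    "x \<in> A \<Longrightarrow> c \<star> x \<in> A"
proof -
  have zero: "0 \<in> A" and one: "1 \<in> A" and sc: "scalar c \<in> A" for c
    by (auto simp: A_def carrier_free_algebra scalar_def zero_free_word_def split: if_splits)
  have add: "x + y \<in> A" if "x \<in> A" "y \<in> A" for x y
    using that keys_add[of x y] unfolding A_def carrier_free_algebra by blast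
  have mult: "x * y \<in> A" if "x \<in> A" "y \<in> A" for x y
  proof -
    have "set (letters w) \<subseteq> G" if w: "w \<in> Poly_Mapping.keys (x * y)" for w
    proof -
      obtain a b where "w = a + b" "a \<in> Poly_Mapping.keys x" "b \<in> Poly_Mapping.keys y"
        using w keys_mult[of x y] by blast
      then show ?thesis using \<open>x \<in> A\<close> \<open>y \<in> A\<close> unfolding A_def carrier_free_algebra
        by (auto simp: plus_free_word_def)
    qed
    then show ?thesis by (auto simp: A_def carrier_free_algebra)
  qed
  have scale: "c \<star> x \<in> A" if "x \<in> A" for c x
    using mult[OF sc that] by (simp add: cscale_def)
  have minus: "- x \<in> A" if "x \<in> A" for x
    using scale[OF that, of "-1"] by (simp add: cscale_simps)
  have diff: "x - y \<in> A" if "x \<in> A" "y \<in> A" for x y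
    using add[OF that(1) minus[OF that(2)]] by simp
  show "0 \<in> A" "1 \<in> A" "x \<in> A \<Longrightarrow> y \<in> A \<Longrightarrow> x + y \<in> A" "x \<in> A \<Longrightarrow> y \<in> A \<Longrightarrow> x * y \<in> A"
    "x \<in> A \<Longrightarrow> - x \<in> A" "x \<in> A \<Longrightarrow> y \<in> A \<Longrightarrow> x - y \<in> A" "scalar c \<in> A"
    "x \<in> A \<Longrightarrow> c \<star> x \<in> A"
    by (fact zero one add mult minus diff sc scale)+
qed

lemma free_algebra_sum [intro]:
  "(\<And>i. i \<in> B \<Longrightarrow> f i \<in> carrier (free_algebra G)) \<Longrightarrow> sum f B \<in> carrier (free_algebra G)"
  by (induction B rule: infinite_finite_induct) auto

lemma gen_closed [simp, intro]: "g \<in> G \<Longrightarrow> gen g \<in> carrier (free_algebra G)"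
  by (auto simp: gen_def carrier_free_algebra)

lemma word_closed [simp, intro]: "set w \<subseteq> G \<Longrightarrow> word w \<in> carrier (free_algebra G)"
  by (auto simp: word_def carrier_free_algebra)

lemma free_algebra_induct [consumes 1, case_names zero add word]:
  assumes "x \<in> carrier (free_algebra G)"
    and zero: "P 0" and add: "\<And>x y. P x \<Longrightarrow> P y \<Longrightarrow> P (x + y)"
    and word: "\<And>c w. set w \<subseteq> G \<Longrightarrow> P (c \<star> word w)"
  shows "P x"
proof -
  have "P (\<Sum>w\<in>B. Poly_Mapping.lookup x w \<star> word (letters w))" if "finite B" "B \<subseteq> Poly_Mapping.keys x" for B
    using that
  proof (induction B rule: finite_induct)
    case empty then show ?case using zero by simp
  next
    case (insert w B)
    then show ?case using assms(1) by (auto intro!: add word simp: carrier_free_algebra)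
  qed
  from this[of "Poly_Mapping.keys x"] show ?thesis by (simp add: sum_cscale_word)
qed

lemma tcoeff_closed [simp, intro]:
  "i \<in> {1..N} \<Longrightarrow> j \<in> {1..N} \<Longrightarrow> tcoeff i j r \<in> falg N"
  by (auto simp: tcoeff_def yangian_letters_def)

lemma ring_free_algebra: "ring (free_algebra G)"
proof (rule ringI)
  show "abelian_group (free_algebra G)"
  proof (rule abelian_groupI)
    fix x assume x: "x \<in> carrier (free_algebra G)"
    show "\<exists>y\<in>carrier (free_algebra G). y \<oplus>\<^bsub>free_algebra G\<^esub> x = \<zero>\<^bsub>free_algebra G\<^esub>"
      by (rule bexI[of _ "- x"]) (use x in auto)
  qed (auto simp: algebra_simps)
  show "monoid (free_algebra G)"
    by (rule monoidI) (auto simp: algebra_simps)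
qed (auto simp: algebra_simps)

section \<open>Relabelling of the generators\<close>

lemma relabel_superset:
  assumes "finite B" "Poly_Mapping.keys x \<subseteq> B"
  shows "relabel f x = (\<Sum>w\<in>B. Poly_Mapping.single (map_free_word f w) (Poly_Mapping.lookup x w))"
  unfolding relabel_def using assms by (intro sum.mono_neutral_left) (auto simp: in_keys_iff)

lemma relabel_add: "relabel f (x + y) = relabel f x + relabel f y"
proof -
  let ?B = "Poly_Mapping.keys x \<union> Poly_Mapping.keys y"
  show ?thesis
    using keys_add[of x y]
    by (subst (1 2 3) relabel_superset[where B = ?B]) (auto simp: lookup_add single_add sum.distrib)
qed

lemma relabel_zero [simp]: "relabel f 0 = 0"
  by (simp add: relabel_def)

lemma relabel_sum: "relabel f (\<Sum>i\<in>A. g i) = (\<Sum>i\<in>A. relabel f (g i))"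
  by (induction A rule: infinite_finite_induct) (auto simp: relabel_add)

lemma relabel_single: "relabel f (Poly_Mapping.single w c) = Poly_Mapping.single (map_free_word f w) c"
  by (simp add: relabel_def)

lemma relabel_word: "relabel f (c \<star> word w) = c \<star> word (map f w)"
  by (simp add: cscale_def scalar_def word_def mult_single relabel_single)

lemma relabel_mult: "relabel f (x * y) = relabel f x * relabel f y"
proof -
  have 1: "relabel f (Poly_Mapping.single v c * Poly_Mapping.single w d)
      = relabel f (Poly_Mapping.single v c) * relabel f (Poly_Mapping.single w d)" for v w c d
    by (cases v; cases w) (simp add: mult_single relabel_single plus_free_word_def)
  let ?s = "\<lambda>x. \<Sum>w\<in>Poly_Mapping.keys x. Poly_Mapping.single w (Poly_Mapping.lookup x w)"
  have "relabel f (?s x * ?s y) = relabel f (?s x) * relabel f (?s y)"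
    by (simp add: sum_product relabel_sum 1)
  then show ?thesis by (simp add: sum_single_lookup)
qed

lemma relabel_scalar [simp]: "relabel f (scalar c) = scalar c"
  by (simp add: scalar_def relabel_single zero_free_word_def)

lemma relabel_one [simp]: "relabel f 1 = 1"
  using relabel_scalar[of f 1] by (simp add: scalar_simps)

lemma relabel_cscale: "relabel f (c \<star> x) = c \<star> relabel f x"
  by (simp add: cscale_def relabel_mult)

lemma relabel_uminus: "relabel f (- x) = - relabel f x"
  using relabel_cscale[of f "-1" x] by (simp add: cscale_simps)

lemma relabel_diff: "relabel f (x - y) = relabel f x - relabel f y"
  using relabel_add[of f x "- y"] by (simp add: relabel_uminus)

lemma relabel_neg_one_power: "relabel f ((- 1) ^ n) = (- 1) ^ n"
  by (induction n) (simp_all add: relabel_mult relabel_uminus)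

lemma relabel_gen: "relabel f (gen g) = gen (f g)"
  by (simp add: gen_def relabel_single)

lemma relabel_closed:
  assumes "x \<in> carrier (free_algebra G)" "\<And>g. g \<in> G \<Longrightarrow> f g \<in> G'"
  shows "relabel f x \<in> carrier (free_algebra G')"
  using assms(1)
proof (induction rule: free_algebra_induct)
  case (word c w)
  have "set (map f w) \<subseteq> G'" using word assms(2) by auto
  then show ?case by (metis relabel_word word_closed free_algebra_closed(8))
qed (auto simp: relabel_add)

lemma relabel_relabel:
  assumes "x \<in> carrier (free_algebra G)" "\<And>g. g \<in> G \<Longrightarrow> f (h g) = g"
  shows "relabel f (relabel h x) = x"
  using assms(1)
proof (induction rule: free_algebra_induct)
  case (word c w)
  then have "map (f \<circ> h) w = w" using assms(2) by (intro map_idI) auto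
  then show ?case by (simp add: relabel_word)
qed (auto simp: relabel_add)

section \<open>Quotients of left modules\<close>

locale left_module = R?: ring R + M?: abelian_group M
  for R :: "'a ring" and M :: "('a, 'b) module" +
  assumes smult_closed: "\<lbrakk>a \<in> carrier R; x \<in> carrier M\<rbrakk> \<Longrightarrow> a \<odot>\<^bsub>M\<^esub> x \<in> carrier M"
    and smult_l_distr: "\<lbrakk>a \<in> carrier R; b \<in> carrier R; x \<in> carrier M\<rbrakk> \<Longrightarrow>
      (a \<oplus>\<^bsub>R\<^esub> b) \<odot>\<^bsub>M\<^esub> x = a \<odot>\<^bsub>M\<^esub> x \<oplus>\<^bsub>M\<^esub> b \<odot>\<^bsub>M\<^esub> x"
    and smult_r_distr: "\<lbrakk>a \<in> carrier R; x \<in> carrier M; y \<in> carrier M\<rbrakk> \<Longrightarrow>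
      a \<odot>\<^bsub>M\<^esub> (x \<oplus>\<^bsub>M\<^esub> y) = a \<odot>\<^bsub>M\<^esub> x \<oplus>\<^bsub>M\<^esub> a \<odot>\<^bsub>M\<^esub> y"
    and smult_assoc: "\<lbrakk>a \<in> carrier R; b \<in> carrier R; x \<in> carrier M\<rbrakk> \<Longrightarrow>
      (a \<otimes>\<^bsub>R\<^esub> b) \<odot>\<^bsub>M\<^esub> x = a \<odot>\<^bsub>M\<^esub> (b \<odot>\<^bsub>M\<^esub> x)"
    and smult_one: "x \<in> carrier M \<Longrightarrow> \<one>\<^bsub>R\<^esub> \<odot>\<^bsub>M\<^esub> x = x"

lemma quotient_module_sel [simp]:
  "carrier (quotient_module M H) = a_rcosets\<^bsub>M\<^esub> H" "zero (quotient_module M H) = H"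
  "add (quotient_module M H) = set_add M"
  "smult (quotient_module M H) = (\<lambda>a X. \<Union>x\<in>X. H +>\<^bsub>M\<^esub> (a \<odot>\<^bsub>M\<^esub> x))"
  by (simp_all add: quotient_module_def)

context left_module
begin

lemma submodule_abelian_subgroup:
  "submodule H R M \<Longrightarrow> abelian_subgroup H M"
  by (rule abelian_subgroupI3) (simp_all add: additive_subgroup_def submodule_def M.abelian_group_axioms)

context
  fixes H
  assumes H: "submodule H R M"
begin

interpretation H: abelian_subgroup H M
  using H by (rule submodule_abelian_subgroup)

lemma coset_add:
  "x \<in> carrier M \<Longrightarrow> y \<in> carrier M \<Longrightarrow> (H +>\<^bsub>M\<^esub> x) <+>\<^bsub>M\<^esub> (H +>\<^bsub>M\<^esub> y) = H +>\<^bsub>M\<^esub> (x \<oplus>\<^bsub>M\<^esub> y)"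
  by (rule H.a_rcos_sum)

lemma coset_eq_zero_iff:
  assumes "x \<in> carrier M" shows "H +>\<^bsub>M\<^esub> x = H \<longleftrightarrow> x \<in> H"
  using assms H.a_rcos_const H.a_rcos_self by blast

text \<open>
  The union that defines the action runs over all representatives of a coset; the cosets in it agree because \<open>H\<close> is stable under the ring.
\<close>

lemma coset_smult:
  assumes a: "a \<in> carrier R" and x: "x \<in> carrier M"
  shows "a \<odot>\<^bsub>quotient_module M H\<^esub> (H +>\<^bsub>M\<^esub> x) = H +>\<^bsub>M\<^esub> (a \<odot>\<^bsub>M\<^esub> x)"
proof -
  have "H +>\<^bsub>M\<^esub> (a \<odot>\<^bsub>M\<^esub> y) = H +>\<^bsub>M\<^esub> (a \<odot>\<^bsub>M\<^esub> x)" if y: "y \<in> H +>\<^bsub>M\<^esub> x" for y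
  proof -
    obtain h where h: "h \<in> H" "y = h \<oplus>\<^bsub>M\<^esub> x"
      using y unfolding a_r_coset_def r_coset_def by auto
    have hM: "h \<in> carrier M" using h(1) H.a_subset by blast
    have ah: "a \<odot>\<^bsub>M\<^esub> h \<in> H" using H a h(1) by (rule submodule.smult_closed)
    have "a \<odot>\<^bsub>M\<^esub> y = a \<odot>\<^bsub>M\<^esub> h \<oplus>\<^bsub>M\<^esub> a \<odot>\<^bsub>M\<^esub> x"
      using a x hM h(2) by (simp add: smult_r_distr)
    then have "a \<odot>\<^bsub>M\<^esub> y \<in> H +>\<^bsub>M\<^esub> (a \<odot>\<^bsub>M\<^esub> x)"
      using ah by (auto simp: a_r_coset_def r_coset_def)
    then show ?thesis
      using M.a_repr_independence[OF _ smult_closed[OF a x] H.a_subgroup] by simp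
  qed
  moreover have "x \<in> H +>\<^bsub>M\<^esub> x" using x by (rule H.a_rcos_self)
  ultimately show ?thesis
    unfolding quotient_module_sel by (intro SUP_eq_const) blast+
qed

lemma carrier_quotient: "a_rcosets\<^bsub>M\<^esub> H = (\<lambda>x. H +>\<^bsub>M\<^esub> x) ` carrier M"
  by (auto simp: A_RCOSETS_def RCOSETS_def a_r_coset_def)

lemma left_module_quotient: "left_module R (quotient_module M H)"
proof -
  have zero: "H +>\<^bsub>M\<^esub> \<zero>\<^bsub>M\<^esub> = H"
    using coset_eq_zero_iff H.zero_closed by simp
  have ag: "abelian_group (quotient_module M H)"
  proof (rule abelian_groupI)
    fix X assume "X \<in> carrier (quotient_module M H)"
    then obtain x where x: "x \<in> carrier M" "X = H +>\<^bsub>M\<^esub> x" by (auto simp: carrier_quotient)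
    have "(H +>\<^bsub>M\<^esub> (\<ominus>\<^bsub>M\<^esub> x)) <+>\<^bsub>M\<^esub> X = H +>\<^bsub>M\<^esub> \<zero>\<^bsub>M\<^esub>"
      using x by (simp add: coset_add M.l_neg)
    then show "\<exists>Y\<in>carrier (quotient_module M H). Y \<oplus>\<^bsub>quotient_module M H\<^esub> X = \<zero>\<^bsub>quotient_module M H\<^esub>"
      using x(1) by (intro bexI[of _ "H +>\<^bsub>M\<^esub> (\<ominus>\<^bsub>M\<^esub> x)"]) (auto simp: carrier_quotient zero)
  next
    show "\<zero>\<^bsub>quotient_module M H\<^esub> \<in> carrier (quotient_module M H)"
      unfolding quotient_module_sel carrier_quotient by (rule image_eqI[where x = "\<zero>\<^bsub>M\<^esub>"]) (simp_all add: zero)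
  next
    fix X assume "X \<in> carrier (quotient_module M H)"
    then obtain x where x: "x \<in> carrier M" "X = H +>\<^bsub>M\<^esub> x" by (auto simp: carrier_quotient)
    show "\<zero>\<^bsub>quotient_module M H\<^esub> \<oplus>\<^bsub>quotient_module M H\<^esub> X = X"
      using coset_add[OF M.zero_closed x(1)] x by (simp add: zero)
  qed (auto simp: carrier_quotient coset_add M.a_ac)
  have ax: "left_module_axioms R (quotient_module M H)"
  proof (unfold_locales, goal_cases)
    case (1 a X)
    then show ?case
      by (auto simp: carrier_quotient simp del: quotient_module_sel(4) simp: coset_smult smult_closed)
  next
    case (2 a b X)
    then show ?case
      by (auto simp: carrier_quotient simp del: quotient_module_sel(4)
            simp: coset_smult smult_closed smult_l_distr coset_add)
  next
    case (3 a X Y)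
    then show ?case
      by (auto simp: carrier_quotient simp del: quotient_module_sel(4)
            simp: coset_smult smult_closed smult_r_distr coset_add)
  next
    case (4 a b X)
    then show ?case
      by (auto simp: carrier_quotient simp del: quotient_module_sel(4)
            simp: coset_smult smult_closed smult_assoc)
  next
    case (5 X)
    then show ?case
      by (auto simp: carrier_quotient simp del: quotient_module_sel(4) simp: coset_smult smult_one)
  qed
  show ?thesis
    by (intro left_module.intro ag ax R.ring_axioms)
qed

end

lemma zero_smult: "a \<in> carrier R \<Longrightarrow> a \<odot>\<^bsub>M\<^esub> \<zero>\<^bsub>M\<^esub> = \<zero>\<^bsub>M\<^esub>"
  using smult_r_distr[of a "\<zero>\<^bsub>M\<^esub>" "\<zero>\<^bsub>M\<^esub>"] smult_closed[of a "\<zero>\<^bsub>M\<^esub>"]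
  by (metis M.add.l_cancel_one' M.zero_closed M.r_zero)

end

section \<open>Modules as quotients of the free algebra\<close>

definition relators :: "nat \<Rightarrow> (nat \<Rightarrow> nat) \<Rightarrow> letter free_alg set" where
  "relators N s = {yangian_relator s i j k l p q | i j k l p q.
          i \<in> {1..N} \<and> j \<in> {1..N} \<and> k \<in> {1..N} \<and> l \<in> {1..N}}"

lemma neg_one_power_closed [simp]: "(- 1) ^ n \<in> carrier (free_algebra G)"
  by (induction n) auto

lemma tbracket_closed [simp]:
  "i \<in> {1..N} \<Longrightarrow> j \<in> {1..N} \<Longrightarrow> k \<in> {1..N} \<Longrightarrow> l \<in> {1..N} \<Longrightarrow> tbracket s i j p k l q \<in> falg N"
  unfolding tbracket_def
  by (intro free_algebra_closed tcoeff_closed neg_one_power_closed)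

lemma relators_closed: "relators N s \<subseteq> falg N"
  unfolding relators_def yangian_relator_def
  by (auto intro!: free_algebra_closed tbracket_closed tcoeff_closed neg_one_power_closed simp del: atLeastAtMost_iff)

lemma ideal_yangian: "ideal (yangian_ideal N s) (free_algebra (yangian_letters N))"
  unfolding yangian_ideal_def relators_def[symmetric]
  by (rule ring.genideal_ideal[OF ring_free_algebra relators_closed])

lemma relators_subset: "relators N s \<subseteq> yangian_ideal N s"
  unfolding yangian_ideal_def relators_def[symmetric]
  by (rule ring.genideal_self[OF ring_free_algebra relators_closed])

lemma yangian_ideal_minimal:
  "ideal K (free_algebra (yangian_letters N)) \<Longrightarrow> relators N s \<subseteq> K \<Longrightarrow> yangian_ideal N s \<subseteq> K"
  unfolding yangian_ideal_def relators_def[symmetric]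
  by (rule ring.genideal_minimal[OF ring_free_algebra])

lemma ring_yangian: "ring (yangian N s)"
  unfolding yangian_def by (rule ideal.quotient_is_ring[OF ideal_yangian])

lemma yangian_class_hom: "ring_hom_ring (free_algebra (yangian_letters N)) (yangian N s) (yangian_class N s)"
proof -
  have "yangian_class N s = (+>\<^bsub>free_algebra (yangian_letters N)\<^esub>) (yangian_ideal N s)"
    by (rule ext) (simp add: yangian_class_def)
  then show ?thesis
    unfolding yangian_def using ideal.rcos_ring_hom_ring[OF ideal_yangian] by metis
qed

lemma yangian_class_simps:
  assumes "x \<in> falg N" "y \<in> falg N"
  shows "yangian_class N s (x + y) = yangian_class N s x \<oplus>\<^bsub>yangian N s\<^esub> yangian_class N s y"
    "yangian_class N s (x * y) = yangian_class N s x \<otimes>\<^bsub>yangian N s\<^esub> yangian_class N s y"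
    "yangian_class N s x \<in> carrier (yangian N s)"
  using ring_hom_ring.homh[OF yangian_class_hom, of N s] assms
  by (auto simp: ring_hom_def)

lemma carrier_yangian: "carrier (yangian N s) = yangian_class N s ` falg N"
  by (auto simp: yangian_def FactRing_def A_RCOSETS_def RCOSETS_def yangian_class_def a_r_coset_def)

lemma zero_yangian: "\<zero>\<^bsub>yangian N s\<^esub> = yangian_ideal N s"
  by (simp add: yangian_def FactRing_def)

lemma yangian_class_eq_zero_iff:
  "x \<in> falg N \<Longrightarrow> yangian_class N s x = yangian_ideal N s \<longleftrightarrow> x \<in> yangian_ideal N s"
proof -
  assume x: "x \<in> falg N"
  interpret I: ideal "yangian_ideal N s" "free_algebra (yangian_letters N)" by (rule ideal_yangian)
  show ?thesis unfolding yangian_class_def using I.a_rcos_const I.a_rcos_self[OF x] by blast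
qed

definition left_ideal :: "nat \<Rightarrow> letter free_alg set \<Rightarrow> bool" where
  "left_ideal N J \<longleftrightarrow> J \<subseteq> falg N \<and> 0 \<in> J \<and> (\<forall>x\<in>J. \<forall>y\<in>J. x + y \<in> J) \<and> (\<forall>a\<in>falg N. \<forall>x\<in>J. a * x \<in> J)"

definition left_hull :: "nat \<Rightarrow> letter free_alg set \<Rightarrow> letter free_alg set" where
  "left_hull N G = \<Inter>{P. left_ideal N P \<and> G \<subseteq> P}"

text \<open>
  The map \<open>f\<close> is $x \mapsto x\<xi>$ for a cyclic vector \<open>\<xi>\<close> of \<open>M\<close> with annihilator \<open>J\<close>.
  With this notion an iterated quotient is described by one
  left ideal of the free algebra, and its nested cosets need not be opened again.
\<close>

definition presents :: "nat \<Rightarrow> (nat \<Rightarrow> nat) \<Rightarrow> (letter free_alg set, 'b) module \<Rightarrow>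
    (letter free_alg \<Rightarrow> 'b) \<Rightarrow> letter free_alg set \<Rightarrow> bool" where
  "presents N s M f J \<longleftrightarrow> left_module (yangian N s) M \<and> f ` falg N = carrier M \<and>
     (\<forall>x\<in>falg N. \<forall>y\<in>falg N. f (x + y) = f x \<oplus>\<^bsub>M\<^esub> f y) \<and>
     (\<forall>a\<in>falg N. \<forall>x\<in>falg N. f (a * x) = yangian_class N s a \<odot>\<^bsub>M\<^esub> f x) \<and>
     J = {x\<in>falg N. f x = \<zero>\<^bsub>M\<^esub>}"

lemma left_ideal_falg: "left_ideal N (falg N)"
  by (auto simp: left_ideal_def)

lemma left_hull_left_ideal: "G \<subseteq> falg N \<Longrightarrow> left_ideal N (left_hull N G)"
proof -
  assume "G \<subseteq> falg N"
  then have "left_hull N G \<subseteq> falg N"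
    unfolding left_hull_def using left_ideal_falg[of N] by (intro Inter_lower) auto
  then show ?thesis unfolding left_ideal_def[of N "left_hull N G"]
    by (auto simp: left_hull_def left_ideal_def)
qed

lemma left_hull_subset: "G \<subseteq> left_hull N G"
  by (auto simp: left_hull_def)

lemma left_hull_minimal: "left_ideal N P \<Longrightarrow> G \<subseteq> P \<Longrightarrow> left_hull N G \<subseteq> P"
  by (auto simp: left_hull_def)

lemma left_ideal_uminus:
  assumes "left_ideal N J" "x \<in> J" shows "- x \<in> J"
proof -
  have "(- 1) * x \<in> J" using assms unfolding left_ideal_def by (meson free_algebra_closed(2,5))
  then show ?thesis by simp
qed

lemma presents_regular:
  "presents N s (regular_module (yangian N s)) (yangian_class N s) (yangian_ideal N s)"
proof -
  have sel: "carrier (regular_module R) = carrier R" "zero (regular_module R) = zero R"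
    "add (regular_module R) = add R" "smult (regular_module R) = monoid.mult R" for R :: "'c ring"
    by (simp_all add: regular_module_def)
  interpret Y: ring "yangian N s" by (rule ring_yangian)
  have "abelian_group (regular_module (yangian N s))"
    by (rule abelian_groupI) (auto simp: sel Y.a_ac intro: Y.a_inv_closed Y.l_neg)
  then have "left_module (yangian N s) (regular_module (yangian N s))"
    by (intro left_module.intro left_module_axioms.intro Y.ring_axioms)
      (simp_all add: sel Y.l_distr Y.r_distr Y.m_assoc)
  moreover have "yangian_ideal N s = {x \<in> falg N. yangian_class N s x = \<zero>\<^bsub>yangian N s\<^esub>}"
    using yangian_class_eq_zero_iff[of _ N s] ideal.axioms(1)[OF ideal_yangian, of N s]
    by (auto simp: zero_yangian dest: additive_subgroup.a_Hcarr)
  ultimately show ?thesis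
    by (auto simp: presents_def sel carrier_yangian yangian_class_simps)
qed


lemma presents_left_module: "presents N s M f J \<Longrightarrow> left_module (yangian N s) M"
  by (simp add: presents_def)

lemma presents_closed: "presents N s M f J \<Longrightarrow> x \<in> falg N \<Longrightarrow> f x \<in> carrier M"
  by (auto simp: presents_def)

lemma presents_minus:
  assumes "presents N s M f J" "x \<in> falg N"
  shows "f (- x) = \<ominus>\<^bsub>M\<^esub> f x" "f 0 = \<zero>\<^bsub>M\<^esub>"
proof -
  interpret left_module "yangian N s" M using assms(1) by (rule presents_left_module)
  have add: "f (a + b) = f a \<oplus>\<^bsub>M\<^esub> f b" if "a \<in> falg N" "b \<in> falg N" for a b
    using assms(1) that by (auto simp: presents_def)
  have c: "f a \<in> carrier M" if "a \<in> falg N" for a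
    using presents_closed[OF assms(1) that] .
  show z: "f 0 = \<zero>\<^bsub>M\<^esub>"
    using add[of 0 0] c[of 0] M.add.l_cancel_one[of "f 0" "f 0"] by auto
  show "f (- x) = \<ominus>\<^bsub>M\<^esub> f x"
    using add[of "- x" x] c[of x] c[of "- x"] assms(2) z M.minus_equality[of "f (- x)" "f x"] by auto
qed

lemma presents_eq_iff:
  assumes "presents N s M f J" "x \<in> falg N" "y \<in> falg N"
  shows "f x = f y \<longleftrightarrow> x - y \<in> J"
proof -
  interpret left_module "yangian N s" M using assms(1) by (rule presents_left_module)
  have "f (x + (- y)) = f x \<oplus>\<^bsub>M\<^esub> f (- y)"
    using assms unfolding presents_def by blast
  then have "f (x - y) = f x \<ominus>\<^bsub>M\<^esub> f y"
    by (simp add: presents_minus(1)[OF assms(1,3)] M.minus_eq)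
  moreover have "x - y \<in> J \<longleftrightarrow> f (x - y) = \<zero>\<^bsub>M\<^esub>"
    using assms by (auto simp: presents_def)
  ultimately show ?thesis
    using presents_closed[OF assms(1) assms(2)] presents_closed[OF assms(1) assms(3)]
    by (metis M.a_inv_closed M.minus_eq M.minus_equality M.minus_minus M.r_neg)
qed

lemma presents_left_ideal: assumes "presents N s M f J" shows "left_ideal N J"
proof -
  interpret left_module "yangian N s" M using assms(1) by (rule presents_left_module)
  show ?thesis
    using assms presents_minus(2)[OF assms free_algebra_closed(1)] yangian_class_simps(3)
    by (auto simp: left_ideal_def presents_def zero_smult)
qed

lemma presents_submodule_preimage:
  assumes "presents N s M f J" "submodule H (yangian N s) M"
  shows "left_ideal N {x\<in>falg N. f x \<in> H}" "J \<subseteq> {x\<in>falg N. f x \<in> H}" "f ` {x\<in>falg N. f x \<in> H} = H"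
proof -
  interpret left_module "yangian N s" M using assms(1) by (rule presents_left_module)
  interpret H: subgroup H "add_monoid M" using assms(2) by (simp add: submodule_def)
  have z: "\<zero>\<^bsub>M\<^esub> \<in> H" using H.one_closed by simp
  have p: "x \<oplus>\<^bsub>M\<^esub> y \<in> H" if "x \<in> H" "y \<in> H" for x y using H.m_closed[OF that] by simp
  have H: "H \<subseteq> carrier M" using H.subset by simp
  show "left_ideal N {x\<in>falg N. f x \<in> H}"
    using assms presents_minus(2)[OF assms(1) free_algebra_closed(1)] yangian_class_simps(3) z p
    by (auto simp: left_ideal_def presents_def submodule_def submodule_axioms_def)
  show "J \<subseteq> {x\<in>falg N. f x \<in> H}" using assms(1) z by (auto simp: presents_def)
  show "f ` {x\<in>falg N. f x \<in> H} = H"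
  proof -
    have "f ` falg N = carrier M" using assms(1) by (simp add: presents_def)
    then have "H \<subseteq> f ` falg N" using H by (simp only:)
    then show ?thesis by fast
  qed
qed

lemma presents_submodule_image:
  assumes M: "presents N s M f J" and P: "left_ideal N P" and "J \<subseteq> P"
  shows "submodule (f ` P) (yangian N s) M" "{x\<in>falg N. f x \<in> f ` P} = P"
proof -
  interpret left_module "yangian N s" M using assms(1) by (rule presents_left_module)
  have sub: "P \<subseteq> falg N" using P by (simp add: left_ideal_def)
  have zero: "\<zero>\<^bsub>M\<^esub> \<in> f ` P"
    using presents_minus(2)[OF M free_algebra_closed(1)] P by (force simp: left_ideal_def)
  have add: "f x \<oplus>\<^bsub>M\<^esub> f y \<in> f ` P" if "x \<in> P" "y \<in> P" for x y
  proof -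
    have "f (x + y) = f x \<oplus>\<^bsub>M\<^esub> f y" using M that sub unfolding presents_def by blast
    moreover have "x + y \<in> P" using that P unfolding left_ideal_def by blast
    ultimately show ?thesis by (metis image_eqI)
  qed
  have inv: "\<ominus>\<^bsub>M\<^esub> f x \<in> f ` P" if "x \<in> P" for x
    using that left_ideal_uminus[OF P that] presents_minus(1)[OF M] sub by (metis image_eqI subsetD)
  have smult: "a \<odot>\<^bsub>M\<^esub> f x \<in> f ` P" if x: "x \<in> P" and a: "a \<in> carrier (yangian N s)" for a x
  proof -
    obtain b where b: "b \<in> falg N" "a = yangian_class N s b" using a by (auto simp: carrier_yangian)
    have "f (b * x) = a \<odot>\<^bsub>M\<^esub> f x" using M x b sub unfolding presents_def by blast
    moreover have "b * x \<in> P" using x b(1) P unfolding left_ideal_def by blast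
    ultimately show ?thesis by (metis image_eqI)
  qed
  show "submodule (f ` P) (yangian N s) M"
  proof (intro submodule.intro subgroup.intro submodule_axioms.intro)
    show "f ` P \<subseteq> carrier (add_monoid M)" using sub presents_closed[OF M] by auto
    show "inv\<^bsub>add_monoid M\<^esub> x \<in> f ` P" if "x \<in> f ` P" for x
      using that inv by (auto simp: a_inv_def)
  qed (use zero add smult in auto)
  have "x \<in> P" if "x \<in> falg N" "f x = f p" "p \<in> P" for x p
  proof -
    have "x - p \<in> P" using that presents_eq_iff[OF M] sub \<open>J \<subseteq> P\<close> by blast
    then have "(x - p) + p \<in> P" using P that(3) unfolding left_ideal_def by blast
    then show ?thesis by simp
  qed
  then show "{x\<in>falg N. f x \<in> f ` P} = P" using sub by auto
qed

lemma presents_quotient: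
  assumes M: "presents N s M f J" and H: "submodule H (yangian N s) M"
  shows "presents N s (quotient_module M H) (\<lambda>x. H +>\<^bsub>M\<^esub> f x) {x\<in>falg N. f x \<in> H}"
proof -
  interpret left_module "yangian N s" M using M by (rule presents_left_module)
  show ?thesis
    unfolding presents_def
  proof (intro conjI ballI)
    have "(\<lambda>x. H +>\<^bsub>M\<^esub> f x) ` falg N = (+>\<^bsub>M\<^esub>) H ` f ` falg N" by (simp only: image_image)
    also have "f ` falg N = carrier M" using M by (simp add: presents_def)
    finally show "(\<lambda>x. H +>\<^bsub>M\<^esub> f x) ` falg N = carrier (quotient_module M H)"
      by (simp only: quotient_module_sel carrier_quotient[OF H])
  next
    fix x y assume xy: "x \<in> falg N" "y \<in> falg N"
    then have f: "f x \<in> carrier M" "f y \<in> carrier M" using presents_closed[OF M] by auto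
    show "H +>\<^bsub>M\<^esub> f (x + y) = (H +>\<^bsub>M\<^esub> f x) \<oplus>\<^bsub>quotient_module M H\<^esub> (H +>\<^bsub>M\<^esub> f y)"
      using M xy f by (simp add: presents_def coset_add[OF H])
    show "H +>\<^bsub>M\<^esub> f (x * y) = yangian_class N s x \<odot>\<^bsub>quotient_module M H\<^esub> (H +>\<^bsub>M\<^esub> f y)"
      using M xy f by (simp add: presents_def coset_smult[OF H] yangian_class_simps(3) del: quotient_module_sel(4))
  next
    show "{x \<in> falg N. f x \<in> H} = {x \<in> falg N. H +>\<^bsub>M\<^esub> f x = \<zero>\<^bsub>quotient_module M H\<^esub>}"
      using coset_eq_zero_iff[OF H presents_closed[OF M]] by auto
  qed (rule left_module_quotient[OF H])
qed

text \<open>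
  Submodules of \<open>M\<close> correspond to the left ideals that contain \<open>J\<close>, and the correspondence
  respects intersections.
\<close>

lemma presents_generated:
  assumes M: "presents N s M f J" and G: "G \<subseteq> falg N"
  shows "generated_submodule (yangian N s) M (f ` G) = f ` left_hull N (J \<union> G)"
proof
  have JG: "J \<union> G \<subseteq> falg N" using G presents_left_ideal[OF M] by (auto simp: left_ideal_def)
  show "generated_submodule (yangian N s) M (f ` G) \<subseteq> f ` left_hull N (J \<union> G)"
    unfolding generated_submodule_def
    using presents_submodule_image(1)[OF M left_hull_left_ideal[OF JG]] left_hull_subset[of "J \<union> G" N] by blast
  show "f ` left_hull N (J \<union> G) \<subseteq> generated_submodule (yangian N s) M (f ` G)"
    unfolding generated_submodule_def
  proof (rule Inter_greatest)
    fix H assume H: "H \<in> {H. submodule H (yangian N s) M \<and> f ` G \<subseteq> H}"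
    then have "left_hull N (J \<union> G) \<subseteq> {x\<in>falg N. f x \<in> H}"
      using presents_submodule_preimage[OF M, of H] G by (intro left_hull_minimal) auto
    then show "f ` left_hull N (J \<union> G) \<subseteq> H" by blast
  qed
qed

lemma presents_quotient_generated:
  assumes M: "presents N s M f J" and G: "G \<subseteq> falg N"
  shows "presents N s (quotient_module M (generated_submodule (yangian N s) M (f ` G)))
    (\<lambda>x. generated_submodule (yangian N s) M (f ` G) +>\<^bsub>M\<^esub> f x) (left_hull N (J \<union> G))"
proof -
  have JG: "J \<union> G \<subseteq> falg N" using G presents_left_ideal[OF M] by (auto simp: left_ideal_def)
  show ?thesis
    using presents_submodule_image[OF M left_hull_left_ideal[OF JG]] left_hull_subset[of "J \<union> G" N]
      presents_quotient[OF M, of "f ` left_hull N (J \<union> G)"]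
    by (auto simp: presents_generated[OF M G])
qed

definition verma_gens :: "nat \<Rightarrow> (nat \<Rightarrow> complex fps) \<Rightarrow> letter free_alg set" where
  "verma_gens N lam = {tcoeff a b r | a b r. 1 \<le> a \<and> a < b \<and> b \<le> N} \<union>
     {tcoeff j j r - scalar (fps_nth (lam j) r) | j r. 1 \<le> j \<and> j \<le> N}"

definition verma_ideal :: "nat \<Rightarrow> (nat \<Rightarrow> nat) \<Rightarrow> (nat \<Rightarrow> complex fps) \<Rightarrow> letter free_alg set" where
  "verma_ideal N s lam = left_hull N (yangian_ideal N s \<union> verma_gens N lam)"

text \<open>
  The preimage in the free algebra of the sum of all proper submodules of the Verma module.
\<close>

definition maximal_ideal :: "nat \<Rightarrow> (nat \<Rightarrow> nat) \<Rightarrow> (nat \<Rightarrow> complex fps) \<Rightarrow> letter free_alg set" where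
  "maximal_ideal N s lam = left_hull N (verma_ideal N s lam \<union>
     \<Union>{P. left_ideal N P \<and> verma_ideal N s lam \<subseteq> P \<and> P \<noteq> falg N})"

lemma verma_gens_closed: "verma_gens N lam \<subseteq> falg N"
  by (auto simp: verma_gens_def)

lemma presents_verma: "\<exists>f. presents N s (verma_module N s lam) f (verma_ideal N s lam)"
proof -
  have "{yangian_class N s (tcoeff a b r) | a b r. 1 \<le> a \<and> a < b \<and> b \<le> N} \<union>
        {yangian_class N s (tcoeff j j r - scalar (fps_nth (lam j) r)) | j r. 1 \<le> j \<and> j \<le> N}
      = yangian_class N s ` verma_gens N lam"
    unfolding verma_gens_def by blast
  then show ?thesis
    using presents_quotient_generated[OF presents_regular verma_gens_closed, of N s lam]
    unfolding verma_module_def verma_left_ideal_def verma_ideal_def by metis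
qed

lemma presents_irreducible:
  "\<exists>f. presents N s (irreducible_hw_module N s lam) f (maximal_ideal N s lam)"
proof -
  obtain f where M: "presents N s (verma_module N s lam) f (verma_ideal N s lam)"
    using presents_verma by blast
  let ?M = "verma_module N s lam" and ?Y = "yangian N s"
  let ?G = "\<Union>{P. left_ideal N P \<and> verma_ideal N s lam \<subseteq> P \<and> P \<noteq> falg N}"
  have G: "?G \<subseteq> falg N" by (auto simp: left_ideal_def)
  have "\<Union>{H. submodule H ?Y ?M \<and> H \<noteq> carrier ?M} = f ` ?G"
  proof (intro equalityI subsetI)
    fix x assume "x \<in> \<Union>{H. submodule H ?Y ?M \<and> H \<noteq> carrier ?M}"
    then obtain H where H: "x \<in> H" "submodule H ?Y ?M" "H \<noteq> carrier ?M" by blast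
    let ?P = "{x\<in>falg N. f x \<in> H}"
    have "?P \<noteq> falg N"
      using H(3) presents_submodule_preimage(3)[OF M H(2)] M unfolding presents_def by metis
    then have "?P \<subseteq> ?G" using presents_submodule_preimage(1,2)[OF M H(2)] by blast
    moreover have "x \<in> f ` ?P" using H(1) presents_submodule_preimage(3)[OF M H(2)] by simp
    ultimately show "x \<in> f ` ?G" by (rule subsetD[OF image_mono])
  next
    fix x assume "x \<in> f ` ?G"
    then obtain P where P: "x \<in> f ` P" "left_ideal N P" "verma_ideal N s lam \<subseteq> P" "P \<noteq> falg N" by blast
    have "f ` P \<noteq> carrier ?M"
    proof
      assume "f ` P = carrier ?M"
      then have "{x \<in> falg N. f x \<in> f ` P} = falg N" using presents_closed[OF M] by auto
      then show False using presents_submodule_image(2)[OF M P(2,3)] P(4) by simp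
    qed
    then show "x \<in> \<Union>{H. submodule H ?Y ?M \<and> H \<noteq> carrier ?M}"
      using presents_submodule_image(1)[OF M P(2,3)] P(1) by (intro UnionI[of "f ` P"] CollectI conjI)
  qed
  then show ?thesis
    unfolding irreducible_hw_module_def sum_of_proper_submodules_def maximal_ideal_def
    by (simp only:) (rule exI, rule presents_quotient_generated[OF M G])
qed

text \<open>
  The map $x \mapsto \mathit{rl}(x) z$ presents the first module over the second algebra with the
  cyclic vector \<open>z\<close>; both modules are then the free algebra modulo \<open>J'\<close>.
\<close>

lemma module_iso_if_same_kernel:
  assumes L: "presents N s L f J" and L': "presents N s' L' f' J'"
    and rl: "\<And>x. x \<in> falg N \<Longrightarrow> rl x \<in> falg N" "\<And>x y. rl (x + y) = rl x + rl y"
      "\<And>x y. rl (x * y) = rl x * rl y" "\<And>x. rl (- x) = - rl x"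
    and h: "\<And>x. x \<in> falg N \<Longrightarrow> h (yangian_class N s' x) = yangian_class N s (rl x)"
    and z: "z \<in> falg N" and ker: "\<And>x. x \<in> falg N \<Longrightarrow> rl x * z \<in> J \<longleftrightarrow> x \<in> J'"
    and surj: "\<And>y. y \<in> falg N \<Longrightarrow> \<exists>x\<in>falg N. y - rl x * z \<in> J"
  shows "module_iso (yangian N s') (restrict_scalars h L) L' \<noteq> {}"
proof -
  define g where "g x = f (rl x * z)" for x
  define \<phi> where "\<phi> v = f' (SOME x. x \<in> falg N \<and> g x = v)" for v
  have g_eq: "g x = g y \<longleftrightarrow> f' x = f' y" if "x \<in> falg N" "y \<in> falg N" for x y
  proof -
    have "rl x * z - rl y * z = rl (x - y) * z"
      using rl(2)[of "x" "- y"] rl(4)[of y] by (simp add: left_diff_distrib)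
    then show ?thesis unfolding g_def
      using that presents_eq_iff[OF L, of "rl x * z" "rl y * z"] presents_eq_iff[OF L', of x y] ker[of "x - y"] rl(1) z
      by auto
  qed
  have phi: "\<phi> (g x) = f' x" if "x \<in> falg N" for x
  proof -
    have "(SOME y. y \<in> falg N \<and> g y = g x) \<in> falg N \<and> g (SOME y. y \<in> falg N \<and> g y = g x) = g x"
      by (rule someI[of _ x]) (use that in auto)
    then show ?thesis unfolding \<phi>_def using g_eq that by blast
  qed
  have g_car: "carrier L = g ` falg N"
  proof (intro equalityI subsetI)
    fix v assume "v \<in> carrier L"
    then have "v \<in> f ` falg N" using L by (simp add: presents_def)
    then obtain y where y: "y \<in> falg N" "v = f y" by blast
    obtain x where x: "x \<in> falg N" "y - rl x * z \<in> J" using surj[OF y(1)] by blast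
    then have "v = g x" unfolding g_def y(2) using presents_eq_iff[OF L y(1)] rl(1) z by auto
    then show "v \<in> g ` falg N" using x(1) by blast
  qed (use rl(1) z presents_closed[OF L] in \<open>auto simp: g_def\<close>)
  have g_add: "g (x + y) = g x \<oplus>\<^bsub>L\<^esub> g y" if "x \<in> falg N" "y \<in> falg N" for x y
    using L that rl z by (simp add: g_def presents_def distrib_right)
  have g_mult: "g (a * x) = h (yangian_class N s' a) \<odot>\<^bsub>L\<^esub> g x" if "a \<in> falg N" "x \<in> falg N" for a x
    using L that rl z by (simp add: g_def presents_def mult.assoc h)
  have f': "f' ` falg N = carrier L'" "\<And>x y. x \<in> falg N \<Longrightarrow> y \<in> falg N \<Longrightarrow> f' (x + y) = f' x \<oplus>\<^bsub>L'\<^esub> f' y"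
    "\<And>a x. a \<in> falg N \<Longrightarrow> x \<in> falg N \<Longrightarrow> f' (a * x) = yangian_class N s' a \<odot>\<^bsub>L'\<^esub> f' x"
    using L' by (auto simp: presents_def)
  have "bij_betw \<phi> (carrier L) (carrier L')"
    unfolding bij_betw_def g_car f'(1)[symmetric]
    by (auto simp: inj_on_def phi g_eq image_image)
  moreover have "\<phi> (g x \<oplus>\<^bsub>L\<^esub> g y) = \<phi> (g x) \<oplus>\<^bsub>L'\<^esub> \<phi> (g y)" if "x \<in> falg N" "y \<in> falg N" for x y
    using phi[of "x + y"] that by (simp add: g_add[symmetric] phi f'(2))
  moreover have "\<phi> (h (yangian_class N s' a) \<odot>\<^bsub>L\<^esub> g x) = yangian_class N s' a \<odot>\<^bsub>L'\<^esub> \<phi> (g x)"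
    if "a \<in> falg N" "x \<in> falg N" for a x
    using phi[of "a * x"] that by (simp add: g_mult[symmetric] phi f'(3))
  ultimately have "\<phi> \<in> module_iso (yangian N s') (restrict_scalars h L) L'"
    by (auto simp: module_iso_def restrict_scalars_def g_car carrier_yangian)
  then show ?thesis by blast
qed

section \<open>Words, degrees and weights\<close>

text \<open>
  With respect to the sum of the superscripts, the bracket of two generators has smaller degree
  than their product.
\<close>

definition deg :: "letter list \<Rightarrow> nat" where
  "deg w = (\<Sum>(i, j, r)\<leftarrow>w. r)"

lemma deg_simps [simp]: "deg [] = 0" "deg ((i, j, r) # w) = r + deg w"
  by (simp_all add: deg_def)

inductive_set wspan :: "letter set \<Rightarrow> nat \<Rightarrow> letter free_alg set" for A n where
  zero: "0 \<in> wspan A n"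
| add: "x \<in> wspan A n \<Longrightarrow> y \<in> wspan A n \<Longrightarrow> x + y \<in> wspan A n"
| word: "set w \<subseteq> A \<Longrightarrow> deg w \<le> n \<Longrightarrow> c \<star> word w \<in> wspan A n"

lemma wspan_cscale: "x \<in> wspan A n \<Longrightarrow> c \<star> x \<in> wspan A n"
  by (induction rule: wspan.induct) (auto simp: cscale_simps intro: wspan.intros)

lemma wspan_mono: "x \<in> wspan A m \<Longrightarrow> m \<le> n \<Longrightarrow> x \<in> wspan A n"
  by (induction rule: wspan.induct) (auto intro: wspan.intros)

lemma wspan_mult: "x \<in> wspan A m \<Longrightarrow> (i, j, r) \<in> A \<Longrightarrow> gen (i, j, r) * x \<in> wspan A (r + m)"
proof (induction rule: wspan.induct)
  case (word w c)
  then have "c \<star> word ((i, j, r) # w) \<in> wspan A (r + m)"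
    by (intro wspan.word) auto
  then show ?case by (simp add: cscale_simps)
qed (auto simp: algebra_simps intro: wspan.intros)

definition weight :: "letter list \<Rightarrow> complex" where
  "weight w = (\<Sum>(i, j, r)\<leftarrow>w. of_nat i - of_nat j)"

lemma weight_simps [simp]: "weight [] = 0" "weight ((i, j, r) # w) = (of_nat i - of_nat j) + weight w"
  by (simp_all add: weight_def)

lemma weight_nonneg:
  assumes "\<And>i j r. (i, j, r) \<in> set w \<Longrightarrow> j \<le> i" shows "\<exists>m. weight w = of_nat m"
  using assms
proof (induction w)
  case (Cons g w)
  obtain i j r where g: "g = (i, j, r)" by (cases g) auto
  obtain m where "weight w = of_nat m" using Cons by (meson list.set_intros(2))
  then have "weight (g # w) = of_nat (m + (i - j))" using Cons.prems[of i j r] g by (simp add: of_nat_diff)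
  then show ?case by blast
qed (auto intro: exI[of _ 0])

text \<open>
  The bracket with this element multiplies $t_{kl}^{(r)}$ by $k - l$ (\<open>weight_op_letter\<close>), and the constants are
  chosen so that it kills the highest vector. The sign \<open>(- 1) ^ (s j * s j)\<close> is the one that the
  defining relation produces for $i = j$. Lowering generators have positive weight.
\<close>

definition weight_op :: "nat \<Rightarrow> (nat \<Rightarrow> nat) \<Rightarrow> (nat \<Rightarrow> complex fps) \<Rightarrow> letter free_alg" where
  "weight_op N s lam = (\<Sum>j=1..N. (of_nat j * (- 1) ^ (s j * s j)) \<star> (tcoeff j j 1 - scalar (fps_nth (lam j) 1)))"

text \<open>
  The product $(h - n) \cdots (h - 1)$ kills all vectors of weights $1, \dots, n$, but multiplies a vector
  of weight \<open>0\<close> by a nonzero number. This separates the highest vector from the vectors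
  of positive weight without decomposing the module.
\<close>

fun hpoly :: "letter free_alg \<Rightarrow> nat \<Rightarrow> letter free_alg" where
  "hpoly h 0 = 1"
| "hpoly h (Suc n) = (h - scalar (of_nat (Suc n))) * hpoly h n"

definition torsion :: "nat \<Rightarrow> letter free_alg \<Rightarrow> letter free_alg set \<Rightarrow> letter free_alg set" where
  "torsion N h J = {z \<in> falg N. \<exists>n. hpoly h n * z \<in> J}"

section \<open>Left ideals containing the Yangian relations\<close>

locale yangian_left_ideal =
  fixes N :: nat and s :: "nat \<Rightarrow> nat" and J :: "letter free_alg set"
  assumes left_ideal_J: "left_ideal N J" and relations_J: "yangian_ideal N s \<subseteq> J"
begin

lemma J_falg: "x \<in> J \<Longrightarrow> x \<in> falg N"
  and J_zero [simp, intro]: "0 \<in> J"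
  and J_add [intro]: "x \<in> J \<Longrightarrow> y \<in> J \<Longrightarrow> x + y \<in> J"
  and J_mult [intro]: "a \<in> falg N \<Longrightarrow> x \<in> J \<Longrightarrow> a * x \<in> J"
  using left_ideal_J by (auto simp: left_ideal_def)

lemma J_cscale [intro]: "x \<in> J \<Longrightarrow> c \<star> x \<in> J"
  unfolding cscale_def by (rule J_mult) auto

lemma J_uminus [intro]: "x \<in> J \<Longrightarrow> - x \<in> J"
  using left_ideal_uminus[OF left_ideal_J] .

lemma J_diff [intro]: "x \<in> J \<Longrightarrow> y \<in> J \<Longrightarrow> x - y \<in> J"
  using J_add[OF _ J_uminus] by fastforce

lemma J_sum [intro]: "(\<And>i. i \<in> A \<Longrightarrow> f i \<in> J) \<Longrightarrow> sum f A \<in> J"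
  by (induction A rule: infinite_finite_induct) auto

lemma J_cong: "x - y \<in> J \<Longrightarrow> x \<in> J \<longleftrightarrow> y \<in> J"
  using J_add[of "x - y" y] J_diff[of x "x - y"] by auto

lemma J_cscale_iff: "c \<noteq> 0 \<Longrightarrow> c \<star> x \<in> J \<longleftrightarrow> x \<in> J"
  using J_cscale[of "c \<star> x" "1 / c"] J_cscale[of x c] by (auto simp: cscale_simps)

lemma J_full_iff: "J = falg N \<longleftrightarrow> 1 \<in> J"
  using J_mult[of _ 1] J_falg by auto

lemma relator_in_J:
  assumes "i \<in> {1..N}" "j \<in> {1..N}" "k \<in> {1..N}" "l \<in> {1..N}" "x \<in> falg N"
  shows "yangian_relator s i j k l p q * x \<in> J"
proof -
  have "yangian_relator s i j k l p q \<in> yangian_ideal N s"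
    using relators_subset[of N s] assms unfolding relators_def by blast
  then show ?thesis
    using ideal.I_r_closed[OF ideal_yangian] assms(5) relations_J by fastforce
qed

lemma tbracket_zero [simp]: "tbracket s i j 0 k l q = 0" "tbracket s i j p k l 0 = 0"
  by (auto simp: tbracket_def tcoeff_def)

lemma tbracket_swap:
  "tbracket s i j p k l q = - ((- 1) ^ ((s i + s j) * (s k + s l)) * tbracket s k l q i j p)"
proof -
  have "((- 1) ^ m * ((- 1) ^ m * x) :: letter free_alg) = x" for m x
    by (simp flip: mult.assoc power_add)
  then show ?thesis
    by (simp add: tbracket_def algebra_simps)
qed

text \<open>
  The defining relation expresses the bracket with superscripts $(p, q + 1)$ by the one with
  $(p + 1, q)$ and two products that end in a coefficient of $t_{il}(u)$. These kill \<open>x\<close>, and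
  the bracket with second superscript \<open>0\<close> vanishes.
\<close>

lemma tbracket_kill_right:
  assumes "i \<in> {1..N}" "j \<in> {1..N}" "k \<in> {1..N}" "l \<in> {1..N}" "x \<in> falg N"
    and kill: "\<And>r. tcoeff i l r * x \<in> J"
  shows "tbracket s i j p k l q * x \<in> J"
proof (induction q arbitrary: p)
  case (Suc q)
  let ?e = "(- 1) ^ (s i * s j + s i * s k + s j * s k) :: letter free_alg"
  have "tbracket s i j p k l (Suc q) * x = tbracket s i j (p + 1) k l q * x
      - yangian_relator s i j k l p q * x
      - ?e * (tcoeff k j p * (tcoeff i l q * x) - tcoeff k j q * (tcoeff i l p * x))"
    by (simp add: yangian_relator_def algebra_simps)
  also have "\<dots> \<in> J"
    by (intro J_diff Suc.IH relator_in_J J_mult kill tcoeff_closed neg_one_power_closed) fact+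
  finally show ?case .
qed simp

text \<open>
  Interchanging the two factors of the bracket interchanges the roles of $t_{il}$ and $t_{kj}$.
\<close>

lemma tbracket_kill_left:
  assumes "i \<in> {1..N}" "j \<in> {1..N}" "k \<in> {1..N}" "l \<in> {1..N}" "x \<in> falg N"
    and kill: "\<And>r. tcoeff k j r * x \<in> J"
  shows "tbracket s i j p k l q * x \<in> J"
proof -
  have "tbracket s k l q i j p * x \<in> J"
    by (rule tbracket_kill_right) fact+
  then show ?thesis
    by (subst tbracket_swap) (auto simp: mult.assoc intro!: J_mult)
qed

section \<open>Straightening\<close>

definition straight :: "letter set \<Rightarrow> nat \<Rightarrow> letter free_alg set" where
  "straight A n = {x. \<exists>y\<in>wspan A n. x - y \<in> J}"

lemma straight_add: "x \<in> straight A n \<Longrightarrow> y \<in> straight A n \<Longrightarrow> x + y \<in> straight A n"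
  unfolding straight_def
proof clarify
  fix x' y' assume *: "x' \<in> wspan A n" "x - x' \<in> J" "y' \<in> wspan A n" "y - y' \<in> J"
  have "x + y - (x' + y') \<in> J" using J_add[OF *(2,4)] by (simp add: algebra_simps)
  then show "\<exists>z\<in>wspan A n. x + y - z \<in> J" using * by (blast intro: wspan.add)
qed

lemma straight_cscale: "x \<in> straight A n \<Longrightarrow> c \<star> x \<in> straight A n"
  unfolding straight_def using J_cscale wspan_cscale by (fastforce simp: cscale_simps(2))

lemma straight_diff: "x \<in> straight A n \<Longrightarrow> y \<in> straight A n \<Longrightarrow> x - y \<in> straight A n"
  using straight_add[of x A n "(- 1) \<star> y"] straight_cscale[of y A n "- 1"] by (simp add: cscale_simps)

lemma straight_sign: "x \<in> straight A n \<Longrightarrow> (- 1) ^ m * x \<in> straight A n"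
  using straight_cscale[of x A n "(- 1) ^ m"]
  by (cases "even m") (auto simp: cscale_simps)

lemma straight_J: "x \<in> J \<Longrightarrow> x \<in> straight A n"
  unfolding straight_def by (auto intro!: bexI[of _ 0] wspan.zero)

lemma straight_mono: "x \<in> straight A m \<Longrightarrow> m \<le> n \<Longrightarrow> x \<in> straight A n"
  unfolding straight_def using wspan_mono by blast

lemma straight_mult:
  assumes "x \<in> straight A m" "(i, j, r) \<in> A" "A \<subseteq> yangian_letters N"
  shows "gen (i, j, r) * x \<in> straight A (r + m)"
proof -
  obtain y where y: "y \<in> wspan A m" "x - y \<in> J" using assms(1) by (auto simp: straight_def)
  have "gen (i, j, r) * (x - y) \<in> J" using assms y by (intro J_mult gen_closed) auto
  then show ?thesis
    using wspan_mult[OF y(1) assms(2)] by (auto simp: straight_def algebra_simps)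
qed

text \<open>
  The spanning half of the Poincare-Birkhoff-Witt theorem, in the form needed for cyclic modules: if
  all letters outside \<open>A\<close> act on the cyclic vector as scalars, then words in \<open>A\<close> span. A letter outside \<open>A\<close> is moved
  to the right, towards the cyclic vector; each bracket that arises has smaller degree.
\<close>

lemma straighten_word:
  assumes A: "A \<subseteq> yangian_letters N"
    and scal: "\<And>g. g \<in> yangian_letters N \<Longrightarrow> g \<notin> A \<Longrightarrow> \<exists>c. gen g - scalar c \<in> J"
    and w: "set w \<subseteq> yangian_letters N" "deg w \<le> n"
  shows "word w \<in> straight A n"
  using w
proof (induction n arbitrary: w rule: less_induct)
  case (less n)
  have tt: "tcoeff i j p * (tcoeff k l q * word v) \<in> straight A n"
    if "i \<in> {1..N}" "j \<in> {1..N}" "k \<in> {1..N}" "l \<in> {1..N}" "set v \<subseteq> yangian_letters N" "p + q + deg v < n"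
    for i j p k l q v
  proof -
    have 0: "0 \<in> straight A n" by (rule straight_J) simp
    have 1: "word v' \<in> straight A n" if "set v' \<subseteq> yangian_letters N" "deg v' < n" for v'
      using less.IH[OF that(2,1)] straight_mono[of "word v'" A "deg v'" n] that(2) by auto
    have let': "(i, j, p) \<in> yangian_letters N \<or> p = 0" "(k, l, q) \<in> yangian_letters N \<or> q = 0"
      using that by (auto simp: yangian_letters_def)
    show ?thesis
      using 0 1[of v] 1[of "(k, l, q) # v"] 1[of "(i, j, p) # v"] 1[of "(i, j, p) # (k, l, q) # v"] that let'
      by (auto simp: tcoeff_def)
  qed
  \<comment> \<open>one superscript in the bracket is shifted to the other until it is \<open>0\<close>; all correction terms have smaller degree\<close>
  have br: "tbracket s i j p k l q * word v \<in> straight A n"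
    if ijkl: "i \<in> {1..N}" "j \<in> {1..N}" "k \<in> {1..N}" "l \<in> {1..N}" and v: "set v \<subseteq> yangian_letters N"
    and "p + q + deg v \<le> n" for i j p k l q v
    using that(6)
  proof (induction p arbitrary: q)
    case 0
    then show ?case by (simp add: straight_J)
  next
    case (Suc p)
    let ?e = "(- 1) ^ (s i * s j + s i * s k + s j * s k) :: letter free_alg"
    have "tbracket s i j (Suc p) k l q * word v = tbracket s i j p k l (q + 1) * word v
      + yangian_relator s i j k l p q * word v
      + ?e * (tcoeff k j p * (tcoeff i l q * word v) - tcoeff k j q * (tcoeff i l p * word v))"
      by (simp add: yangian_relator_def algebra_simps)
    also have "\<dots> \<in> straight A n"
      using Suc ijkl v
      by (intro straight_add straight_sign straight_diff tt Suc.IH straight_J relator_in_J) auto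
    finally show ?case .
  qed
  have gv: "gen (i, j, r) * word v \<in> straight A n"
    if g: "(i, j, r) \<in> yangian_letters N" and v: "set v \<subseteq> A" "r + deg v \<le> n" for i j r v
  proof (cases "(i, j, r) \<in> A")
    case True
    have "c \<star> word ((i, j, r) # v) \<in> wspan A n" for c
      using True v by (intro wspan.word) auto
    from this[of 1] show ?thesis
      unfolding straight_def by (auto simp: cscale_simps intro!: bexI[of _ "gen (i, j, r) * word v"])
  next
    case False
    then obtain c where c: "gen (i, j, r) - scalar c \<in> J" using scal[OF g] by blast
    show ?thesis
    proof (cases v)
      case Nil
      have "c \<star> word [] \<in> wspan A n" by (rule wspan.word) auto
      then show ?thesis using c Nil by (auto simp: straight_def scalar_eq_cscale)
    next
      case (Cons a v')
      obtain k l q where a: "a = (k, l, q)" by (cases a) auto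
      have let': "i \<in> {1..N}" "j \<in> {1..N}" "k \<in> {1..N}" "l \<in> {1..N}" "r \<ge> 1" "q \<ge> 1" "(k, l, q) \<in> A"
        and v': "set v' \<subseteq> yangian_letters N"
        using g v A Cons a by (auto simp: yangian_letters_def)
      have dv: "q + r + deg v' \<le> n" using v Cons a by simp
      have "word ((i, j, r) # v') \<in> straight A (n - q)"
        using let' dv v' g by (intro less.IH) auto
      then have "gen (k, l, q) * word ((i, j, r) # v') \<in> straight A (q + (n - q))"
        using let' A by (intro straight_mult) auto
      then have 1: "gen (k, l, q) * (gen (i, j, r) * word v') \<in> straight A n"
        using dv by simp
      have "gen (i, j, r) * word v = tbracket s i j r k l q * word v'
          + (- 1) ^ ((s i + s j) * (s k + s l)) * (gen (k, l, q) * (gen (i, j, r) * word v'))"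
        using let' Cons a by (simp add: tbracket_def tcoeff_def algebra_simps)
      also have "\<dots> \<in> straight A n"
        using let' v' dv by (intro straight_add br straight_sign 1) auto
      finally show ?thesis .
    qed
  qed
  show ?case
  proof (cases w)
    case Nil
    have "1 \<star> word [] \<in> wspan A n" by (rule wspan.word) auto
    then show ?thesis using Nil by (auto simp: straight_def cscale_simps intro!: bexI[of _ 1])
  next
    case (Cons a w')
    obtain i j r where a: "a = (i, j, r)" by (cases a) auto
    have g: "(i, j, r) \<in> yangian_letters N" and r: "r \<ge> 1" and w': "set w' \<subseteq> yangian_letters N"
      and d: "r + deg w' \<le> n"
      using less.prems Cons a by (auto simp: yangian_letters_def)
    have "word w' \<in> straight A (n - r)"
      using r d w' by (intro less.IH) auto
    then obtain y where y: "y \<in> wspan A (n - r)" "word w' - y \<in> J" by (auto simp: straight_def)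
    have "gen (i, j, r) * (word w' - y) \<in> J" using g y(2) by (intro J_mult) auto
    then have 1: "gen (i, j, r) * (word w' - y) \<in> straight A n" by (rule straight_J)
    have "gen (i, j, r) * y \<in> straight A n"
      using y(1)
    proof (induction rule: wspan.induct)
      case zero
      then show ?case by (simp add: straight_J)
    next
      case (add x y)
      then show ?case by (simp add: distrib_left straight_add)
    next
      case (word v c)
      then show ?case using gv[OF g word(1)] d by (simp add: cscale_simps straight_cscale)
    qed
    from straight_add[OF 1 this] show ?thesis using Cons a by (simp add: algebra_simps)
  qed
qed

lemma straighten:
  assumes A: "A \<subseteq> yangian_letters N"
    and scal: "\<And>g. g \<in> yangian_letters N \<Longrightarrow> g \<notin> A \<Longrightarrow> \<exists>c. gen g - scalar c \<in> J"
    and x: "x \<in> falg N"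
  shows "\<exists>n. \<exists>y\<in>wspan A n. x - y \<in> J"
proof -
  have "\<exists>n. x \<in> straight A n"
    using x
  proof (induction rule: free_algebra_induct)
    case zero
    then show ?case using straight_J by blast
  next
    case (add x y)
    then obtain m n where "x \<in> straight A m" "y \<in> straight A n" by blast
    then have "x + y \<in> straight A (max m n)"
      by (intro straight_add) (auto elim: straight_mono)
    then show ?case by blast
  next
    case (word c w)
    then show ?case using straighten_word[OF A scal, of w "deg w"] straight_cscale by blast
  qed
  then show ?thesis by (auto simp: straight_def)
qed


section \<open>The weight grading\<close>

lemma sign_cscale: "(- 1) ^ m * x = ((- 1) ^ m) \<star> (x :: letter free_alg)"
  by (cases "even m") (auto simp: cscale_simps)

lemma weight_op_letter:
  assumes k: "k \<in> {1..N}" and l: "l \<in> {1..N}" and x: "x \<in> falg N"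
  shows "weight_op N s lam * (tcoeff k l q * x) - tcoeff k l q * (weight_op N s lam * x)
     - (of_nat k - of_nat l) \<star> (tcoeff k l q * x) \<in> J"
proof -
  define c where "c j = of_nat j * (- 1 :: complex) ^ (s j * s j)" for j
  have h: "weight_op N s lam = (\<Sum>j=1..N. c j \<star> (tcoeff j j 1 - scalar (fps_nth (lam j) 1)))"
    by (simp add: weight_op_def c_def)
  have cc: "c j * (- 1) ^ (s j * s j + (s j * s k + s j * s k)) = of_nat j" for j
    by (simp add: c_def power_add mult.assoc flip: power_mult_distrib)
  have 1: "c j \<star> (tcoeff j j 1 - scalar (fps_nth (lam j) 1)) * (tcoeff k l q * x)
      - tcoeff k l q * (c j \<star> (tcoeff j j 1 - scalar (fps_nth (lam j) 1)) * x)
      - of_nat j \<star> (tcoeff k j 0 * (tcoeff j l q * x) - tcoeff j l 0 * (tcoeff k j q * x))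
      = c j \<star> (yangian_relator s j j k l 0 q * x)" for j
  proof -
    have "yangian_relator s j j k l 0 q * x = tcoeff j j 1 * (tcoeff k l q * x) - tcoeff k l q * (tcoeff j j 1 * x)
      - ((- 1) ^ (s j * s j + (s j * s k + s j * s k))) \<star>
          (tcoeff k j 0 * (tcoeff j l q * x) - tcoeff j l 0 * (tcoeff k j q * x))"
    proof -
      have "tcoeff k j q * (tcoeff j l 0 * x) = tcoeff j l 0 * (tcoeff k j q * x)"
        by (simp add: tcoeff_def)
      then show ?thesis
        unfolding yangian_relator_def tbracket_zero
        by (simp add: tbracket_def sign_cscale left_diff_distrib mult.assoc cscale_simps add.assoc)
    qed
    then show ?thesis
      using cc[of j]
      by (simp add: cscale_simps left_diff_distrib right_diff_distrib mult.assoc)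
         (simp add: scalar_eq_cscale cscale_simps)
  qed
  have 2: "(\<Sum>j=1..N. of_nat j \<star> (tcoeff k j 0 * (tcoeff j l q * x) - tcoeff j l 0 * (tcoeff k j q * x)))
     = (of_nat k - of_nat l) \<star> (tcoeff k l q * x)"
  proof -
    have "(\<Sum>j=1..N. of_nat j \<star> (tcoeff k j 0 * (tcoeff j l q * x) - tcoeff j l 0 * (tcoeff k j q * x)))
      = (\<Sum>j=1..N. (if k = j then of_nat k \<star> (tcoeff k l q * x) else 0) - (if l = j then of_nat l \<star> (tcoeff k l q * x) else 0))"
      by (rule sum.cong) (auto simp: tcoeff_def cscale_simps)
    also have "\<dots> = (of_nat k - of_nat l) \<star> (tcoeff k l q * x)"
      using k l by (simp add: sum_subtractf sum.delta cscale_simps)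
    finally show ?thesis .
  qed
  have "weight_op N s lam * (tcoeff k l q * x) - tcoeff k l q * (weight_op N s lam * x)
     - (of_nat k - of_nat l) \<star> (tcoeff k l q * x)
     = (\<Sum>j=1..N. c j \<star> (yangian_relator s j j k l 0 q * x))"
    unfolding 1[symmetric] 2[symmetric] h by (simp add: sum_subtractf sum_distrib_left sum_distrib_right)
  also have "\<dots> \<in> J"
    using k l x by (intro J_sum J_cscale relator_in_J) auto
  finally show ?thesis .
qed

lemma weight_op_word:
  assumes x: "x \<in> falg N" and h: "weight_op N s lam * x - c \<star> x \<in> J" and w: "set w \<subseteq> yangian_letters N"
  shows "weight_op N s lam * (word w * x) - (c + weight w) \<star> (word w * x) \<in> J"
  using w
proof (induction w)
  case Nil
  then show ?case using h by simp
next
  case (Cons g w)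
  obtain k l r where g: "g = (k, l, r)" by (cases g) auto
  have kl: "k \<in> {1..N}" "l \<in> {1..N}" "r \<ge> 1" using Cons.prems g by (auto simp: yangian_letters_def)
  then have t: "gen g = tcoeff k l r" by (simp add: g tcoeff_def)
  let ?h = "weight_op N s lam" and ?y = "word w * x"
  have y: "?y \<in> falg N" using Cons.prems x by auto
  have 1: "?h * (tcoeff k l r * ?y) - tcoeff k l r * (?h * ?y) - (of_nat k - of_nat l) \<star> (tcoeff k l r * ?y) \<in> J"
    by (rule weight_op_letter[OF kl(1,2) y])
  have 2: "tcoeff k l r * (?h * ?y - (c + weight w) \<star> ?y) \<in> J"
    using Cons kl by (intro J_mult tcoeff_closed) auto
  have "?h * (word (g # w) * x) - (c + weight (g # w)) \<star> (word (g # w) * x)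
    = ?h * (tcoeff k l r * ?y) - tcoeff k l r * (?h * ?y) - (of_nat k - of_nat l) \<star> (tcoeff k l r * ?y)
      + tcoeff k l r * (?h * ?y - (c + weight w) \<star> ?y)"
    by (simp add: t) (simp add: g algebra_simps cscale_simps)
  then show ?case using J_add[OF 1 2] by simp
qed

lemma hpoly_mono:
  assumes h: "h \<in> falg N" and z: "hpoly h m * z \<in> J" and "m \<le> n"
  shows "hpoly h n * z \<in> J"
  using \<open>m \<le> n\<close>
proof (induction n rule: dec_induct)
  case (step n)
  have "(h - scalar (of_nat (Suc n))) * (hpoly h n * z) \<in> J"
    using h by (intro J_mult[OF _ step(3)]) auto
  then show ?case by (simp add: mult.assoc)
qed (rule z)

lemma hpoly_eigen:
  assumes h: "h \<in> falg N" and z: "h * z - c \<star> z \<in> J"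
  shows "hpoly h n * z - (\<Prod>d=1..n. c - of_nat d) \<star> z \<in> J"
proof (induction n)
  case 0
  then show ?case by (simp add: cscale_simps)
next
  case (Suc n)
  let ?p = "\<Prod>d=1..n. c - of_nat d"
  have 1: "(h - scalar (of_nat (Suc n))) * (hpoly h n * z - ?p \<star> z) \<in> J"
    using Suc h by (intro J_mult) auto
  have "hpoly h (Suc n) * z - (\<Prod>d=1..Suc n. c - of_nat d) \<star> z
    = (h - scalar (of_nat (Suc n))) * (hpoly h n * z - ?p \<star> z) + ?p \<star> (h * z - c \<star> z)"
    by (simp add: scalar_eq_cscale algebra_simps cscale_simps del: of_nat_Suc)
  then show ?case using J_add[OF 1 J_cscale[OF z, of ?p]] by simp
qed

lemma torsion_closed:
  assumes "h \<in> falg N"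
  shows torsion_J: "z \<in> J \<Longrightarrow> z \<in> torsion N h J"
    and torsion_add: "x \<in> torsion N h J \<Longrightarrow> y \<in> torsion N h J \<Longrightarrow> x + y \<in> torsion N h J"
    and torsion_cscale: "x \<in> torsion N h J \<Longrightarrow> c \<star> x \<in> torsion N h J"
proof -
  show "z \<in> torsion N h J" if "z \<in> J"
    using that J_falg by (auto simp: torsion_def intro!: exI[of _ 0])
  show "c \<star> x \<in> torsion N h J" if "x \<in> torsion N h J"
    using that by (auto simp: torsion_def cscale_simps)
  show "x + y \<in> torsion N h J" if xy: "x \<in> torsion N h J" "y \<in> torsion N h J"
  proof -
    obtain m n where "hpoly h m * x \<in> J" "hpoly h n * y \<in> J" using xy by (auto simp: torsion_def)
    then have "hpoly h (max m n) * x \<in> J" "hpoly h (max m n) * y \<in> J"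
      using hpoly_mono[OF assms] by (meson max.cobounded1 max.cobounded2)+
    then have "hpoly h (max m n) * (x + y) \<in> J" by (simp add: distrib_left J_add)
    then show ?thesis using xy unfolding torsion_def by blast
  qed
qed

lemma torsion_eigen:
  assumes h: "h \<in> falg N" and z: "z \<in> falg N" "h * z - of_nat (Suc n) \<star> z \<in> J"
  shows "z \<in> torsion N h J"
proof -
  have "(\<Prod>d=1..Suc n. of_nat (Suc n) - of_nat d :: complex) = 0"
    by (rule prod_zero) (auto intro!: bexI[of _ "Suc n"])
  then have "hpoly h (Suc n) * z \<in> J"
    using hpoly_eigen[OF h z(2), of "Suc n"] by (simp add: cscale_simps)
  then show ?thesis using z(1) unfolding torsion_def by blast
qed

text \<open>
  On the cyclic vector, which has weight \<open>0\<close>, the products \<open>hpoly h n\<close> act by nonzero numbers.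
\<close>

lemma torsion_one:
  assumes h: "h \<in> falg N" "h \<in> J" and P: "left_ideal N P" "J \<subseteq> P" and "hpoly h n * (c \<star> 1) \<in> P"
  shows "c = 0 \<or> 1 \<in> P"
proof -
  interpret P: yangian_left_ideal N s P
    using P relations_J by unfold_locales auto
  define e :: complex where "e = (\<Prod>d=1..n. 0 - of_nat d)"
  have e: "e \<noteq> 0" by (auto simp: e_def)
  have "h * 1 - 0 \<star> 1 \<in> P" using h(2) P(2) by (auto simp: cscale_simps)
  from P.hpoly_eigen[OF h(1) this, of n] have "hpoly h n * 1 - e \<star> 1 \<in> P" by (simp add: e_def)
  then have "hpoly h n * (c \<star> 1) - (c * e) \<star> 1 \<in> P"
    using P.J_cscale[of "hpoly h n * 1 - e \<star> 1" c] by (simp add: cscale_simps)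
  then have "(c * e) \<star> 1 \<in> P" using P.J_cong assms(5) by blast
  then show ?thesis using P.J_cscale_iff[of "c * e" 1] e by auto
qed

end

section \<open>The maximal left ideal of a highest weight\<close>

locale highest_weight =
  fixes N :: nat and s :: "nat \<Rightarrow> nat" and lam :: "nat \<Rightarrow> complex fps"
begin

abbreviation "V \<equiv> verma_ideal N s lam"
abbreviation "h \<equiv> weight_op N s lam"
definition "Jmax \<equiv> maximal_ideal N s lam"

lemma ideal_gens_closed: "yangian_ideal N s \<union> verma_gens N lam \<subseteq> falg N"
  using verma_gens_closed presents_left_ideal[OF presents_regular] by (auto simp: left_ideal_def)

sublocale V: yangian_left_ideal N s V
  using left_hull_left_ideal[OF ideal_gens_closed] left_hull_subset[of "yangian_ideal N s \<union> verma_gens N lam" N]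
  by unfold_locales (auto simp: verma_ideal_def)

lemma verma_gens_V: "verma_gens N lam \<subseteq> V"
  using left_hull_subset[of "yangian_ideal N s \<union> verma_gens N lam" N] by (auto simp: verma_ideal_def)

lemma verma_minimal: "left_ideal N P \<Longrightarrow> yangian_ideal N s \<subseteq> P \<Longrightarrow> verma_gens N lam \<subseteq> P \<Longrightarrow> V \<subseteq> P"
  unfolding verma_ideal_def by (rule left_hull_minimal) auto

lemma Jmax_gens_closed: "V \<union> \<Union>{P. left_ideal N P \<and> V \<subseteq> P \<and> P \<noteq> falg N} \<subseteq> falg N"
  using V.J_falg by (auto simp: left_ideal_def)

lemma V_Jmax: "V \<subseteq> Jmax" and Jmax_proper: "left_ideal N P \<Longrightarrow> V \<subseteq> P \<Longrightarrow> P \<noteq> falg N \<Longrightarrow> P \<subseteq> Jmax"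
  unfolding Jmax_def maximal_ideal_def
  using left_hull_subset[of "V \<union> \<Union>{P. left_ideal N P \<and> V \<subseteq> P \<and> P \<noteq> falg N}" N] by blast+

sublocale Jm: yangian_left_ideal N s Jmax
  using left_hull_left_ideal[OF Jmax_gens_closed] V_Jmax V.relations_J
  by unfold_locales (auto simp: Jmax_def maximal_ideal_def)

lemma upper_V: "1 \<le> a \<Longrightarrow> a < b \<Longrightarrow> b \<le> N \<Longrightarrow> tcoeff a b r \<in> V"
  and diag_V: "1 \<le> j \<Longrightarrow> j \<le> N \<Longrightarrow> tcoeff j j r - scalar (fps_nth (lam j) r) \<in> V"
  using verma_gens_V unfolding verma_gens_def by blast+

lemma h_closed [simp, intro]: "h \<in> falg N"
  unfolding weight_op_def by (intro free_algebra_sum free_algebra_closed tcoeff_closed)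

lemma h_V: "h \<in> V"
  unfolding weight_op_def by (intro V.J_sum V.J_cscale diag_V) auto

text \<open>
  By straightening, the Verma module is spanned by words in the letters $t_{ij}^{(r)}$ with $i > j$, and all of these
  except the empty word raise the weight.
\<close>

lemma top_component:
  assumes x: "x \<in> falg N"
  obtains c z where "z \<in> torsion N h V" "x - (c \<star> 1 + z) \<in> V"
proof -
  let ?A = "{(i, j, r) \<in> yangian_letters N. j < i}"
  have scal: "\<exists>c. gen g - scalar c \<in> V" if g: "g \<in> yangian_letters N" "g \<notin> ?A" for g
  proof -
    obtain i j r where ijr: "g = (i, j, r)" by (cases g) auto
    have 1: "1 \<le> i" "i \<le> j" "j \<le> N" "r \<ge> 1" using g ijr by (auto simp: yangian_letters_def)
    have t: "gen g = tcoeff i j r" using 1 ijr by (simp add: tcoeff_def)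
    show ?thesis
    proof (cases "i = j")
      case True
      then show ?thesis using diag_V[of i r] 1 t by auto
    next
      case False
      then have "gen g - scalar 0 \<in> V" using upper_V[of i j r] 1 t by (simp add: scalar_simps)
      then show ?thesis by blast
    qed
  qed
  obtain n y where y: "y \<in> wspan ?A n" "x - y \<in> V"
    using V.straighten[of ?A x] scal x by blast
  have "\<exists>c. \<exists>z\<in>torsion N h V. y = c \<star> 1 + z"
    using y(1)
  proof (induction rule: wspan.induct)
    case zero
    then show ?case using V.torsion_J[OF h_closed V.J_zero] by (auto intro!: exI[of _ 0] bexI[of _ 0] simp: cscale_simps)
  next
    case (add x y)
    then obtain c d z w where *: "z \<in> torsion N h V" "x = c \<star> 1 + z" "w \<in> torsion N h V" "y = d \<star> 1 + w" by blast
    have "x + y = (c + d) \<star> 1 + (z + w)" using * by (simp add: cscale_simps)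
    then show ?case using V.torsion_add[OF h_closed *(1,3)] by blast
  next
    case (word w c)
    show ?case
    proof (cases w)
      case Nil
      then show ?thesis using V.torsion_J[OF h_closed V.J_zero] by (auto intro!: exI[of _ c] bexI[of _ 0])
    next
      case (Cons g v)
      have "\<exists>m. weight v = of_nat m"
        by (rule weight_nonneg) (use word(1) Cons in \<open>auto simp: subset_iff less_imp_le\<close>)
      then obtain m where m: "weight v = of_nat m" by blast
      obtain i j r where g: "g = (i, j, r)" "j < i" using word Cons by auto
      then have "weight w = of_nat (Suc (m + (i - j - 1)))" using m Cons by (simp add: of_nat_diff)
      moreover have "h * (word w * 1) - (0 + weight w) \<star> (word w * 1) \<in> V"
        using word h_V by (intro V.weight_op_word) (auto simp: cscale_simps)
      ultimately have "word w \<in> torsion N h V"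
        using V.torsion_eigen[OF h_closed, of "word w" "m + (i - j - 1)"] word by auto
      then have "c \<star> word w \<in> torsion N h V" by (rule V.torsion_cscale[OF h_closed])
      then show ?thesis by (auto intro!: exI[of _ 0] bexI[of _ "c \<star> word w"] simp: cscale_simps)
    qed
  qed
  then show thesis using that y(2) by blast
qed

text \<open>
  If a submodule contains a vector with a nonzero multiple of the highest vector as its component of
  weight \<open>0\<close>, then a polynomial in \<open>h\<close> extracts the highest vector, and the submodule is everything.
\<close>

lemma proper_torsion:
  assumes P: "left_ideal N P" "V \<subseteq> P" "1 \<notin> P" and x: "x \<in> P"
  shows "x \<in> torsion N h V"
proof -
  interpret P: yangian_left_ideal N s P
    using P V.relations_J by unfold_locales auto
  obtain c z where z: "z \<in> torsion N h V" "x - (c \<star> 1 + z) \<in> V"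
    using top_component x P.J_falg by blast
  obtain n where n: "hpoly h n * z \<in> V" using z(1) by (auto simp: torsion_def)
  have hp: "hpoly h n \<in> falg N" by (induction n) auto
  have "hpoly h n * (x - (c \<star> 1 + z)) \<in> V" by (rule V.J_mult[OF hp z(2)])
  then have "hpoly h n * x - hpoly h n * (c \<star> 1) - hpoly h n * z \<in> P"
    using P(2) by (auto simp: algebra_simps)
  moreover have "hpoly h n * x \<in> P" "hpoly h n * z \<in> P" using n P(2) P.J_mult[OF hp x] by auto
  ultimately have "hpoly h n * (c \<star> 1) \<in> P"
    using P.J_cong[of "hpoly h n * x - hpoly h n * z" "hpoly h n * (c \<star> 1)"]
    by (auto simp: algebra_simps)
  then have "c = 0" using V.torsion_one[OF h_closed h_V P(1,2)] P(3) by blast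
  then have "x - z \<in> V" using z(2) by (simp add: cscale_simps)
  from V.torsion_add[OF h_closed V.torsion_J[OF h_closed this] z(1)] show ?thesis by simp
qed

text \<open>
  Being of positive weight is not stable under the algebra, hence the quantifier over \<open>a\<close>; the set so
  defined is a left ideal that contains all proper ones.
\<close>

lemma Jmax_torsion:
  assumes "1 \<notin> V" shows "Jmax \<subseteq> {x \<in> falg N. \<forall>a\<in>falg N. a * x \<in> torsion N h V}"
  unfolding Jmax_def maximal_ideal_def
proof (rule left_hull_minimal)
  let ?T = "{x \<in> falg N. \<forall>a\<in>falg N. a * x \<in> torsion N h V}"
  show "left_ideal N ?T"
    using V.torsion_add[OF h_closed] V.torsion_J[OF h_closed V.J_zero]
    by (auto simp: left_ideal_def distrib_left simp flip: mult.assoc)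
  have "P \<subseteq> ?T" if P: "left_ideal N P" "V \<subseteq> P" "P \<noteq> falg N" for P
  proof -
    interpret P: yangian_left_ideal N s P
      using P V.relations_J by unfold_locales auto
    show ?thesis using proper_torsion[OF P(1,2)] P.J_full_iff P(3) P.J_falg by auto
  qed
  from this[of V] this show "V \<union> \<Union>{P. left_ideal N P \<and> V \<subseteq> P \<and> P \<noteq> falg N} \<subseteq> ?T"
    using V.left_ideal_J V.J_full_iff assms by blast
qed

text \<open>
  The highest vector is not of positive weight unless the Verma module is zero, so the sum of all
  proper submodules of a nonzero Verma module is proper.
\<close>

lemma one_Jmax_iff: "1 \<in> Jmax \<longleftrightarrow> 1 \<in> V"
proof (rule ccontr)
  assume neg: "\<not> ?thesis"
  then have V: "1 \<notin> V" and J: "1 \<in> Jmax" using V_Jmax by auto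
  from J have "1 \<in> torsion N h V" using Jmax_torsion[OF V] by auto
  then obtain n where "hpoly h n * (1 \<star> 1) \<in> V" by (auto simp: torsion_def cscale_simps)
  then show False using V.torsion_one[OF h_closed h_V V.left_ideal_J, of n 1] V by auto
qed

end

locale proper_highest_weight = highest_weight +
  assumes proper: "1 \<notin> Jmax"
begin

text \<open>
  Irreducibility: a left ideal above \<open>V\<close> that is not contained in \<open>Jmax\<close> cannot be proper.
\<close>

lemma Jmax_cyclic:
  assumes x: "x \<in> falg N" "x \<notin> Jmax"
  obtains y where "y \<in> falg N" "y * x - 1 \<in> Jmax"
proof -
  let ?P = "{a * x + j | a j. a \<in> falg N \<and> j \<in> Jmax}"
  have "left_ideal N ?P"
    unfolding left_ideal_def
  proof (intro conjI ballI)
    show "?P \<subseteq> falg N" using x Jm.J_falg by auto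
    show "0 \<in> ?P" by (rule CollectI) (metis add_0 mult_zero_left free_algebra_closed(1) Jm.J_zero)
  next
    fix u v assume "u \<in> ?P" "v \<in> ?P"
    then obtain a j b i where *: "u = a * x + j" "v = b * x + i" "a \<in> falg N" "b \<in> falg N" "j \<in> Jmax" "i \<in> Jmax" by blast
    have "u + v = (a + b) * x + (j + i)" using * by (simp add: algebra_simps)
    then show "u + v \<in> ?P" using * Jm.J_add free_algebra_closed(3) by blast
  next
    fix u v assume "u \<in> falg N" "v \<in> ?P"
    then obtain b i where *: "v = b * x + i" "b \<in> falg N" "i \<in> Jmax" "u \<in> falg N" by blast
    have "u * v = (u * b) * x + u * i" using * by (simp add: algebra_simps)
    then show "u * v \<in> ?P" using * Jm.J_mult free_algebra_closed(4) by blast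
  qed
  moreover have "V \<subseteq> ?P"
  proof
    fix v assume "v \<in> V"
    then have "v \<in> Jmax" using V_Jmax by blast
    then show "v \<in> ?P" by (intro CollectI exI[of _ 0] exI[of _ v]) auto
  qed
  moreover have "x \<in> ?P" using Jm.J_zero by (intro CollectI exI[of _ 1] exI[of _ 0]) auto
  ultimately have "?P = falg N" using Jmax_proper[of ?P] x(2) by blast
  then have "1 \<in> ?P" by simp
  then obtain a j where a: "1 = a * x + j" "a \<in> falg N" "j \<in> Jmax" by blast
  then have "a * x - 1 = - j" by (simp add: algebra_simps)
  then show thesis using that[OF a(2)] Jm.J_uminus[OF a(3)] by simp
qed

lemma one_not_torsion: "1 \<notin> torsion N h Jmax"
proof
  assume "1 \<in> torsion N h Jmax"
  then obtain n where "hpoly h n * (1 \<star> 1) \<in> Jmax" by (auto simp: torsion_def cscale_simps)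
  then show False
    using V.torsion_one[OF h_closed h_V Jm.left_ideal_J V_Jmax, of n 1] proper by auto
qed

text \<open>
  A singular vector \<open>x\<close> of positive weight generates, by straightening with respect to the letters
  $t_{ij}^{(r)}$ with \<open>i \<ge> j\<close>, only vectors of positive weight, and so never the highest vector.
\<close>

lemma singular_vector:
  assumes x: "x \<in> falg N" and hx: "h * x - of_nat (Suc n) \<star> x \<in> Jmax"
    and upper: "\<And>a b r. 1 \<le> a \<Longrightarrow> a < b \<Longrightarrow> b \<le> N \<Longrightarrow> tcoeff a b r * x \<in> Jmax"
  shows "x \<in> Jmax"
proof (rule ccontr)
  assume "x \<notin> Jmax"
  then obtain y where y: "y \<in> falg N" "y * x - 1 \<in> Jmax" using Jmax_cyclic x by blast
  let ?V = "{a \<in> falg N. a * x \<in> Jmax}"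
  have "left_ideal N ?V"
    using Jm.J_add Jm.J_mult by (auto simp: left_ideal_def distrib_right mult.assoc)
  moreover have "yangian_ideal N s \<subseteq> ?V"
  proof
    fix a assume a: "a \<in> yangian_ideal N s"
    then have "a * x \<in> yangian_ideal N s" using ideal.I_r_closed[OF ideal_yangian a] x by simp
    then show "a \<in> ?V" using a ideal_gens_closed Jm.relations_J by blast
  qed
  ultimately interpret W: yangian_left_ideal N s ?V by unfold_locales
  let ?A = "{(i, j, r) \<in> yangian_letters N. j \<le> i}"
  have scal: "\<exists>c. gen g - scalar c \<in> ?V" if g: "g \<in> yangian_letters N" "g \<notin> ?A" for g
  proof -
    obtain i j r where ijr: "g = (i, j, r)" by (cases g) auto
    have 1: "1 \<le> i" "i < j" "j \<le> N" "r \<ge> 1" using g ijr by (auto simp: yangian_letters_def)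
    then have "gen g - scalar 0 \<in> ?V"
      using upper[of i j r] g ijr by (simp add: scalar_simps tcoeff_def)
    then show ?thesis by blast
  qed
  obtain m y' where y': "y' \<in> wspan ?A m" "y - y' \<in> ?V"
    using W.straighten[of ?A y] scal y by blast
  have tors: "y' * x \<in> torsion N h Jmax"
    using y'(1)
  proof (induction rule: wspan.induct)
    case zero
    then show ?case using Jm.torsion_J[OF h_closed Jm.J_zero] by simp
  next
    case (add u v)
    then show ?case using Jm.torsion_add[OF h_closed] by (simp add: distrib_right)
  next
    case (word w c)
    obtain m where m: "weight w = of_nat m"
      using weight_nonneg[of w] word by (auto simp: subset_iff)
    have "h * (word w * x) - (of_nat (Suc n) + weight w) \<star> (word w * x) \<in> Jmax"
      using word by (intro Jm.weight_op_word x hx) auto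
    moreover have "of_nat (Suc n) + weight w = of_nat (Suc (n + m))" by (simp add: m)
    moreover have "word w \<in> falg N" using word by (intro word_closed) auto
    ultimately have "word w * x \<in> torsion N h Jmax"
      using Jm.torsion_eigen[OF h_closed, of "word w * x" "n + m"] x by (auto simp: add.assoc)
    then show ?case using Jm.torsion_cscale[OF h_closed] by (simp add: cscale_simps)
  qed
  have "1 - y' * x \<in> Jmax"
  proof -
    have "1 - y' * x = (y - y') * x - (y * x - 1)" by (simp add: algebra_simps)
    moreover have "(y - y') * x \<in> Jmax" using y'(2) by blast
    ultimately show ?thesis using Jm.J_diff[OF _ y(2)] by metis
  qed
  then have "(1 - y' * x) + y' * x \<in> torsion N h Jmax"
    using Jm.torsion_add[OF h_closed Jm.torsion_J[OF h_closed] tors] by blast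
  then show False using one_not_torsion by simp
qed

text \<open>
  A product of factors \<open>h - d\<close> that kills the component of positive weight multiplies a vector of weight \<open>0\<close>
  by a nonzero number, so that component is zero.
\<close>

lemma weight_zero:
  assumes x: "x \<in> falg N" and hx: "h * x \<in> Jmax"
  obtains c where "x - c \<star> 1 \<in> Jmax"
proof -
  obtain c z where z: "z \<in> torsion N h V" "x - (c \<star> 1 + z) \<in> V"
    using top_component x by blast
  obtain n where n: "hpoly h n * z \<in> V" using z(1) by (auto simp: torsion_def)
  have hp: "hpoly h n \<in> falg N" by (induction n) auto
  define e :: complex where "e = (\<Prod>d=1..n. 0 - of_nat d)"
  have e: "e \<noteq> 0" by (auto simp: e_def)
  have "h * (x - c \<star> 1) - 0 \<star> (x - c \<star> 1) \<in> Jmax"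
    using hx h_V V_Jmax Jm.J_diff[OF hx Jm.J_cscale[of h c]] by (auto simp: cscale_simps algebra_simps)
  from Jm.hpoly_eigen[OF h_closed this, of n]
  have 1: "hpoly h n * (x - c \<star> 1) - e \<star> (x - c \<star> 1) \<in> Jmax" by (simp add: e_def)
  have "hpoly h n * (x - (c \<star> 1 + z)) + hpoly h n * z \<in> V"
    by (rule V.J_add[OF V.J_mult[OF hp z(2)] n])
  then have "hpoly h n * (x - c \<star> 1) \<in> Jmax" using V_Jmax by (auto simp: algebra_simps)
  then have "e \<star> (x - c \<star> 1) \<in> Jmax" using Jm.J_cong[OF 1] by simp
  then show thesis using that Jm.J_cscale_iff[OF e] by blast
qed

end

section \<open>Polynomial functions with values in the free algebra\<close>

text \<open>
  Iterated differences encode a bound on the degree in the form in which it is used: the value at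
  \<open>c\<close> is an integral combination of values at $c + 1, c + 2, \dots$.
\<close>

fun polyfun_deg :: "nat \<Rightarrow> (complex \<Rightarrow> letter free_alg) \<Rightarrow> bool" where
  "polyfun_deg 0 f \<longleftrightarrow> (\<forall>u v. f u = f v)"
| "polyfun_deg (Suc n) f \<longleftrightarrow> polyfun_deg n (\<lambda>u. f (u + 1) - f u)"

definition polyfun :: "(complex \<Rightarrow> letter free_alg) \<Rightarrow> bool" where
  "polyfun f \<longleftrightarrow> (\<exists>n. polyfun_deg n f)"

lemma polyfun_deg_0I: "(\<And>u v. f u = f v) \<Longrightarrow> polyfun_deg 0 f"
  unfolding polyfun_deg.simps by blast

lemma polyfun_deg_0D: "polyfun_deg 0 f \<Longrightarrow> f u = f v"
  unfolding polyfun_deg.simps by blast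

lemma polyfun_deg_const: "polyfun_deg n (\<lambda>u. c)"
proof (induction n arbitrary: c)
  case (Suc n)
  from Suc[of 0] show ?case by simp
qed simp

lemma polyfun_deg_Suc: "polyfun_deg n f \<Longrightarrow> polyfun_deg (Suc n) f"
proof (induction n arbitrary: f)
  case 0
  then have "(\<lambda>u. f (u + 1) - f u) = (\<lambda>u. 0)" by (intro ext, subst polyfun_deg_0D[OF 0, of _ 0], subst polyfun_deg_0D[OF 0, of _ 0]) simp
  then show ?case by simp
next
  case (Suc n)
  have "polyfun_deg (Suc n) (\<lambda>u. f (u + 1) - f u)"
    by (rule Suc.IH) (use Suc.prems in simp)
  then show ?case using polyfun_deg.simps(2) by blast
qed

lemma polyfun_deg_mono: "m \<le> n \<Longrightarrow> polyfun_deg m f \<Longrightarrow> polyfun_deg n f"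
  by (induction n rule: dec_induct) (auto simp del: polyfun_deg.simps intro: polyfun_deg_Suc)

lemma polyfun_deg_add: "polyfun_deg n f \<Longrightarrow> polyfun_deg n g \<Longrightarrow> polyfun_deg n (\<lambda>u. f u + g u)"
proof (induction n arbitrary: f g)
  case 0
  show ?case
    by (rule polyfun_deg_0I, rule arg_cong2[of _ _ _ _ plus]; rule polyfun_deg_0D[OF 0(1)] polyfun_deg_0D[OF 0(2)])
next
  case (Suc n)
  then have "polyfun_deg n (\<lambda>u. (f (u + 1) - f u) + (g (u + 1) - g u))" by simp
  then show ?case by (simp add: algebra_simps)
qed

lemma polyfun_deg_mult: "polyfun_deg n f \<Longrightarrow> polyfun_deg n (\<lambda>u. a * f u * b)"
proof (induction n arbitrary: f)
  case 0
  show ?case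
    by (rule polyfun_deg_0I, rule arg_cong[of _ _ "\<lambda>x. a * x * b"], rule polyfun_deg_0D[OF 0])
next
  case (Suc n)
  then have "polyfun_deg n (\<lambda>u. a * (f (u + 1) - f u) * b)" by simp
  then show ?case by (simp add: algebra_simps)
qed

lemma polyfun_deg_shift: "polyfun_deg n f \<Longrightarrow> polyfun_deg n (\<lambda>u. f (u + 1))"
proof (induction n arbitrary: f)
  case 0
  show ?case by (rule polyfun_deg_0I, rule polyfun_deg_0D[OF 0])
next
  case (Suc n)
  from Suc.IH[OF Suc.prems[simplified]] show ?case by simp
qed

lemma polyfun_deg_times: "polyfun_deg n f \<Longrightarrow> polyfun_deg (Suc n) (\<lambda>u. u \<star> f u)"
proof (induction n arbitrary: f)
  case 0
  have "(u + 1) \<star> f (u + 1) - u \<star> f u = f 0" for u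
  proof -
    have "f (u + 1) = f 0" "f u = f 0" by (rule polyfun_deg_0D[OF 0])+
    then show ?thesis by (simp add: cscale_simps)
  qed
  then show ?case unfolding polyfun_deg.simps by simp
next
  case (Suc n)
  have eq: "(u + 1) \<star> f (u + 1) - u \<star> f u = u \<star> (f (u + 1) - f u) + f (u + 1)" for u
    by (simp add: cscale_simps)
  have "polyfun_deg (Suc n) (\<lambda>u. u \<star> (f (u + 1) - f u))"
    by (rule Suc.IH) (use Suc.prems in simp)
  moreover have "polyfun_deg (Suc n) (\<lambda>u. f (u + 1))" by (rule polyfun_deg_shift) fact
  ultimately have "polyfun_deg (Suc n) (\<lambda>u. (u + 1) \<star> f (u + 1) - u \<star> f u)"
    unfolding eq by (rule polyfun_deg_add)
  then show ?case by (subst polyfun_deg.simps)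
qed

lemma polyfun_const: "polyfun (\<lambda>u. c)"
  unfolding polyfun_def using polyfun_deg_const by blast

lemma polyfun_add: "polyfun f \<Longrightarrow> polyfun g \<Longrightarrow> polyfun (\<lambda>u. f u + g u)"
  unfolding polyfun_def using polyfun_deg_add polyfun_deg_mono by (meson max.cobounded1 max.cobounded2)

lemma polyfun_sandwich: "polyfun f \<Longrightarrow> polyfun (\<lambda>u. a * f u * b)"
  unfolding polyfun_def using polyfun_deg_mult by blast

lemma polyfun_mult: "polyfun f \<Longrightarrow> polyfun (\<lambda>u. a * f u)"
  using polyfun_sandwich[of f a 1] by simp

lemma polyfun_mult_right: "polyfun f \<Longrightarrow> polyfun (\<lambda>u. f u * b)"
  using polyfun_sandwich[of f 1 b] by simp

lemma polyfun_cscale: "polyfun f \<Longrightarrow> polyfun (\<lambda>u. c \<star> f u)"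
  unfolding cscale_def by (rule polyfun_mult)

lemma polyfun_diff: "polyfun f \<Longrightarrow> polyfun g \<Longrightarrow> polyfun (\<lambda>u. f u - g u)"
  using polyfun_add[OF _ polyfun_cscale[of g "- 1"], of f] by (simp add: cscale_simps)

lemma polyfun_times: "polyfun f \<Longrightarrow> polyfun (\<lambda>u. u \<star> f u)"
  unfolding polyfun_def using polyfun_deg_times by blast

lemma polyfun_linear: "polyfun f \<Longrightarrow> polyfun (\<lambda>u. (u + c) \<star> f u)"
  using polyfun_add[OF polyfun_times polyfun_cscale, of f f c] by (simp add: cscale_simps)

lemma polyfun_power: "polyfun f \<Longrightarrow> polyfun (\<lambda>u. u ^ n \<star> f u)"
proof (induction n)
  case (Suc n)
  then have "polyfun (\<lambda>u. u \<star> u ^ n \<star> f u)" by (intro polyfun_times)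
  then show ?case by (simp add: cscale_simps)
qed (simp add: cscale_simps)

lemma polyfun_prod: "polyfun f \<Longrightarrow> polyfun (\<lambda>u. (\<Prod>a\<leftarrow>as. u + g a) \<star> f u)"
proof (induction as)
  case (Cons a as)
  then have "polyfun (\<lambda>u. (u + g a) \<star> (\<Prod>a\<leftarrow>as. u + g a) \<star> f u)" by (intro polyfun_linear)
  then show ?case by (simp add: cscale_simps)
qed (simp add: cscale_simps)

lemma polyfun_sum: "(\<And>i. i \<in> A \<Longrightarrow> polyfun (f i)) \<Longrightarrow> polyfun (\<lambda>u. \<Sum>i\<in>A. f i u)"
  by (induction A rule: infinite_finite_induct) (simp_all add: polyfun_const polyfun_add)

context yangian_left_ideal
begin

lemma polyfun_deg_extend:
  assumes "polyfun_deg n f" "\<And>i. f (c + 1 + of_nat i) \<in> J"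
  shows "f c \<in> J"
  using assms
proof (induction n arbitrary: f c)
  case 0
  have "f c = f (c + 1 + of_nat 0)" using 0(1) by simp
  then show ?case using 0(2) by metis
next
  case (Suc n)
  have "f (c + 1 + of_nat i + 1) - f (c + 1 + of_nat i) \<in> J" for i
    using J_diff[OF Suc.prems(2)[of "Suc i"] Suc.prems(2)[of i]] by (simp add: add_ac)
  then have "f (c + 1) - f c \<in> J"
    using Suc.IH[of "\<lambda>u. f (u + 1) - f u" c] Suc.prems(1) by simp
  from J_diff[OF Suc.prems(2)[of 0] this] show ?case by simp
qed

text \<open>
  Finitely many exceptional points can be avoided by starting far out on the ray
  $u, u + 1, u + 2, \dots$ and walking back to \<open>u\<close>.
\<close>

lemma polyfun_extend:
  assumes f: "polyfun f" and E: "finite E" "\<And>u. u \<notin> E \<Longrightarrow> f u \<in> J"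
  shows "f u \<in> J"
proof -
  obtain n where n: "polyfun_deg n f" using f by (auto simp: polyfun_def)
  define S where "S = {i::nat. u + of_nat i \<in> E}"
  have "finite ((\<lambda>i. u + of_nat i) -` E)"
    by (rule finite_vimageI[OF E(1)]) (auto simp: inj_on_def)
  then have "finite S" by (simp add: S_def vimage_def)
  then obtain m where m: "\<forall>i\<in>S. i < m" unfolding finite_nat_set_iff_bounded by (elim exE)
  have "f (u + of_nat i) \<in> J" if "i \<ge> m" for i
  proof -
    have "i \<notin> S" using m that by (meson leD)
    then show ?thesis using E(2) by (simp add: S_def)
  qed
  then have "\<forall>i. f (u + of_nat m + of_nat i) \<in> J"
    by (metis add.assoc le_add1 of_nat_add)
  moreover have "\<forall>i. f (u + of_nat j + of_nat i) \<in> J" if "\<forall>i. f (u + of_nat (Suc j) + of_nat i) \<in> J" for j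
  proof
    fix i
    have "f (u + of_nat j) \<in> J"
    proof (rule polyfun_deg_extend[OF n])
      show "f (u + of_nat j + 1 + of_nat i) \<in> J" for i
        using that[rule_format, of i] by (simp add: add_ac)
    qed
    then show "f (u + of_nat j + of_nat i) \<in> J"
      using that[rule_format, of "i - 1"] by (cases i) (simp_all add: add_ac)
  qed
  ultimately have "\<forall>i. f (u + of_nat 0 + of_nat i) \<in> J"
    by (induction m) (blast, fast)
  then show ?thesis by (metis add_0_right of_nat_0)
qed

lemma polyfun_cancel:
  assumes f: "polyfun f" and J: "\<And>u. (\<Prod>a\<leftarrow>as. u + g a) \<star> f u \<in> J"
  shows "f u \<in> J"
proof (rule polyfun_extend[OF f])
  show "finite (set (map (\<lambda>a. - g a) as))" by simp
  fix u assume u: "u \<notin> set (map (\<lambda>a. - g a) as)"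
  have "(\<Prod>a\<leftarrow>as. u + g a) \<noteq> 0"
    using u by (auto simp: prod_list_zero_iff add_eq_0_iff image_iff)
  then show "f u \<in> J" using J[of u] J_cscale_iff by blast
qed

text \<open>
  Evaluate at \<open>0\<close> to obtain the lowest coefficient, subtract it, divide by \<open>u\<close>, and repeat.
\<close>

lemma coefficients_in_J:
  assumes "\<And>u. (\<Sum>r\<le>n. u ^ (n - r) \<star> x r) \<in> J" and "r \<le> n"
  shows "x r \<in> J"
proof -
  have *: "\<forall>r\<le>n. y r \<in> J" if "\<And>u. (\<Sum>r\<le>n. u ^ r \<star> y r) \<in> J" for y
    using that
  proof (induction n arbitrary: y)
    case 0
    then show ?case using 0[of 0] by (simp add: cscale_simps)
  next
    case (Suc n)
    have eq: "(\<Sum>r\<le>Suc n. u ^ r \<star> y r) = y 0 + u \<star> (\<Sum>r\<le>n. u ^ r \<star> y (Suc r))" for u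
      by (simp only: sum.atMost_Suc_shift) (simp add: cscale_sum cscale_simps)
    have y0: "y 0 \<in> J" using Suc.prems[of 0] unfolding eq by (simp add: cscale_simps)
    have "u \<star> (\<Sum>r\<le>n. u ^ r \<star> y (Suc r)) \<in> J" for u
      using J_diff[OF Suc.prems[of u, unfolded eq] y0] by simp
    then have "(\<Prod>a\<leftarrow>[0]. u + a) \<star> (\<Sum>r\<le>n. u ^ r \<star> y (Suc r)) \<in> J" for u by simp
    then have "(\<Sum>r\<le>n. u ^ r \<star> y (Suc r)) \<in> J" for u
      by (rule polyfun_cancel[rotated]) (intro polyfun_sum polyfun_power polyfun_const)
    then have "\<forall>r\<le>n. y (Suc r) \<in> J" by (rule Suc.IH)
    then show ?case using y0 by (metis Suc_le_mono not0_implies_Suc)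
  qed
  have "(\<Sum>r\<le>n. u ^ r \<star> x (n - r)) \<in> J" for u
  proof -
    have "(\<Sum>r\<le>n. u ^ r \<star> x (n - r)) = (\<Sum>r\<le>n. u ^ (n - r) \<star> x r)"
      by (rule sum.reindex_bij_witness[of _ "\<lambda>r. n - r" "\<lambda>r. n - r"]) auto
    then show ?thesis using assms(1) by simp
  qed
  then have "\<forall>r\<le>n. x (n - r) \<in> J" by (rule *)
  then show ?thesis using assms(2) by (metis diff_diff_cancel diff_le_self)
qed

end

section \<open>The chain of Bethe vectors\<close>

primrec chain :: "(complex \<Rightarrow> letter free_alg) \<Rightarrow> complex list \<Rightarrow> letter free_alg" where
  "chain C [] = 1"
| "chain C (a # as) = C (- a) * chain C as"

text \<open>
  This is the quotient of the polynomial $B(u) C(-a_1) \cdots C(-a_j)\<xi>$ by the product of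
  $u + r$ over the roots $-r$ of $A$ that are not yet used; see \<open>chain_B\<close>.
\<close>

primrec chainQ :: "(complex \<Rightarrow> letter free_alg) \<Rightarrow> (complex \<Rightarrow> letter free_alg) \<Rightarrow> complex \<Rightarrow> complex \<Rightarrow>
    complex list \<Rightarrow> complex \<Rightarrow> letter free_alg" where
  "chainQ C D \<epsilon> \<eta> [] u = 0"
| "chainQ C D \<epsilon> \<eta> (a # as) u = - ((u + a) \<star> (C (- a) * chainQ C D \<epsilon> \<eta> as u))
     + (\<eta> * (\<Prod>r\<leftarrow>as. u + (r - \<epsilon>))) \<star> (D (- a) * chain C as)"

lemma polyfun_chainQ: "polyfun (chainQ C D \<epsilon> \<eta> as)"
proof (induction as)
  case Nil
  have "chainQ C D \<epsilon> \<eta> [] = (\<lambda>u. 0)" by auto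
  then show ?case using polyfun_const by metis
next
  case (Cons a as)
  have eq: "chainQ C D \<epsilon> \<eta> (a # as) = (\<lambda>u. (- 1) \<star> ((u + a) \<star> (C (- a) * chainQ C D \<epsilon> \<eta> as u))
     + \<eta> \<star> ((\<Prod>r\<leftarrow>as. u + (r - \<epsilon>)) \<star> (D (- a) * chain C as)))"
    by (rule ext) (simp add: cscale_simps)
  show ?case unfolding eq
    by (intro polyfun_add polyfun_cscale polyfun_linear polyfun_mult polyfun_prod polyfun_const Cons)
qed

text \<open>
  The relations shared by two situations: \<open>A\<close>, \<open>D\<close> are $t_{pp}, t_{qq}$ in one and
  $t_{qq}, t_{pp}$ in the other, which changes the sign of \<open>\<eta>\<close>. The vector \<open>1\<close> is the highest vector.
\<close>

locale bethe_chain = yangian_left_ideal N s J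
  for N :: nat and s :: "nat \<Rightarrow> nat" and J :: "letter free_alg set" +
  fixes A B C D :: "complex \<Rightarrow> letter free_alg" and W :: "letter free_alg set" and \<epsilon> \<eta> :: complex
    and as :: "complex list"
  assumes closed: "\<And>u. A u \<in> falg N" "\<And>u. B u \<in> falg N" "\<And>u. C u \<in> falg N" "\<And>u. D u \<in> falg N"
    and CW: "\<And>x u. x \<in> W \<Longrightarrow> C u * x \<in> W" and oneW: "1 \<in> W"
    and AC: "\<And>x u v. x \<in> W \<Longrightarrow> (u - v) \<star> (A u * (C v * x) - C v * (A u * x))
        - \<epsilon> \<star> (C u * (A v * x) - C v * (A u * x)) \<in> J"
    and BC: "\<And>x u v. x \<in> W \<Longrightarrow> (u - v) \<star> (B u * (C v * x) + C v * (B u * x))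
        - \<eta> \<star> (D v * (A u * x) - D u * (A v * x)) \<in> J"
    and polyA: "polyfun A" and polyB: "polyfun B"
    and A1: "\<And>u. A u - (\<Prod>a\<leftarrow>as. u + a) \<star> 1 \<in> J" and B1: "\<And>u. B u \<in> J"
begin

lemma chain_W: "chain C ys \<in> W"
  by (induction ys) (auto intro: oneW CW)

text \<open>
  At $v = -a$ the current vector is killed by $A(v)$, so the unwanted term of the relation \<open>AC\<close> drops
  out. What remains replaces the factor $u + a$ of the eigenvalue by \<open>u + a - \<epsilon>\<close>, after division by
  $u + a$, which is legitimate for polynomial functions.
\<close>

lemma chain_eigen:
  "as = xs @ ys \<Longrightarrow> A u * chain C ys - ((\<Prod>a\<leftarrow>xs. u + a) * (\<Prod>a\<leftarrow>ys. u + (a - \<epsilon>))) \<star> chain C ys \<in> J"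
proof (induction ys arbitrary: xs u)
  case Nil
  then show ?case using A1 by simp
next
  case (Cons a ys)
  let ?X = "chain C ys"
  let ?\<alpha> = "\<lambda>u. (\<Prod>a\<leftarrow>xs. u + a) * (u + a) * (\<Prod>a\<leftarrow>ys. u + (a - \<epsilon>))"
  let ?\<beta> = "\<lambda>u. (\<Prod>a\<leftarrow>xs. u + a) * (\<Prod>a\<leftarrow>a # ys. u + (a - \<epsilon>))"
  have IH: "A u * ?X - ?\<alpha> u \<star> ?X \<in> J" for u
    using Cons.IH[of "xs @ [a]" u] Cons.prems by (simp add: mult.assoc)
  have Aa: "A (- a) * ?X \<in> J" using IH[of "- a"] by (simp add: cscale_simps)
  have "(u + a) \<star> (A u * (C (- a) * ?X) - ?\<beta> u \<star> (C (- a) * ?X)) \<in> J" for u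
  proof -
    have 1: "(u - (- a)) \<star> (A u * (C (- a) * ?X) - C (- a) * (A u * ?X))
        - \<epsilon> \<star> (C u * (A (- a) * ?X) - C (- a) * (A u * ?X)) \<in> J"
      by (rule AC[OF chain_W])
    have 2: "\<epsilon> \<star> (C u * (A (- a) * ?X)) \<in> J" by (intro J_cscale J_mult closed Aa)
    have 3: "(u + a - \<epsilon>) \<star> (C (- a) * (A u * ?X - ?\<alpha> u \<star> ?X)) \<in> J" by (intro J_cscale J_mult closed IH)
    have b: "(u + a) * ?\<beta> u = (u + a - \<epsilon>) * ?\<alpha> u" by (simp add: algebra_simps)
    have "(u + a) \<star> (A u * (C (- a) * ?X) - ?\<beta> u \<star> (C (- a) * ?X))
      = ((u - (- a)) \<star> (A u * (C (- a) * ?X) - C (- a) * (A u * ?X))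
        - \<epsilon> \<star> (C u * (A (- a) * ?X) - C (- a) * (A u * ?X)))
        + \<epsilon> \<star> (C u * (A (- a) * ?X)) + (u + a - \<epsilon>) \<star> (C (- a) * (A u * ?X - ?\<alpha> u \<star> ?X))"
      unfolding right_diff_distrib cscale_simps b by (simp add: cscale_simps)
    then show ?thesis using J_add[OF J_add[OF 1 2] 3] by simp
  qed
  then have "(\<Prod>r\<leftarrow>[a]. u + r) \<star> (A u * (C (- a) * ?X) - ?\<beta> u \<star> (C (- a) * ?X)) \<in> J" for u
    by simp
  then have "A u * (C (- a) * ?X) - ?\<beta> u \<star> (C (- a) * ?X) \<in> J"
  proof (rule polyfun_cancel[rotated])
    have "polyfun (\<lambda>u. A u * (C (- a) * ?X) - (\<Prod>a\<leftarrow>xs. u + a) \<star> (\<Prod>a\<leftarrow>a # ys. u + (a - \<epsilon>)) \<star> (C (- a) * ?X))"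
      by (intro polyfun_diff polyfun_mult_right polyA polyfun_prod polyfun_const)
    then show "polyfun (\<lambda>u. A u * (C (- a) * ?X) - ?\<beta> u \<star> (C (- a) * ?X))"
      by (simp only: cscale_simps)
  qed
  then show ?case by simp
qed

text \<open>
  In the relation \<open>BC\<close> at $v = -a$ only the term $D(-a) A(u)$ survives on the right, and $A(u)$ contributes
  the factor $u + a$ of its eigenvalue. Cancelling this factor gives the recursion of \<open>chainQ\<close>.
\<close>

lemma chain_B:
  "as = xs @ ys \<Longrightarrow> B u * chain C ys - (\<Prod>a\<leftarrow>xs. u + a) \<star> chainQ C D \<epsilon> \<eta> ys u \<in> J"
proof (induction ys arbitrary: xs u)
  case Nil
  then show ?case using B1 by (simp add: cscale_simps)
next
  case (Cons a ys)
  let ?X = "chain C ys" and ?p = "\<lambda>u. (\<Prod>a\<leftarrow>xs. u + a)" and ?q = "\<lambda>u. (\<Prod>a\<leftarrow>ys. u + (a - \<epsilon>))"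
  let ?Q = "chainQ C D \<epsilon> \<eta> ys"
  let ?Q' = "chainQ C D \<epsilon> \<eta> (a # ys)"
  let ?\<alpha> = "\<lambda>u. ?p u * (u + a) * ?q u"
  have A: "A u * ?X - ?\<alpha> u \<star> ?X \<in> J" for u
    using chain_eigen[of "xs @ [a]" ys u] Cons.prems by (simp add: mult.assoc)
  have Aa: "A (- a) * ?X \<in> J" using A[of "- a"] by (simp add: cscale_simps)
  have IH: "B u * ?X - (?p u * (u + a)) \<star> ?Q u \<in> J" for u
    using Cons.IH[of "xs @ [a]" u] Cons.prems by simp
  have "(u + a) \<star> (B u * (C (- a) * ?X) - ?p u \<star> ?Q' u) \<in> J" for u
  proof -
    have 1: "(u - (- a)) \<star> (B u * (C (- a) * ?X) + C (- a) * (B u * ?X))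
        - \<eta> \<star> (D (- a) * (A u * ?X) - D u * (A (- a) * ?X)) \<in> J"
      by (rule BC[OF chain_W])
    have 2: "\<eta> \<star> (D u * (A (- a) * ?X)) \<in> J" by (intro J_cscale J_mult closed Aa)
    have 3: "\<eta> \<star> (D (- a) * (A u * ?X - ?\<alpha> u \<star> ?X)) \<in> J" by (intro J_cscale J_mult closed A)
    have 4: "(u + a) \<star> (C (- a) * (B u * ?X - (?p u * (u + a)) \<star> ?Q u)) \<in> J"
      by (intro J_cscale J_mult closed IH)
    have "(u + a) \<star> (B u * (C (- a) * ?X) - ?p u \<star> ?Q' u)
      = ((u - (- a)) \<star> (B u * (C (- a) * ?X) + C (- a) * (B u * ?X))
        - \<eta> \<star> (D (- a) * (A u * ?X) - D u * (A (- a) * ?X)))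
        - \<eta> \<star> (D u * (A (- a) * ?X))
        + \<eta> \<star> (D (- a) * (A u * ?X - ?\<alpha> u \<star> ?X))
        - (u + a) \<star> (C (- a) * (B u * ?X - (?p u * (u + a)) \<star> ?Q u))"
      by (simp add: cscale_simps right_diff_distrib) (simp add: algebra_simps cscale_simps flip: cscale_simps(4))
    then show ?thesis using J_diff[OF J_add[OF J_diff[OF 1 2] 3] 4] by simp
  qed
  then have "(\<Prod>r\<leftarrow>[a]. u + r) \<star> (B u * (C (- a) * ?X) - ?p u \<star> ?Q' u) \<in> J" for u
    by simp
  then have "B u * (C (- a) * ?X) - ?p u \<star> ?Q' u \<in> J"
    by (rule polyfun_cancel[rotated])
      (intro polyfun_diff polyfun_mult_right polyB polyfun_prod polyfun_chainQ)
  then show ?case by simp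
qed

text \<open>
  Suppose that $C(-a)$ kills the vector \<open>x\<close> of the chain. Then $A(-a)$ and $B(-a)$ kill \<open>x\<close>, since the
  root \<open>- a\<close> was not used for \<open>x\<close>, and the recursion for \<open>chainQ\<close> at $u = -a$ leaves
  a multiple of $D(-a)x$. The order of the roots makes the factor nonzero.
\<close>

lemma bethe_chain_nonzero:
  assumes proper: "1 \<notin> J" and eta: "\<eta> \<noteq> 0"
    and order: "sorted_wrt (\<lambda>a r. r - a \<noteq> \<epsilon>) as"
    and nondegenerate: "\<And>ys v. A v * chain C ys \<in> J \<Longrightarrow> B v * chain C ys \<in> J \<Longrightarrow>
       C v * chain C ys \<in> J \<Longrightarrow> D v * chain C ys \<in> J \<Longrightarrow> chain C ys \<in> J"
  shows "as = xs @ ys \<Longrightarrow> chain C ys \<notin> J"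
proof (induction ys arbitrary: xs)
  case Nil
  then show ?case using proper by simp
next
  case (Cons a ys)
  let ?X = "chain C ys"
  have X: "?X \<notin> J" using Cons.IH[of "xs @ [a]"] Cons.prems by simp
  show ?case
  proof
    assume 0: "chain C (a # ys) \<in> J"
    have Aa: "A (- a) * ?X \<in> J"
      using chain_eigen[of "xs @ [a]" ys "- a"] Cons.prems by (simp add: cscale_simps)
    have Ba: "B (- a) * ?X \<in> J"
      using chain_B[of "xs @ [a]" ys "- a"] Cons.prems by (simp add: cscale_simps)
    have "(\<Prod>r\<leftarrow>xs. u + r) \<star> chainQ C D \<epsilon> \<eta> (a # ys) u \<in> J" for u
      using chain_B[OF Cons.prems, of u] J_mult[OF closed(2)[of u] 0] J_cong by blast
    then have "chainQ C D \<epsilon> \<eta> (a # ys) (- a) \<in> J"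
      by (rule polyfun_cancel[OF polyfun_chainQ])
    then have "(\<eta> * (\<Prod>r\<leftarrow>ys. - a + (r - \<epsilon>))) \<star> (D (- a) * ?X) \<in> J"
      by (simp add: cscale_simps)
    moreover have "(\<Prod>r\<leftarrow>ys. - a + (r - \<epsilon>)) \<noteq> 0"
      using order Cons.prems by (auto simp: prod_list_zero_iff sorted_wrt_append algebra_simps)
    ultimately have "D (- a) * ?X \<in> J"
      using eta J_cscale_iff by simp
    then show False using nondegenerate[OF Aa Ba] 0 X by simp
  qed
qed

end

section \<open>The rank one subalgebra of an odd pair\<close>

context yangian_left_ideal
begin

lemma tcoeff_commute:
  "tcoeff i j r * (tcoeff l m r' * x) = tbracket s i j r l m r' * x
     + ((- 1) ^ ((s i + s j) * (s l + s m))) \<star> (tcoeff l m r' * (tcoeff i j r * x))"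
  by (simp add: tbracket_def sign_cscale cscale_simps left_diff_distrib mult.assoc)

lemma tbracket_Suc_left:
  "tbracket s i j (Suc r) l m r' * x = tbracket s i j r l m (Suc r') * x + yangian_relator s i j l m r r' * x
     + ((- 1) ^ (s i * s j + s i * s l + s j * s l)) \<star>
       (tcoeff l j r * (tcoeff i m r' * x) - tcoeff l j r' * (tcoeff i m r * x))"
  by (simp add: yangian_relator_def sign_cscale cscale_simps left_diff_distrib mult.assoc)

end

text \<open>
  This is $u^k t_{ij}(u)$, cut off after the coefficient of $u^{-k}$.
\<close>

definition tpoly :: "nat \<Rightarrow> nat \<Rightarrow> nat \<Rightarrow> complex \<Rightarrow> letter free_alg" where
  "tpoly k i j u = (\<Sum>r\<le>k. u ^ (k - r) \<star> tcoeff i j r)"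

lemma tpoly_closed [simp, intro]: "i \<in> {1..N} \<Longrightarrow> j \<in> {1..N} \<Longrightarrow> tpoly k i j u \<in> falg N"
  unfolding tpoly_def by (intro free_algebra_sum free_algebra_closed tcoeff_closed)

lemma polyfun_tpoly: "polyfun (tpoly k i j)"
proof -
  have "tpoly k i j = (\<lambda>u. \<Sum>r\<le>k. u ^ (k - r) \<star> tcoeff i j r)" by (rule ext) (simp add: tpoly_def)
  then show ?thesis by (simp only:) (intro polyfun_sum polyfun_power polyfun_const)
qed

lemma sum_shift:
  fixes f :: "nat \<Rightarrow> letter free_alg"
  shows "(\<Sum>r\<le>k. u ^ (k - r) \<star> f (Suc r)) = u \<star> (\<Sum>r\<le>k. u ^ (k - r) \<star> f r) + f (Suc k) - u ^ Suc k \<star> f 0"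
proof -
  have "(\<Sum>r\<le>Suc k. u ^ (Suc k - r) \<star> f r) = u ^ Suc k \<star> f 0 + (\<Sum>r\<le>k. u ^ (k - r) \<star> f (Suc r))"
    by (subst sum.atMost_Suc_shift) simp
  moreover have "(\<Sum>r\<le>Suc k. u ^ (Suc k - r) \<star> f r) = u \<star> (\<Sum>r\<le>k. u ^ (k - r) \<star> f r) + f (Suc k)"
    by (simp add: cscale_sum cscale_simps Suc_diff_le)
  ultimately show ?thesis by (simp add: algebra_simps)
qed

text \<open>
  The lists \<open>as\<close> and \<open>bs\<close> are the negatives of the roots of the two eigenvalues, with multiplicities. The order
  conditions can be met for any list by sorting its entries by real parts, in the direction given by the sign.
\<close>

locale odd_pair = proper_highest_weight N s lam
  for N :: nat and s :: "nat \<Rightarrow> nat" and lam :: "nat \<Rightarrow> complex fps" +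
  fixes p k :: nat and as bs :: "complex list"
  assumes p: "1 \<le> p" "Suc p \<le> N"
    and parity: "s p = 0 \<and> s (Suc p) = 1 \<or> s p = 1 \<and> s (Suc p) = 0"
    and length_roots: "length as = k" "length bs = k"
    and lam_p: "\<And>u. (\<Sum>r\<le>k. u ^ (k - r) * fps_nth (lam p) r) = (\<Prod>a\<leftarrow>as. u + a)"
      "\<And>r. k < r \<Longrightarrow> fps_nth (lam p) r = 0"
    and lam_q: "\<And>u. (\<Sum>r\<le>k. u ^ (k - r) * fps_nth (lam (Suc p)) r) = (\<Prod>b\<leftarrow>bs. u + b)"
      "\<And>r. k < r \<Longrightarrow> fps_nth (lam (Suc p)) r = 0"
    and no_common_root: "set as \<inter> set bs = {}"
    and order_as: "sorted_wrt (\<lambda>a r. r - a \<noteq> (- 1) ^ s p) as"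
    and order_bs: "sorted_wrt (\<lambda>a r. r - a \<noteq> (- 1) ^ s p) bs"
begin

abbreviation "q \<equiv> Suc p"
abbreviation "pq \<equiv> {p, Suc p}"

lemma pq_range: "i \<in> pq \<Longrightarrow> i \<in> {1..N}"
  using p by auto

text \<open>
  The highest weight conditions that do not involve the four series of the pair; the odd reflection
  leaves them alone.
\<close>

definition W0 :: "letter free_alg set" where
  "W0 = {x \<in> falg N.
     (\<forall>a b r. 1 \<le> a \<and> a < b \<and> b \<le> N \<and> (a, b) \<noteq> (p, q) \<longrightarrow> tcoeff a b r * x \<in> Jmax) \<and>
     (\<forall>j r. 1 \<le> j \<and> j \<le> N \<and> j \<notin> pq \<longrightarrow> tcoeff j j r * x - fps_nth (lam j) r \<star> x \<in> Jmax)}"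

text \<open>
  The bound on the superscripts makes the four series of the pair polynomials in $u^{-1}$, which can be
  evaluated at complex numbers after multiplication by $u^k$.
\<close>

definition W :: "letter free_alg set" where
  "W = {x \<in> W0. \<forall>i\<in>pq. \<forall>j\<in>pq. \<forall>r>k. tcoeff i j r * x \<in> Jmax}"

lemma W0_falg: "x \<in> W0 \<Longrightarrow> x \<in> falg N" and W_W0: "x \<in> W \<Longrightarrow> x \<in> W0" and W_falg: "x \<in> W \<Longrightarrow> x \<in> falg N"
  by (auto simp: W0_def W_def)

lemma W0_upper: "x \<in> W0 \<Longrightarrow> 1 \<le> a \<Longrightarrow> a < b \<Longrightarrow> b \<le> N \<Longrightarrow> (a, b) \<noteq> (p, q) \<Longrightarrow> tcoeff a b r * x \<in> Jmax"
  and W0_diag: "x \<in> W0 \<Longrightarrow> 1 \<le> j \<Longrightarrow> j \<le> N \<Longrightarrow> j \<notin> pq \<Longrightarrow> tcoeff j j r * x - fps_nth (lam j) r \<star> x \<in> Jmax"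
  by (auto simp: W0_def)

lemma W_bound: "x \<in> W \<Longrightarrow> i \<in> pq \<Longrightarrow> j \<in> pq \<Longrightarrow> k < r \<Longrightarrow> tcoeff i j r * x \<in> Jmax"
  by (auto simp: W_def)

lemma W_I:
  assumes "x \<in> falg N"
    "\<And>a b r. 1 \<le> a \<Longrightarrow> a < b \<Longrightarrow> b \<le> N \<Longrightarrow> (a, b) \<noteq> (p, q) \<Longrightarrow> tcoeff a b r * x \<in> Jmax"
    "\<And>j r. 1 \<le> j \<Longrightarrow> j \<le> N \<Longrightarrow> j \<notin> pq \<Longrightarrow> tcoeff j j r * x - fps_nth (lam j) r \<star> x \<in> Jmax"
    "\<And>i j r. i \<in> pq \<Longrightarrow> j \<in> pq \<Longrightarrow> k < r \<Longrightarrow> tcoeff i j r * x \<in> Jmax"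
  shows "x \<in> W"
  unfolding W_def W0_def using assms by blast

text \<open>
  For $a < b$ with $(a, b)$ different from $(p, q)$, either $a < p$ or $b > q$. In the first case $t_{ad}$ is
  again one of the operators that kill \<open>x\<close>, in the second case $t_{cb}$ is; so one of the two
  forms of the relation shows that the bracket kills \<open>x\<close>. The argument for $t_{jj}$ is the same.
\<close>

lemma W0_step:
  assumes x: "x \<in> W0" and c: "c \<in> pq" and d: "d \<in> pq"
  shows "tcoeff c d r * x \<in> W0"
proof -
  have xf: "x \<in> falg N" using x by (rule W0_falg)
  have tf: "tcoeff c d r \<in> falg N" using pq_range c d by (intro tcoeff_closed)
  have upper: "tcoeff a b r' * (tcoeff c d r * x) \<in> Jmax"
    if ab: "1 \<le> a" "a < b" "b \<le> N" "(a, b) \<noteq> (p, q)" for a b r'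
  proof -
    have "tbracket s a b r' c d r * x \<in> Jmax"
    proof (cases "a < p")
      case True
      have "tcoeff a d r * x \<in> Jmax" for r
        using True d ab p by (intro W0_upper[OF x]) auto
      then show ?thesis using ab pq_range c d xf by (intro Jm.tbracket_kill_right) auto
    next
      case False
      then have "b > q" using ab by (cases "a = p") auto
      then have "tcoeff c b r * x \<in> Jmax" for r
        using c ab p by (intro W0_upper[OF x]) auto
      then show ?thesis using ab pq_range c d xf by (intro Jm.tbracket_kill_left) auto
    qed
    moreover have "tcoeff c d r * (tcoeff a b r' * x) \<in> Jmax"
      by (intro Jm.J_mult tf W0_upper[OF x] ab)
    ultimately show ?thesis unfolding Jm.tcoeff_commute[of a b] by (intro Jm.J_add Jm.J_cscale)
  qed
  have diag: "tcoeff j j r' * (tcoeff c d r * x) - fps_nth (lam j) r' \<star> (tcoeff c d r * x) \<in> Jmax"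
    if j: "1 \<le> j" "j \<le> N" "j \<notin> pq" for j r'
  proof -
    have "tbracket s j j r' c d r * x \<in> Jmax"
    proof (cases "j < p")
      case True
      have "tcoeff j d r * x \<in> Jmax" for r
        using True d j p by (intro W0_upper[OF x]) auto
      then show ?thesis using j pq_range c d xf by (intro Jm.tbracket_kill_right) auto
    next
      case False
      then have "tcoeff c j r * x \<in> Jmax" for r
        using c j p by (intro W0_upper[OF x]) auto
      then show ?thesis using j pq_range c d xf by (intro Jm.tbracket_kill_left) auto
    qed
    moreover have "tcoeff c d r * (tcoeff j j r' * x - fps_nth (lam j) r' \<star> x) \<in> Jmax"
      by (intro Jm.J_mult tf W0_diag[OF x] j)
    ultimately have "tbracket s j j r' c d r * x + tcoeff c d r * (tcoeff j j r' * x - fps_nth (lam j) r' \<star> x) \<in> Jmax"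
      by (rule Jm.J_add)
    then show ?thesis unfolding Jm.tcoeff_commute[of j j]
      by (simp add: right_diff_distrib cscale_simps add_diff_eq)
  qed
  show ?thesis unfolding W0_def using upper diag tf xf by auto
qed

text \<open>
  Each step of the induction on \<open>r\<close> lowers the superscript of the right factor by one and raises that of the
  left factor, which stays above \<open>k\<close>.
\<close>

lemma W_step:
  assumes x: "x \<in> W" and c: "c \<in> pq" and d: "d \<in> pq"
  shows "tcoeff c d r * x \<in> W"
proof -
  have xf: "x \<in> falg N" using x by (rule W_falg)
  have "tcoeff i j r' * (tcoeff c d r * x) \<in> Jmax" if "i \<in> pq" "j \<in> pq" "k < r'" "c \<in> pq" "d \<in> pq" for i j c d r'
    using that
  proof (induction r arbitrary: i j c d r')
    case 0
    then show ?case using W_bound[OF x] by (simp add: tcoeff_def)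
  next
    case (Suc r)
    note in_pq = Suc.prems(1,2,4,5) and ranges = Suc.prems(1,2,4,5)[THEN pq_range]
    have br: "tbracket s i j (Suc r') c d r * x \<in> Jmax"
    proof -
      have "tcoeff i j (Suc r') * (tcoeff c d r * x) \<in> Jmax"
        by (rule Suc.IH[OF in_pq(1,2) _ in_pq(3,4)]) (use Suc.prems in simp)
      moreover have "tcoeff c d r * (tcoeff i j (Suc r') * x) \<in> Jmax"
        by (rule Jm.J_mult[OF tcoeff_closed[OF ranges(3,4)] W_bound[OF x in_pq(1,2)]]) (use Suc.prems in simp)
      ultimately show ?thesis
        unfolding tbracket_def left_diff_distrib Jm.sign_cscale cscale_simps mult.assoc
        by (intro Jm.J_diff Jm.J_cscale)
    qed
    have "tcoeff c j r' * (tcoeff i d r * x) \<in> Jmax"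
      by (rule Suc.IH) (use Suc.prems in auto)
    moreover have "tcoeff c j r * (tcoeff i d r' * x) \<in> Jmax"
      by (intro Jm.J_mult tcoeff_closed ranges W_bound[OF x] Suc.prems)
    ultimately have "tbracket s i j (Suc r') c d r * x - yangian_relator s i j c d r' r * x
        - ((- 1) ^ (s i * s j + s i * s c + s j * s c)) \<star>
          (tcoeff c j r' * (tcoeff i d r * x) - tcoeff c j r * (tcoeff i d r' * x)) \<in> Jmax"
      by (intro Jm.J_diff Jm.J_cscale br Jm.relator_in_J ranges xf)
    then have "tbracket s i j r' c d (Suc r) * x \<in> Jmax"
      unfolding Jm.tbracket_Suc_left by simp
    moreover have "tcoeff c d (Suc r) * (tcoeff i j r' * x) \<in> Jmax"
      by (intro Jm.J_mult tcoeff_closed ranges W_bound[OF x] Suc.prems)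
    ultimately show ?case unfolding Jm.tcoeff_commute[of i j] by (intro Jm.J_add Jm.J_cscale)
  qed
  then show ?thesis using W0_step[OF W_W0[OF x] c d] c d unfolding W_def by blast
qed

lemma W_zero: "0 \<in> W"
  by (auto simp: W_def W0_def cscale_simps)

lemma W_add: assumes x: "x \<in> W" and y: "y \<in> W" shows "x + y \<in> W"
proof (rule W_I)
  show "x + y \<in> falg N" using W_falg[OF x] W_falg[OF y] by simp
  show "tcoeff a b r * (x + y) \<in> Jmax" if "1 \<le> a" "a < b" "b \<le> N" "(a, b) \<noteq> (p, q)" for a b r
    unfolding distrib_left by (intro Jm.J_add W0_upper[OF W_W0] x y that)
  show "tcoeff j j r * (x + y) - fps_nth (lam j) r \<star> (x + y) \<in> Jmax" if "1 \<le> j" "j \<le> N" "j \<notin> pq" for j r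
    using Jm.J_add[OF W0_diag[OF W_W0[OF x] that] W0_diag[OF W_W0[OF y] that], of r r]
    by (simp add: algebra_simps cscale_simps)
  show "tcoeff i j r * (x + y) \<in> Jmax" if "i \<in> pq" "j \<in> pq" "k < r" for i j r
    unfolding distrib_left by (intro Jm.J_add W_bound x y that)
qed

lemma W_cscale: assumes x: "x \<in> W" shows "c \<star> x \<in> W"
proof (rule W_I)
  show "c \<star> x \<in> falg N" using W_falg[OF x] by simp
  show "tcoeff a b r * (c \<star> x) \<in> Jmax" if "1 \<le> a" "a < b" "b \<le> N" "(a, b) \<noteq> (p, q)" for a b r
    unfolding cscale_simps by (intro Jm.J_cscale W0_upper[OF W_W0] x that)
  show "tcoeff j j r * (c \<star> x) - fps_nth (lam j) r \<star> (c \<star> x) \<in> Jmax" if "1 \<le> j" "j \<le> N" "j \<notin> pq" for j r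
    using Jm.J_cscale[OF W0_diag[OF W_W0[OF x] that], of c r]
    by (simp add: cscale_simps mult.commute)
  show "tcoeff i j r * (c \<star> x) \<in> Jmax" if "i \<in> pq" "j \<in> pq" "k < r" for i j r
    unfolding cscale_simps by (intro Jm.J_cscale W_bound x that)
qed

lemma W_tpoly: "x \<in> W \<Longrightarrow> i \<in> pq \<Longrightarrow> j \<in> pq \<Longrightarrow> tpoly k i j u * x \<in> W"
proof -
  assume x: "x \<in> W" and ij: "i \<in> pq" "j \<in> pq"
  have "(\<Sum>r\<in>R. u ^ (k - r) \<star> (tcoeff i j r * x)) \<in> W" for R
    by (induction R rule: infinite_finite_induct)
      (auto intro!: W_zero W_add W_cscale W_step[OF x ij])
  then show ?thesis by (simp add: tpoly_def sum_distrib_right cscale_simps)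
qed

lemma upper_J: "1 \<le> a \<Longrightarrow> a < b \<Longrightarrow> b \<le> N \<Longrightarrow> tcoeff a b r \<in> Jmax"
  and diag_J: "1 \<le> j \<Longrightarrow> j \<le> N \<Longrightarrow> tcoeff j j r - fps_nth (lam j) r \<star> 1 \<in> Jmax"
  using upper_V diag_V V_Jmax by (auto simp flip: scalar_eq_cscale)

lemma diag_tail: "i \<in> pq \<Longrightarrow> k < r \<Longrightarrow> tcoeff i i r \<in> Jmax"
  using diag_J[of i r] pq_range[of i] lam_p(2) lam_q(2) by (auto simp: cscale_simps)

lemma h_tcoeff:
  assumes "i \<in> {1..N}" "j \<in> {1..N}" "x \<in> falg N" "h * x - c \<star> x \<in> Jmax"
  shows "h * (tcoeff i j r * x) - (c + (of_nat i - of_nat j)) \<star> (tcoeff i j r * x) \<in> Jmax"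
proof -
  have "h * (tcoeff i j r * x) - tcoeff i j r * (h * x) - (of_nat i - of_nat j) \<star> (tcoeff i j r * x)
      + tcoeff i j r * (h * x - c \<star> x) \<in> Jmax"
    using assms by (intro Jm.J_add Jm.weight_op_letter Jm.J_mult tcoeff_closed)
  then show ?thesis by (simp add: algebra_simps cscale_simps)
qed

lemma h_one: "h * 1 - 0 \<star> 1 \<in> Jmax"
  using h_V V_Jmax by (auto simp: cscale_simps)

lemma one_W0: "1 \<in> W0"
  using upper_J diag_J by (auto simp: W0_def)

text \<open>
  For \<open>r > k\<close> the vector $t_{qp}^{(r)}\<xi>$ is singular: its image under $t_{pq}(u)$ consists of terms that
  contain a coefficient of an eigenvalue beyond the degree \<open>k\<close>.
\<close>

lemma one_W: "1 \<in> W"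
proof -
  have q: "p \<in> {1..N}" "q \<in> {1..N}" using p by auto
  have lower: "tcoeff q p r \<in> Jmax" if r: "k < r" for r
  proof -
    have br: "tbracket s p q r' q p r * 1 \<in> Jmax" if "k < r" for r r'
      using that
    proof (induction r' arbitrary: r)
      case 0
      then show ?case by simp
    next
      case (Suc r')
      have "tcoeff q q r' * (tcoeff p p r * 1) \<in> Jmax"
        using Jm.J_mult[OF tcoeff_closed[OF q(2,2)] diag_tail[of p r]] Suc.prems by simp
      moreover have "tcoeff q q r * (tcoeff p p r' * 1) \<in> Jmax"
      proof -
        have "tcoeff q q r * (tcoeff p p r' - fps_nth (lam p) r' \<star> 1) + fps_nth (lam p) r' \<star> tcoeff q q r \<in> Jmax"
          using Suc.prems q p by (intro Jm.J_add Jm.J_cscale Jm.J_mult tcoeff_closed diag_J diag_tail) auto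
        then show ?thesis by (simp add: right_diff_distrib cscale_simps)
      qed
      ultimately show ?case
        unfolding Jm.tbracket_Suc_left
        by (intro Jm.J_add Jm.J_cscale Jm.J_diff Suc.IH Jm.relator_in_J q) (use Suc.prems in auto)
    qed
    have upper: "tcoeff a b r' * (tcoeff q p r * 1) \<in> Jmax" if ab: "1 \<le> a" "a < b" "b \<le> N" for a b r'
    proof (cases "(a, b) = (p, q)")
      case True
      have "tcoeff q p r * (tcoeff p q r' * 1) \<in> Jmax"
        by (rule Jm.J_mult[OF tcoeff_closed[OF q(2,1)]]) (use upper_J[of p q r'] p in simp)
      then have "tcoeff p q r' * (tcoeff q p r * 1) \<in> Jmax"
        unfolding Jm.tcoeff_commute[of p q] using br[OF r] by (intro Jm.J_add Jm.J_cscale)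
      then show ?thesis using True by auto
    next
      case False
      have "tcoeff q p r * 1 \<in> W0" by (rule W0_step[OF one_W0]) auto
      then show ?thesis using W0_upper[OF _ ab False] by blast
    qed
    have "h * (tcoeff q p r * 1) - of_nat (Suc 0) \<star> (tcoeff q p r * 1) \<in> Jmax"
      using h_tcoeff[OF q(2,1) _ h_one, of r] by (simp add: cscale_simps)
    then have "tcoeff q p r * 1 \<in> Jmax"
      by (rule singular_vector[rotated]) (use q upper in \<open>simp_all del: mult_1_right\<close>)
    then show ?thesis by simp
  qed
  have "tcoeff i j r * 1 \<in> Jmax" if "i \<in> pq" "j \<in> pq" "k < r" for i j r
    using that diag_tail[of p r] diag_tail[of q r] lower[of r] upper_J[of p q r] p by auto
  then show ?thesis using one_W0 unfolding W_def by blast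
qed

text \<open>
  Multiply the relation for the superscripts \<open>r\<close>, \<open>r'\<close> by $u^{k-r} v^{k-r'}$ and sum. The shifts of the superscripts
  become the factors \<open>u\<close> and \<open>v\<close>, and the boundary terms have a superscript \<open>0\<close> or \<open>k + 1\<close> and vanish.
\<close>

lemma RTT:
  assumes x: "x \<in> W" and pq: "i \<in> pq" "j \<in> pq" "l \<in> pq" "m \<in> pq"
  defines "\<sigma> \<equiv> (- 1) ^ ((s i + s j) * (s l + s m))" and "\<tau> \<equiv> (- 1) ^ (s i * s j + s i * s l + s j * s l)"
  shows "(u - v) \<star> (tpoly k i j u * (tpoly k l m v * x) - \<sigma> \<star> (tpoly k l m v * (tpoly k i j u * x)))
     - \<tau> \<star> (tpoly k l j u * (tpoly k i m v * x) - tpoly k l j v * (tpoly k i m u * x)) \<in> Jmax"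
proof -
  note ranges = pq[THEN pq_range]
  have xf: "x \<in> falg N" using x by (rule W_falg)
  have bil: "tpoly k a b u * (tpoly k c d v * x)
      = (\<Sum>r\<le>k. \<Sum>r'\<le>k. (u ^ (k - r) * v ^ (k - r')) \<star> (tcoeff a b r * (tcoeff c d r' * x)))" for a b c d u v
  proof -
    have "tpoly k a b u * (tpoly k c d v * x) = (\<Sum>r\<le>k. u ^ (k - r) \<star> (tcoeff a b r * (tpoly k c d v * x)))"
      by (simp add: tpoly_def[of k a b] sum_distrib_right cscale_simps)
    also have "\<dots> = (\<Sum>r\<le>k. \<Sum>r'\<le>k. (u ^ (k - r) * v ^ (k - r')) \<star> (tcoeff a b r * (tcoeff c d r' * x)))"
      by (simp add: tpoly_def sum_distrib_left sum_distrib_right cscale_simps cscale_sum)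
    finally show ?thesis .
  qed
  have bil': "tpoly k a b v * (tpoly k c d u * x)
      = (\<Sum>r\<le>k. \<Sum>r'\<le>k. (u ^ (k - r) * v ^ (k - r')) \<star> (tcoeff a b r' * (tcoeff c d r * x)))" for a b c d
    unfolding bil by (subst sum.swap) (simp add: mult.commute)
  define br where "br r r' = tbracket s i j r l m r' * x" for r r'
  let ?w = "\<lambda>r r'. u ^ (k - r) * v ^ (k - r')"
  let ?SS = "\<lambda>f. \<Sum>r\<le>k. \<Sum>r'\<le>k. ?w r r' \<star> f r r'"
  let ?br = "?SS br" and ?br1 = "?SS (\<lambda>r. br (Suc r))" and ?br2 = "?SS (\<lambda>r r'. br r (Suc r'))"
  have br_eq: "tpoly k i j u * (tpoly k l m v * x) - \<sigma> \<star> (tpoly k l m v * (tpoly k i j u * x)) = ?br"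
    unfolding bil[of i j u l m v] bil'[of l m i j] cscale_sum sum_subtractf[symmetric]
    by (intro sum.cong refl)
      (simp add: br_def tbracket_def \<sigma>_def Jm.sign_cscale cscale_simps left_diff_distrib mult.assoc mult.left_commute mult.commute)
  have br0: "br 0 r' = 0" "br r 0 = 0" for r r' by (simp_all add: br_def)
  \<comment> \<open>the boundary terms of the two shifts of superscripts\<close>
  have brk: "br (Suc k) r' \<in> Jmax" "br r (Suc k) \<in> Jmax" for r r'
  proof -
    have "tcoeff i j (Suc k) * (tcoeff l m r' * x) \<in> Jmax"
      by (rule W_bound[OF W_step[OF x pq(3,4)] pq(1,2)]) simp
    moreover have "tcoeff l m r' * (tcoeff i j (Suc k) * x) \<in> Jmax"
      by (rule Jm.J_mult[OF tcoeff_closed[OF ranges(3,4)] W_bound[OF x pq(1,2)]]) simp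
    ultimately show "br (Suc k) r' \<in> Jmax"
      unfolding br_def tbracket_def left_diff_distrib Jm.sign_cscale cscale_simps mult.assoc
      by (intro Jm.J_diff Jm.J_cscale)
    have "tcoeff i j r * (tcoeff l m (Suc k) * x) \<in> Jmax"
      by (rule Jm.J_mult[OF tcoeff_closed[OF ranges(1,2)] W_bound[OF x pq(3,4)]]) simp
    moreover have "tcoeff l m (Suc k) * (tcoeff i j r * x) \<in> Jmax"
      by (rule W_bound[OF W_step[OF x pq(1,2)] pq(3,4)]) simp
    ultimately show "br r (Suc k) \<in> Jmax"
      unfolding br_def tbracket_def left_diff_distrib Jm.sign_cscale cscale_simps mult.assoc
      by (intro Jm.J_diff Jm.J_cscale)
  qed
  let ?tt = "\<lambda>r r'. tcoeff l j r * (tcoeff i m r' * x) - tcoeff l j r' * (tcoeff i m r * x)"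
  have rel: "br (Suc r) r' - br r (Suc r') - \<tau> \<star> ?tt r r' \<in> Jmax" for r r'
  proof -
    have "br (Suc r) r' - br r (Suc r') - \<tau> \<star> ?tt r r' = yangian_relator s i j l m r r' * x"
      by (simp add: br_def Jm.tbracket_Suc_left \<tau>_def)
    then show ?thesis using Jm.relator_in_J[OF ranges xf] by simp
  qed
  have S1: "?br1 - u \<star> ?br \<in> Jmax"
  proof -
    have "?br1 = (\<Sum>r\<le>k. u ^ (k - r) \<star> (\<Sum>r'\<le>k. v ^ (k - r') \<star> br (Suc r) r'))"
      by (simp add: cscale_sum cscale_simps)
    also have "\<dots> = u \<star> ?br + (\<Sum>r'\<le>k. v ^ (k - r') \<star> br (Suc k) r')"
      by (subst sum_shift[where f = "\<lambda>r. \<Sum>r'\<le>k. v ^ (k - r') \<star> br r r'"]) (simp add: cscale_sum cscale_simps br0)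
    finally show ?thesis by (auto intro!: Jm.J_sum Jm.J_cscale brk)
  qed
  have S2: "?br2 - v \<star> ?br \<in> Jmax"
  proof -
    have "?br2 = (\<Sum>r\<le>k. u ^ (k - r) \<star> (\<Sum>r'\<le>k. v ^ (k - r') \<star> br r (Suc r')))"
      by (simp add: cscale_sum cscale_simps)
    also have "\<dots> = v \<star> ?br + (\<Sum>r\<le>k. u ^ (k - r) \<star> br r (Suc k))"
      by (subst sum_shift) (simp add: cscale_sum cscale_simps br0 sum.distrib mult.left_commute)
    finally show ?thesis by (auto intro!: Jm.J_sum Jm.J_cscale brk)
  qed
  have S3: "?br1 - ?br2
      - \<tau> \<star> ?SS ?tt \<in> Jmax"
  proof -
    have "?br1 - ?br2
      - \<tau> \<star> ?SS ?tt
      = (\<Sum>r\<le>k. \<Sum>r'\<le>k. ?w r r' \<star> (br (Suc r) r' - br r (Suc r') - \<tau> \<star> ?tt r r'))"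
      unfolding cscale_sum sum_subtractf[symmetric]
      by (intro sum.cong refl) (simp add: cscale_simps mult.commute mult.left_commute)
    then show ?thesis by (auto intro!: Jm.J_sum Jm.J_cscale rel)
  qed
  have tt_eq: "tpoly k l j u * (tpoly k i m v * x) - tpoly k l j v * (tpoly k i m u * x)
      = ?SS ?tt"
    unfolding bil[of l j u i m v] bil'[of l j i m] sum_subtractf[symmetric]
    by (intro sum.cong refl) (simp add: cscale_simps)
  have "?br1 - ?br2
      - \<tau> \<star> ?SS ?tt
      - (?br1 - u \<star> ?br)
      + (?br2 - v \<star> ?br) \<in> Jmax"
    by (intro Jm.J_add[OF Jm.J_diff[OF S3 S1] S2])
  then show ?thesis unfolding br_eq tt_eq by (simp add: algebra_simps cscale_simps)
qed

end

section \<open>Words in one odd lowering series\<close>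

text \<open>
  Sorting an adjacent descent decreases this number and keeps the letter sum; it orders the words of
  one letter sum in \<open>lower_word_straighten\<close>.
\<close>

primrec inv_weight :: "nat list \<Rightarrow> nat" where
  "inv_weight [] = 0"
| "inv_weight (x # xs) = Suc (length xs) * x + inv_weight xs"

lemma inv_weight_append: "inv_weight (xs @ ys) = inv_weight xs + length ys * sum_list xs + inv_weight ys"
  by (induction xs) (auto simp: algebra_simps)

lemma inv_weight_swap: "r' < r \<Longrightarrow> inv_weight (xs @ r' # r # ys) < inv_weight (xs @ r # r' # ys)"
  by (simp add: inv_weight_append)

lemma not_sorted_wrt_less:
  "\<not> sorted_wrt (<) (l :: nat list) \<Longrightarrow> \<exists>xs r r' ys. l = xs @ r # r' # ys \<and> r' \<le> r"
proof (induction l)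
  case (Cons x l)
  show ?case
  proof (cases "sorted_wrt (<) l")
    case False
    then obtain xs r r' ys where "l = xs @ r # r' # ys" "r' \<le> r" using Cons.IH by blast
    then have "x # l = (x # xs) @ r # r' # ys \<and> r' \<le> r" by simp
    then show ?thesis by blast
  next
    case True
    then obtain y where y: "y \<in> set l" "y \<le> x" using Cons.prems by force
    then obtain z zs where z: "l = z # zs" by (cases l) auto
    then have "z \<le> x" using y True by auto
    then have "x # l = [] @ x # z # zs \<and> z \<le> x" using z by simp
    then show ?thesis by blast
  qed
qed simp

context odd_pair
begin

abbreviation "\<epsilon> \<equiv> (- 1 :: complex) ^ s p"

lemma pq_mem: "p \<in> pq" "q \<in> pq"
  by auto

section \<open>Bethe vectors do not vanish\<close>

lemma h_tpoly:
  assumes "i \<in> pq" "j \<in> pq" "x \<in> falg N" "h * x - c \<star> x \<in> Jmax"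
  shows "h * (tpoly k i j u * x) - (c + (of_nat i - of_nat j)) \<star> (tpoly k i j u * x) \<in> Jmax"
proof -
  have "h * (tpoly k i j u * x) - (c + (of_nat i - of_nat j)) \<star> (tpoly k i j u * x)
    = (\<Sum>r\<le>k. u ^ (k - r) \<star> (h * (tcoeff i j r * x) - (c + (of_nat i - of_nat j)) \<star> (tcoeff i j r * x)))"
    unfolding tpoly_def sum_distrib_left sum_distrib_right cscale_sum sum_subtractf[symmetric]
    by (intro sum.cong refl) (simp add: cscale_simps(2,7,11,12) mult.commute)
  also have "\<dots> \<in> Jmax"
    using assms by (intro Jm.J_sum Jm.J_cscale h_tcoeff pq_range)
  finally show ?thesis .
qed

lemma tpoly_one_diag:
  "tpoly k p p u - (\<Prod>a\<leftarrow>as. u + a) \<star> 1 \<in> Jmax" "tpoly k q q u - (\<Prod>b\<leftarrow>bs. u + b) \<star> 1 \<in> Jmax"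
proof -
  have 1: "tpoly k i i u - (\<Sum>r\<le>k. u ^ (k - r) * fps_nth (lam i) r) \<star> 1 \<in> Jmax" if "i \<in> pq" for i
  proof -
    have "tpoly k i i u - (\<Sum>r\<le>k. u ^ (k - r) * fps_nth (lam i) r) \<star> 1
      = (\<Sum>r\<le>k. u ^ (k - r) \<star> (tcoeff i i r - fps_nth (lam i) r \<star> 1))"
      unfolding cscale_sum_left tpoly_def sum_subtractf[symmetric]
      by (intro sum.cong refl) (simp add: cscale_simps)
    also have "\<dots> \<in> Jmax"
      using pq_range[OF that] by (intro Jm.J_sum Jm.J_cscale diag_J) auto
    finally show ?thesis .
  qed
  show "tpoly k p p u - (\<Prod>a\<leftarrow>as. u + a) \<star> 1 \<in> Jmax" "tpoly k q q u - (\<Prod>b\<leftarrow>bs. u + b) \<star> 1 \<in> Jmax"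
    using 1[OF pq_mem(1)] 1[OF pq_mem(2)] by (simp_all only: lam_p(1) lam_q(1))
qed

lemma tpoly_one_upper: "tpoly k p q u \<in> Jmax"
  unfolding tpoly_def using p by (intro Jm.J_sum Jm.J_cscale upper_J) auto

text \<open>
  If all four series vanish at \<open>v\<close> on \<open>x\<close>, then by the relations they do so on $B(u)x$, hence on
  $t_{pq}^{(r)}x$. As \<open>L\<close> has no singular vectors of positive weight, a nonzero \<open>x\<close> leads in \<open>d\<close> such
  steps to a nonzero multiple of the highest vector, where the vanishing of $A(v)$ and $D(v)$ contradicts
  the disjointness of the roots.
\<close>

lemma no_common_kernel:
  assumes "x \<in> W" "h * x - of_nat d \<star> x \<in> Jmax"
    and kill: "\<And>i j. i \<in> pq \<Longrightarrow> j \<in> pq \<Longrightarrow> tpoly k i j v * x \<in> Jmax"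
  shows "x \<in> Jmax"
  using assms
proof (induction d arbitrary: x)
  case 0
  show ?case
  proof (rule ccontr)
    assume x: "x \<notin> Jmax"
    have "h * x \<in> Jmax" using 0 by (simp add: cscale_simps)
    then obtain c where c: "x - c \<star> 1 \<in> Jmax" using weight_zero W_falg[OF 0(1)] by blast
    then have c0: "c \<noteq> 0" using x by (auto simp: cscale_simps)
    \<comment> \<open>a vector of weight \<open>0\<close> is a multiple of the highest vector, so the eigenvalues vanish at \<open>v\<close>\<close>
    have root: "(\<Prod>a\<leftarrow>l. v + a) = 0" if i: "i \<in> pq" "tpoly k i i v - (\<Prod>a\<leftarrow>l. v + a) \<star> 1 \<in> Jmax" for i l
    proof -
      have "tpoly k i i v * x - tpoly k i i v * (x - c \<star> 1) - c \<star> (tpoly k i i v - (\<Prod>a\<leftarrow>l. v + a) \<star> 1) \<in> Jmax"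
        by (intro Jm.J_diff Jm.J_cscale Jm.J_mult tpoly_closed 0(3) i pq_range c)
      then have "(c * (\<Prod>a\<leftarrow>l. v + a)) \<star> 1 \<in> Jmax" by (simp add: right_diff_distrib cscale_simps)
      then show ?thesis using proper c0 Jm.J_cscale_iff[of "c * (\<Prod>a\<leftarrow>l. v + a)" 1] by auto
    qed
    have "- v \<in> set as" "- v \<in> set bs"
      using root[OF pq_mem(1) tpoly_one_diag(1)] root[OF pq_mem(2) tpoly_one_diag(2)]
      by (auto simp: prod_list_zero_iff add_eq_0_iff)
    then show False using no_common_root by blast
  qed
next
  case (Suc d)
  have xf: "x \<in> falg N" by (rule W_falg[OF Suc.prems(1)])
  have lifted: "tpoly k l m v * (tpoly k p q u * x) \<in> Jmax" if "l \<in> pq" "m \<in> pq" for l m u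
  proof -
    \<comment> \<open>the defining relation with the terms that contain a series at \<open>v\<close> next to \<open>x\<close> removed\<close>
    have step: "(- ((u - v) * (- 1) ^ ((s i + s j) * (s l + s m)))) \<star> (tpoly k l m v * (tpoly k i j u * x))
        + ((- 1) ^ (s i * s j + s i * s l + s j * s l)) \<star> (tpoly k l j v * (tpoly k i m u * x)) \<in> Jmax"
      if ij: "i \<in> pq" "j \<in> pq" "l \<in> pq" "m \<in> pq" for i j l m u
    proof -
      let ?\<sigma> = "(- 1) ^ ((s i + s j) * (s l + s m)) :: complex"
      let ?\<tau> = "(- 1) ^ (s i * s j + s i * s l + s j * s l) :: complex"
      have 1: "tpoly k i j u * (tpoly k l m v * x) \<in> Jmax" "tpoly k l j u * (tpoly k i m v * x) \<in> Jmax"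
        by (intro Jm.J_mult[OF _ Suc.prems(3)] tpoly_closed pq_range ij)+
      have "(u - v) \<star> (tpoly k i j u * (tpoly k l m v * x) - ?\<sigma> \<star> (tpoly k l m v * (tpoly k i j u * x)))
          - ?\<tau> \<star> (tpoly k l j u * (tpoly k i m v * x) - tpoly k l j v * (tpoly k i m u * x))
          - (u - v) \<star> (tpoly k i j u * (tpoly k l m v * x)) + ?\<tau> \<star> (tpoly k l j u * (tpoly k i m v * x)) \<in> Jmax"
        by (intro Jm.J_add Jm.J_diff Jm.J_cscale RTT Suc.prems(1) ij 1)
      then show ?thesis by (simp add: cscale_simps algebra_simps)
    qed
    \<comment> \<open>the points where the determinant of the two relations for \<open>?y\<close> and \<open>?z\<close> below may vanish\<close>
    define E where "E = {v + 1, v - 1, v + \<i>, v - \<i>}"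
    have E: "(u - v)\<^sup>2 \<noteq> 1" "(u - v)\<^sup>2 \<noteq> - 1" if "u \<notin> E" for u
    proof -
      show "(u - v)\<^sup>2 \<noteq> 1" using that by (auto simp: power2_eq_1_iff E_def algebra_simps)
      have "(u - v)\<^sup>2 + 1 = (u - v - \<i>) * (u - v + \<i>)" by (simp add: power2_eq_square algebra_simps)
      moreover have "u - v - \<i> \<noteq> 0" "u - v + \<i> \<noteq> 0" using that by (auto simp: E_def algebra_simps)
      ultimately show "(u - v)\<^sup>2 \<noteq> - 1" by (metis add.commute add_uminus_conv_diff eq_neg_iff_add_eq_0 mult_eq_0_iff)
    qed
    have sq: "((- 1 :: complex) ^ n)\<^sup>2 = 1" for n by (simp flip: power_mult)
    have gen_E: "tpoly k l m v * (tpoly k p q u * x) \<in> Jmax" if u: "u \<notin> E" for u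
    proof -
      let ?y = "tpoly k l m v * (tpoly k p q u * x)"
      let ?z = "tpoly k l q v * (tpoly k p m u * x)"
      define \<sigma> where "\<sigma> = (- 1 :: complex) ^ ((s p + s q) * (s l + s m))"
      define \<tau> where "\<tau> = (- 1 :: complex) ^ (s p * s q + s p * s l + s q * s l)"
      define \<sigma>' where "\<sigma>' = (- 1 :: complex) ^ ((s p + s m) * (s l + s q))"
      define \<tau>' where "\<tau>' = (- 1 :: complex) ^ (s p * s m + s p * s l + s m * s l)"
      have 1: "(- ((u - v) * \<sigma>)) \<star> ?y + \<tau> \<star> ?z \<in> Jmax"
        unfolding \<sigma>_def \<tau>_def by (rule step) (use \<open>l \<in> pq\<close> \<open>m \<in> pq\<close> in auto)
      have 2: "(- ((u - v) * \<sigma>')) \<star> ?z + \<tau>' \<star> ?y \<in> Jmax"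
        unfolding \<sigma>'_def \<tau>'_def by (rule step) (use \<open>l \<in> pq\<close> \<open>m \<in> pq\<close> in auto)
      have s2: "\<sigma>\<^sup>2 = 1" "\<tau>\<^sup>2 = 1" "\<sigma>'\<^sup>2 = 1" "\<tau>'\<^sup>2 = 1"
        unfolding \<sigma>_def \<tau>_def \<sigma>'_def \<tau>'_def by (rule sq)+
      have "((u - v) * \<sigma>' * \<tau>) \<star> ((- ((u - v) * \<sigma>)) \<star> ?y + \<tau> \<star> ?z) + (\<tau>\<^sup>2) \<star> ((- ((u - v) * \<sigma>')) \<star> ?z + \<tau>' \<star> ?y) \<in> Jmax"
        by (intro Jm.J_add Jm.J_cscale 1 2)
      moreover have "((u - v) * \<sigma>' * \<tau>) \<star> ((- ((u - v) * \<sigma>)) \<star> ?y + \<tau> \<star> ?z) + (\<tau>\<^sup>2) \<star> ((- ((u - v) * \<sigma>')) \<star> ?z + \<tau>' \<star> ?y)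
         = (\<tau>\<^sup>2 * \<tau>' - (u - v)\<^sup>2 * (\<sigma> * \<sigma>' * \<tau>)) \<star> ?y"
        by (simp add: cscale_simps power2_eq_square algebra_simps) (simp add: algebra_simps flip: cscale_simps(4))
      moreover have "\<tau>\<^sup>2 * \<tau>' - (u - v)\<^sup>2 * (\<sigma> * \<sigma>' * \<tau>) \<noteq> 0"
      proof -
        define w where "w = (u - v)\<^sup>2"
        have "w \<noteq> 1" "- w \<noteq> 1" using E[OF u] unfolding w_def by (metis minus_minus)+
        then show ?thesis using s2 unfolding w_def[symmetric] by (auto simp: power2_eq_1_iff)
      qed
      ultimately show ?thesis using Jm.J_cscale_iff by metis
    qed
    show ?thesis
    proof (rule Jm.polyfun_extend[of "\<lambda>u. tpoly k l m v * (tpoly k p q u * x)" E])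
      show "polyfun (\<lambda>u. tpoly k l m v * (tpoly k p q u * x))"
        by (intro polyfun_mult polyfun_mult_right polyfun_tpoly)
    qed (auto simp: E_def intro: gen_E[unfolded E_def])
  qed
  have raise: "tcoeff p q r * x \<in> Jmax" for r
  proof (cases "r \<le> k")
    case False
    then show ?thesis using W_bound[OF Suc.prems(1)] by simp
  next
    case True
    have W': "tcoeff p q r * x \<in> W" by (rule W_step[OF Suc.prems(1)]) auto
    have "h * (tcoeff p q r * x) - (of_nat (Suc d) + (of_nat p - of_nat q)) \<star> (tcoeff p q r * x) \<in> Jmax"
      by (rule h_tcoeff) (use pq_range[OF pq_mem(1)] pq_range[OF pq_mem(2)] xf Suc.prems(2) in simp_all)
    then have h': "h * (tcoeff p q r * x) - of_nat d \<star> (tcoeff p q r * x) \<in> Jmax" by simp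
    have "tpoly k l m v * (tcoeff p q r * x) \<in> Jmax" if "l \<in> pq" "m \<in> pq" for l m
    proof (rule Jm.coefficients_in_J[OF _ True])
      fix u
      have "tpoly k l m v * (tpoly k p q u * x) = (\<Sum>r\<le>k. u ^ (k - r) \<star> (tpoly k l m v * (tcoeff p q r * x)))"
        by (simp add: tpoly_def[of k p q] sum_distrib_left sum_distrib_right cscale_simps)
      then show "(\<Sum>r\<le>k. u ^ (k - r) \<star> (tpoly k l m v * (tcoeff p q r * x))) \<in> Jmax"
        using lifted[OF that, of u] by simp
    qed
    then show ?thesis by (rule Suc.IH[OF W' h'])
  qed
  show ?case
  proof (rule singular_vector[OF xf Suc.prems(2)])
    fix a b r assume "1 \<le> a" "a < b" "b \<le> N"
    then show "tcoeff a b r * x \<in> Jmax"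
      using raise W0_upper[OF W_W0[OF Suc.prems(1)]] by (cases "(a, b) = (p, q)") auto
  qed
qed

lemma sign_nonzero: "\<epsilon> \<noteq> 0"
  by simp

lemma chain_tpoly_weight:
  "chain (tpoly k q p) ys \<in> W \<and> h * chain (tpoly k q p) ys - of_nat (length ys) \<star> chain (tpoly k q p) ys \<in> Jmax"
proof (induction ys)
  case Nil
  then show ?case using one_W h_one by simp
next
  case (Cons a ys)
  have "h * (tpoly k q p (- a) * chain (tpoly k q p) ys)
     - (of_nat (length ys) + (of_nat q - of_nat p)) \<star> (tpoly k q p (- a) * chain (tpoly k q p) ys) \<in> Jmax"
    using Cons W_falg by (intro h_tpoly) auto
  then show ?case using Cons W_tpoly[of _ q p] by (simp add: add.commute)
qed

sublocale chain_p: bethe_chain N s Jmax "tpoly k p p" "tpoly k p q" "tpoly k q p" "tpoly k q q" W \<epsilon> \<epsilon> as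
proof unfold_locales
  note in_range = pq_range[OF pq_mem(1)] pq_range[OF pq_mem(2)]
  fix u v x
  show "tpoly k p p u \<in> falg N" "tpoly k p q u \<in> falg N" "tpoly k q p u \<in> falg N" "tpoly k q q u \<in> falg N"
    using in_range by auto
  show "1 \<in> W" by (rule one_W)
  show "polyfun (tpoly k p p)" "polyfun (tpoly k p q)" by (rule polyfun_tpoly)+
  show "tpoly k p p u - (\<Prod>a\<leftarrow>as. u + a) \<star> 1 \<in> Jmax" by (rule tpoly_one_diag)
  show "tpoly k p q u \<in> Jmax" by (rule tpoly_one_upper)
  assume x: "x \<in> W"
  show "tpoly k q p u * x \<in> W" by (rule W_tpoly[OF x]) auto
  show "(u - v) \<star> (tpoly k p p u * (tpoly k q p v * x) - tpoly k q p v * (tpoly k p p u * x)) -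
      \<epsilon> \<star> (tpoly k q p u * (tpoly k p p v * x) - tpoly k q p v * (tpoly k p p u * x)) \<in> Jmax"
    using RTT[OF x pq_mem(1,1,2,1), of u v] parity by (auto simp: cscale_simps)
  show "(u - v) \<star> (tpoly k p q u * (tpoly k q p v * x) + tpoly k q p v * (tpoly k p q u * x)) -
      \<epsilon> \<star> (tpoly k q q v * (tpoly k p p u * x) - tpoly k q q u * (tpoly k p p v * x)) \<in> Jmax"
    using RTT[OF x pq_mem(1,2,2,1), of u v] parity by (auto simp: cscale_simps algebra_simps)
qed

sublocale chain_q: bethe_chain N s Jmax "tpoly k q q" "tpoly k p q" "tpoly k q p" "tpoly k p p" W \<epsilon> "- \<epsilon>" bs
proof unfold_locales
  note in_range = pq_range[OF pq_mem(1)] pq_range[OF pq_mem(2)]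
  fix u v x
  show "tpoly k p p u \<in> falg N" "tpoly k p q u \<in> falg N" "tpoly k q p u \<in> falg N" "tpoly k q q u \<in> falg N"
    using in_range by auto
  show "1 \<in> W" by (rule one_W)
  show "polyfun (tpoly k q q)" "polyfun (tpoly k p q)" by (rule polyfun_tpoly)+
  show "tpoly k q q u - (\<Prod>a\<leftarrow>bs. u + a) \<star> 1 \<in> Jmax" by (rule tpoly_one_diag)
  show "tpoly k p q u \<in> Jmax" by (rule tpoly_one_upper)
  assume x: "x \<in> W"
  show "tpoly k q p u * x \<in> W" by (rule W_tpoly[OF x]) auto
  show "(u - v) \<star> (tpoly k q q u * (tpoly k q p v * x) - tpoly k q p v * (tpoly k q q u * x)) -
      \<epsilon> \<star> (tpoly k q p u * (tpoly k q q v * x) - tpoly k q p v * (tpoly k q q u * x)) \<in> Jmax"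
    using RTT[OF x pq_mem(2,1,2,2), of v u] parity by (auto simp: cscale_simps algebra_simps)
  show "(u - v) \<star> (tpoly k p q u * (tpoly k q p v * x) + tpoly k q p v * (tpoly k p q u * x)) -
      (- \<epsilon>) \<star> (tpoly k p p v * (tpoly k q q u * x) - tpoly k p p u * (tpoly k q q v * x)) \<in> Jmax"
    using Jm.J_uminus[OF RTT[OF x pq_mem(2,1,1,2), of v u]] parity by (auto simp: cscale_simps algebra_simps)
qed

lemma chain_nondegenerate:
  assumes "tpoly k p p v * chain (tpoly k q p) ys \<in> Jmax" "tpoly k p q v * chain (tpoly k q p) ys \<in> Jmax"
    "tpoly k q p v * chain (tpoly k q p) ys \<in> Jmax" "tpoly k q q v * chain (tpoly k q p) ys \<in> Jmax"
  shows "chain (tpoly k q p) ys \<in> Jmax"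
  using no_common_kernel[of "chain (tpoly k q p) ys" "length ys" v] chain_tpoly_weight[of ys] assms by blast

lemma chain_nonzero: "chain (tpoly k q p) as \<notin> Jmax" "chain (tpoly k q p) bs \<notin> Jmax"
proof -
  show "chain (tpoly k q p) as \<notin> Jmax"
    by (rule chain_p.bethe_chain_nonzero[OF proper sign_nonzero order_as chain_nondegenerate, of _ "[]"]) simp_all
  show "chain (tpoly k q p) bs \<notin> Jmax"
    by (rule chain_q.bethe_chain_nonzero[OF proper _ order_bs chain_nondegenerate, of _ "[]"]) (simp_all add: sign_nonzero)
qed

section \<open>The lowest vector of the rank one subalgebra\<close>

definition lower_word :: "nat list \<Rightarrow> letter free_alg \<Rightarrow> letter free_alg" where
  "lower_word l x = foldr (\<lambda>r y. tcoeff q p r * y) l x"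

lemma lower_word_simps [simp]: "lower_word [] x = x" "lower_word (r # l) x = tcoeff q p r * lower_word l x"
  "lower_word (l @ l') x = lower_word l (lower_word l' x)"
  by (simp_all add: lower_word_def)

lemma lower_word_linear: "lower_word l (x + y) = lower_word l x + lower_word l y"
  "lower_word l (c \<star> x) = c \<star> lower_word l x" "lower_word l (x - y) = lower_word l x - lower_word l y"
  "lower_word l 0 = 0"
  by (induction l) (simp_all add: distrib_left right_diff_distrib cscale_simps)

lemma lower_word_sum: "lower_word l (\<Sum>i\<in>I. f i) = (\<Sum>i\<in>I. lower_word l (f i))"
  by (induction I rule: infinite_finite_induct) (simp_all add: lower_word_linear)

lemma lower_word_W: "x \<in> W \<Longrightarrow> lower_word l x \<in> W"
  by (induction l) (auto intro: W_step)

lemma lower_word_J: "x \<in> Jmax \<Longrightarrow> lower_word l x \<in> Jmax"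
  by (induction l) (simp_all add: Jm.J_mult[OF tcoeff_closed[OF pq_range[OF pq_mem(2)] pq_range[OF pq_mem(1)]]])

definition zeta :: "letter free_alg" where
  "zeta = lower_word [1..<Suc k] 1"

text \<open>
  The generators $t_{qp}^{(r)}$ are odd, so they anticommute up to words of the same length and smaller letter
  sum; in particular twice a square is such a combination. This reduces every word to strictly
  increasing ones, whose letters may be taken from $1, \dots, k$. For \<open>n = k\<close> one such word exists, for
  \<open>n > k\<close> none.
\<close>

lemma lower_word_straighten:
  assumes U_add: "\<And>x y. x \<in> U \<Longrightarrow> y \<in> U \<Longrightarrow> x + y \<in> U" and U_cscale: "\<And>x c. x \<in> U \<Longrightarrow> c \<star> x \<in> U"
    and U_J: "Jmax \<subseteq> U" and zeta: "n = k \<Longrightarrow> zeta \<in> U" and "k \<le> n"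
  shows "length l = n \<Longrightarrow> lower_word l 1 \<in> U"
proof (induction l rule: wf_induct_rule[OF wf_measures[of "[sum_list, inv_weight]"]])
  case (1 l)
  have U_diff: "x - y \<in> U" if "x \<in> U" "y \<in> U" for x y
    using U_add[OF that(1) U_cscale[OF that(2), of "- 1"]] by (simp add: cscale_simps)
  have U0: "0 \<in> U" using U_J Jm.J_zero by blast
  have IH: "lower_word l' 1 \<in> U" if "length l' = n" "sum_list l' < sum_list l" for l'
    using 1 that by simp
  have IH': "lower_word l' 1 \<in> U" if "length l' = n" "sum_list l' = sum_list l" "inv_weight l' < inv_weight l" for l'
    using 1 that by simp
  show ?case
  proof (cases "sorted_wrt (<) l")
    case True
    show ?thesis
    proof (cases "set l \<subseteq> {1..k}")
      case in_range: True
      have dist: "distinct l" using True by (simp add: strict_sorted_iff)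
      then have "n \<le> k" using 1(2) card_mono[OF _ in_range] by (simp add: distinct_card)
      then have n: "n = k" using \<open>k \<le> n\<close> by simp
      then have "set l = {1..k}"
        using in_range dist 1(2) by (intro card_subset_eq) (auto simp: distinct_card)
      then have "set l = set [1..<Suc k]"
        by (simp only: set_upt atLeastLessThanSuc_atLeastAtMost)
      then have "l = [1..<Suc k]"
        by (rule strict_sorted_equal[OF sorted_wrt_upt True])
      then show ?thesis using zeta[OF n] by (simp add: zeta_def)
    next
      case False
      then obtain r where r: "r \<in> set l" "r = 0 \<or> k < r" by force
      then obtain l1 l2 where l: "l = l1 @ r # l2" by (meson split_list)
      have "tcoeff q p r * lower_word l2 1 \<in> Jmax"
        using r(2) W_bound[OF lower_word_W[OF one_W], of q p r] by (auto simp: tcoeff_def)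
      then show ?thesis using lower_word_J U_J l by auto
    qed
  next
    case False
    then obtain l1 r r' l2 where l: "l = l1 @ r # r' # l2" "r' \<le> r"
      using not_sorted_wrt_less by blast
    let ?x = "lower_word l2 1"
    have x: "?x \<in> W" by (rule lower_word_W[OF one_W])
    have br: "lower_word l1 (tbracket s q p a q p a' * ?x) \<in> U" if "a + a' = r + r'" for a a'
      using that
    proof (induction a arbitrary: a')
      case 0
      then show ?case using U0 by (simp add: lower_word_linear)
    next
      case (Suc a)
      have "lower_word l1 (tcoeff q p b * (tcoeff q p b' * ?x)) \<in> U" if "Suc (b + b') = r + r'" for b b'
        using IH[of "l1 @ b # b' # l2"] 1(2) l that by simp
      moreover have "lower_word l1 (yangian_relator s q p q p a a' * ?x) \<in> U"
        by (intro subsetD[OF U_J] lower_word_J Jm.relator_in_J pq_range pq_mem W_falg[OF x])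
      ultimately show ?case
        unfolding Jm.tbracket_Suc_left lower_word_linear
        by (intro U_add U_cscale U_diff Suc.IH) (use Suc.prems in auto)
    qed
    have sum: "tbracket s q p r q p r' * ?x = tcoeff q p r * (tcoeff q p r' * ?x) + tcoeff q p r' * (tcoeff q p r * ?x)"
      using parity by (auto simp: tbracket_def algebra_simps)
    have "lower_word l1 (tcoeff q p r * (tcoeff q p r' * ?x)) \<in> U"
    proof (cases "r = r'")
      case True
      have "2 \<star> lower_word l1 (tcoeff q p r * (tcoeff q p r * ?x)) \<in> U"
        using br[of r r'] True unfolding sum lower_word_linear by (simp add: cscale_simps(4)[of 1 1, simplified] cscale_simps)
      from U_cscale[OF this, of "1 / 2"] show ?thesis using True by (simp add: cscale_simps)
    next
      case False
      then have "lower_word l1 (tcoeff q p r' * (tcoeff q p r * ?x)) \<in> U"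
        using IH'[of "l1 @ r' # r # l2"] 1(2) l inv_weight_swap[of r' r l1 l2] by simp
      from U_diff[OF br[of r r'] this] show ?thesis unfolding sum lower_word_linear by simp
    qed
    then show ?thesis using l by simp
  qed
qed

lemma chain_in_span:
  assumes U_add: "\<And>x y. x \<in> U \<Longrightarrow> y \<in> U \<Longrightarrow> x + y \<in> U" and U_cscale: "\<And>x c. x \<in> U \<Longrightarrow> c \<star> x \<in> U"
    and U_0: "0 \<in> U"
  shows "(\<And>l'. length l' = length ys \<Longrightarrow> lower_word l (lower_word l' 1) \<in> U) \<Longrightarrow>
    lower_word l (chain (tpoly k q p) ys) \<in> U"
proof (induction ys arbitrary: l)
  case Nil
  then show ?case using Nil[of "[]"] by simp
next
  case (Cons a ys)
  have "lower_word (l @ [r]) (chain (tpoly k q p) ys) \<in> U" for r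
  proof (rule Cons.IH)
    fix l' :: "nat list" assume "length l' = length ys"
    then show "lower_word (l @ [r]) (lower_word l' 1) \<in> U" using Cons.prems[of "r # l'"] by simp
  qed
  then have "(\<Sum>r\<in>R. (- a) ^ (k - r) \<star> lower_word (l @ [r]) (chain (tpoly k q p) ys)) \<in> U" for R
    by (induction R rule: infinite_finite_induct) (auto intro: U_0 U_add U_cscale)
  then show ?case
    by (simp add: tpoly_def[of k q p "- a"] sum_distrib_right lower_word_sum lower_word_linear cscale_simps)
qed

lemma chain_multiple_of_zeta:
  assumes "length ys = k" shows "\<exists>c. chain (tpoly k q p) ys - c \<star> zeta \<in> Jmax"
proof -
  let ?U = "{x. \<exists>c. x - c \<star> zeta \<in> Jmax}"
  have add: "x + y \<in> ?U" if xy: "x \<in> ?U" "y \<in> ?U" for x y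
  proof -
    obtain c d where "x - c \<star> zeta \<in> Jmax" "y - d \<star> zeta \<in> Jmax" using xy by blast
    from Jm.J_add[OF this] have "(x + y) - (c + d) \<star> zeta \<in> Jmax" by (simp add: algebra_simps cscale_simps)
    then show ?thesis by blast
  qed
  have scale: "c \<star> x \<in> ?U" if x: "x \<in> ?U" for c x
  proof -
    obtain d where "x - d \<star> zeta \<in> Jmax" using x by blast
    from Jm.J_cscale[OF this, of c] have "c \<star> x - (c * d) \<star> zeta \<in> Jmax" by (simp add: cscale_simps)
    then show ?thesis by blast
  qed
  have J: "Jmax \<subseteq> ?U" by (auto intro!: exI[of _ 0] simp: cscale_simps)
  have z: "zeta \<in> ?U" by (auto intro!: exI[of _ 1] simp: cscale_simps)
  have "lower_word [] (chain (tpoly k q p) ys) \<in> ?U"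
  proof (rule chain_in_span[OF add scale])
    show "0 \<in> ?U" using J Jm.J_zero by blast
    fix l' :: "nat list" assume "length l' = length ys"
    then have "lower_word l' 1 \<in> ?U" using assms by (intro lower_word_straighten[OF add scale J z]) auto
    then show "lower_word [] (lower_word l' 1) \<in> ?U" by simp
  qed
  then show ?thesis by simp
qed

lemma zeta_W: "zeta \<in> W"
  unfolding zeta_def by (rule lower_word_W[OF one_W])

text \<open>
  Multiplying \<open>\<zeta>\<close> by one more generator gives a word of length \<open>k + 1\<close>.
\<close>

lemma zeta_lower: "tcoeff q p r * zeta \<in> Jmax"
proof -
  have "lower_word (r # [1..<Suc k]) 1 \<in> Jmax"
    by (rule lower_word_straighten[where n = "Suc k"]) auto
  then show ?thesis by (simp add: zeta_def)
qed

lemma zeta_notin: "zeta \<notin> Jmax"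
proof
  assume z: "zeta \<in> Jmax"
  obtain c where "chain (tpoly k q p) as - c \<star> zeta \<in> Jmax"
    using chain_multiple_of_zeta length_roots by blast
  then show False using Jm.J_cong[of "chain (tpoly k q p) as" "c \<star> zeta"] Jm.J_cscale[OF z] chain_nonzero(1) by blast
qed

lemma eigen_transfer:
  assumes X: "X \<notin> Jmax" "X - c \<star> zeta \<in> Jmax" and t: "t \<in> falg N" and "t * X - e \<star> X \<in> Jmax"
  shows "t * zeta - e \<star> zeta \<in> Jmax"
proof -
  have c: "c \<noteq> 0" using X by (auto simp: cscale_simps)
  have "(t * X - e \<star> X) - t * (X - c \<star> zeta) + e \<star> (X - c \<star> zeta) \<in> Jmax"
    by (intro Jm.J_add Jm.J_diff Jm.J_cscale Jm.J_mult assms)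
  then have "c \<star> (t * zeta - e \<star> zeta) \<in> Jmax"
    by (simp add: algebra_simps cscale_simps)
  then show ?thesis using Jm.J_cscale_iff[OF c] by simp
qed

lemma zeta_eigen:
  "tpoly k p p u * zeta - (\<Prod>a\<leftarrow>as. u + (a - \<epsilon>)) \<star> zeta \<in> Jmax"
  "tpoly k q q u * zeta - (\<Prod>b\<leftarrow>bs. u + (b - \<epsilon>)) \<star> zeta \<in> Jmax"
proof -
  note in_range = pq_range[OF pq_mem(1)] pq_range[OF pq_mem(2)]
  obtain c where c: "chain (tpoly k q p) as - c \<star> zeta \<in> Jmax"
    using chain_multiple_of_zeta length_roots by blast
  show "tpoly k p p u * zeta - (\<Prod>a\<leftarrow>as. u + (a - \<epsilon>)) \<star> zeta \<in> Jmax"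
    using chain_p.chain_eigen[of "[]" as u] in_range
    by (intro eigen_transfer[OF chain_nonzero(1) c]) auto
  obtain c where c: "chain (tpoly k q p) bs - c \<star> zeta \<in> Jmax"
    using chain_multiple_of_zeta length_roots by blast
  show "tpoly k q q u * zeta - (\<Prod>b\<leftarrow>bs. u + (b - \<epsilon>)) \<star> zeta \<in> Jmax"
    using chain_q.chain_eigen[of "[]" bs u] in_range
    by (intro eigen_transfer[OF chain_nonzero(2) c]) auto
qed

lemma zeta_weight:
  assumes i: "i \<in> pq" and z: "\<And>u. tpoly k i i u * zeta - e u \<star> zeta \<in> Jmax"
    and e: "\<And>u. e u = (\<Sum>r\<le>k. u ^ (k - r) * fps_nth f r)" and tail: "\<And>r. k < r \<Longrightarrow> fps_nth f r = 0"
  shows "tcoeff i i r * zeta - fps_nth f r \<star> zeta \<in> Jmax"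
proof (cases "r \<le> k")
  case True
  show ?thesis
  proof (rule Jm.coefficients_in_J[OF _ True])
    fix u
    have "tpoly k i i u * zeta - e u \<star> zeta = (\<Sum>r\<le>k. u ^ (k - r) \<star> (tcoeff i i r * zeta - fps_nth f r \<star> zeta))"
      unfolding e cscale_sum_left tpoly_def sum_distrib_right sum_subtractf[symmetric]
      by (intro sum.cong refl) (simp add: cscale_simps)
    then show "(\<Sum>r\<le>k. u ^ (k - r) \<star> (tcoeff i i r * zeta - fps_nth f r \<star> zeta)) \<in> Jmax"
      using z[of u] by simp
  qed
next
  case False
  then show ?thesis using W_bound[OF zeta_W i i, of r] tail[of r] by (simp add: cscale_simps)
qed

end

section \<open>The eigenvalue polynomials\<close>

lemma weight_poly_Suc: "fps_nth (weight_poly (Suc k) c) r =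
    fps_nth (weight_poly k c) r + (if r = 0 then 0 else c (Suc k) * fps_nth (weight_poly k c) (r - 1))"
proof -
  have "weight_poly (Suc k) c = weight_poly k c + fps_const (c (Suc k)) * (fps_X * weight_poly k c)"
    by (simp add: weight_poly_def algebra_simps)
  then show ?thesis by (simp only: fps_add_nth fps_mult_left_const_nth fps_X_mult_nth) simp
qed

lemma weight_poly_tail: "k < r \<Longrightarrow> fps_nth (weight_poly k c) r = 0"
proof (induction k arbitrary: r)
  case 0
  then show ?case by (simp add: weight_poly_def)
next
  case (Suc k)
  then show ?case by (simp add: weight_poly_Suc)
qed

lemma weight_poly_eval:
  "(\<Sum>r\<le>k. u ^ (k - r) * fps_nth (weight_poly k c) r) = (\<Prod>a\<leftarrow>map c [1..<Suc k]. u + a)"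
proof (induction k)
  case 0
  then show ?case by (simp add: weight_poly_def)
next
  case (Suc k)
  let ?f = "fps_nth (weight_poly k c)"
  have "(\<Sum>r\<le>Suc k. u ^ (Suc k - r) * fps_nth (weight_poly (Suc k) c) r)
    = (\<Sum>r\<le>Suc k. u ^ (Suc k - r) * ?f r) + (\<Sum>r\<le>Suc k. u ^ (Suc k - r) * (if r = 0 then 0 else c (Suc k) * ?f (r - 1)))"
    by (simp only: weight_poly_Suc distrib_left sum.distrib)
  also have "(\<Sum>r\<le>Suc k. u ^ (Suc k - r) * ?f r) = u * (\<Sum>r\<le>k. u ^ (k - r) * ?f r)"
    by (simp add: weight_poly_tail sum_distrib_left Suc_diff_le mult.assoc)
  also have "(\<Sum>r\<le>Suc k. u ^ (Suc k - r) * (if r = 0 then 0 else c (Suc k) * ?f (r - 1)))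
    = c (Suc k) * (\<Sum>r\<le>k. u ^ (k - r) * ?f r)"
    by (subst sum.atMost_Suc_shift) (simp add: sum_distrib_left mult.left_commute)
  finally show ?case using Suc by (simp add: algebra_simps)
qed

section \<open>Relabelling by a transposition\<close>

abbreviation adj_swap :: "nat \<Rightarrow> nat \<Rightarrow> nat" where
  "adj_swap p \<equiv> transpose p (Suc p)"

definition relabel_swap :: "nat \<Rightarrow> letter free_alg \<Rightarrow> letter free_alg" where
  "relabel_swap p = relabel (\<lambda>(a, b, r). (adj_swap p a, adj_swap p b, r))"

lemma relabel_swap_simps:
  "relabel_swap p (x + y) = relabel_swap p x + relabel_swap p y"
  "relabel_swap p (x * y) = relabel_swap p x * relabel_swap p y"
  "relabel_swap p (- x) = - relabel_swap p x"
  "relabel_swap p (x - y) = relabel_swap p x - relabel_swap p y"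
  "relabel_swap p (scalar c) = scalar c" "relabel_swap p 1 = 1" "relabel_swap p 0 = 0"
  "relabel_swap p ((- 1) ^ m) = (- 1) ^ m"
  by (simp_all add: relabel_swap_def relabel_add relabel_mult relabel_uminus relabel_diff relabel_neg_one_power)

lemma relabel_swap_tcoeff:
  "relabel_swap p (tcoeff i j r) = tcoeff (adj_swap p i) (adj_swap p j) r"
  by (auto simp: tcoeff_def relabel_swap_def relabel_gen dest: transpose_eq_imp_eq)

lemma transpose_range: "1 \<le> p \<Longrightarrow> Suc p \<le> N \<Longrightarrow> adj_swap p i \<in> {1..N} \<longleftrightarrow> i \<in> {1..N}"
  by (auto simp: transpose_def)

lemma relabel_swap_closed:
  assumes "1 \<le> p" "Suc p \<le> N" "x \<in> falg N" shows "relabel_swap p x \<in> falg N"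
  unfolding relabel_swap_def using assms
  by (intro relabel_closed[OF assms(3)]) (auto simp: yangian_letters_def transpose_def)

lemma relabel_swap_swap: "x \<in> falg N \<Longrightarrow> relabel_swap p (relabel_swap p x) = x"
  unfolding relabel_swap_def by (rule relabel_relabel[of _ "yangian_letters N"]) auto

lemma relabel_swap_relator:
  "relabel_swap p (yangian_relator (s \<circ> adj_swap p) i j k l m m') =
    yangian_relator s (adj_swap p i) (adj_swap p j) (adj_swap p k) (adj_swap p l) m m'"
  by (simp add: yangian_relator_def tbracket_def relabel_swap_simps relabel_swap_tcoeff)

lemma yangian_ideal_closed: "yangian_ideal N s \<subseteq> falg N"
  using presents_left_ideal[OF presents_regular] unfolding left_ideal_def by blast

lemma relabel_swap_ideal:
  assumes p: "1 \<le> p" "Suc p \<le> N" and x: "x \<in> yangian_ideal N (s \<circ> adj_swap p)"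
  shows "relabel_swap p x \<in> yangian_ideal N s"
proof -
  let ?K = "{x \<in> falg N. relabel_swap p x \<in> yangian_ideal N s}"
  interpret I: ideal "yangian_ideal N s" "free_algebra (yangian_letters N)" by (rule ideal_yangian)
  have add: "a + b \<in> yangian_ideal N s" if "a \<in> yangian_ideal N s" "b \<in> yangian_ideal N s" for a b
    using additive_subgroup.a_closed[OF ideal.axioms(1)[OF ideal_yangian] that] by simp
  have z: "0 \<in> yangian_ideal N s" using additive_subgroup.zero_closed[OF ideal.axioms(1)[OF ideal_yangian, of N s]] by simp
  have mult: "a * b \<in> yangian_ideal N s" "b * a \<in> yangian_ideal N s" if "a \<in> falg N" "b \<in> yangian_ideal N s" for a b
    using I.I_l_closed[OF that(2,1)] I.I_r_closed[OF that(2,1)] by simp_all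
  have neg: "- a \<in> yangian_ideal N s" if "a \<in> yangian_ideal N s" for a
    using mult(1)[of "- 1" a] that by simp
  have "ideal ?K (free_algebra (yangian_letters N))"
  proof (rule idealI[OF ring_free_algebra])
    show "subgroup ?K (add_monoid (free_algebra (yangian_letters N)))"
    proof (rule group.subgroupI[OF abelian_group.a_group[OF ring.is_abelian_group[OF ring_free_algebra]]])
      show "?K \<noteq> {}" using z by (auto intro!: exI[of _ 0] simp: relabel_swap_simps)
      fix a assume a: "a \<in> ?K"
      have "\<ominus>\<^bsub>free_algebra (yangian_letters N)\<^esub> a = - a"
        using a by (intro abelian_group.minus_equality[OF ring.is_abelian_group[OF ring_free_algebra]]) auto
      then show "inv\<^bsub>add_monoid (free_algebra (yangian_letters N))\<^esub> a \<in> ?K"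
        using a neg unfolding a_inv_def[symmetric] by (simp add: relabel_swap_simps)
    qed (auto simp: relabel_swap_simps add)
  qed (use relabel_swap_closed[OF p] mult in \<open>auto simp: relabel_swap_simps\<close>)
  moreover have "relators N (s \<circ> adj_swap p) \<subseteq> ?K"
  proof
    fix y assume y: "y \<in> relators N (s \<circ> adj_swap p)"
    then obtain i j k l m m' where *: "y = yangian_relator (s \<circ> adj_swap p) i j k l m m'"
        "i \<in> {1..N}" "j \<in> {1..N}" "k \<in> {1..N}" "l \<in> {1..N}"
      unfolding relators_def by blast
    have "relabel_swap p y \<in> relators N s"
      unfolding *(1) relabel_swap_relator relators_def
      using *(2-) transpose_range[OF p] by blast
    then show "y \<in> ?K" using y relators_closed relators_subset by blast
  qed
  ultimately have "yangian_ideal N (s \<circ> adj_swap p) \<subseteq> ?K"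
    by (rule yangian_ideal_minimal)
  then show ?thesis using x by blast
qed

lemma swap_twice: "(s \<circ> adj_swap p) \<circ> adj_swap p = (s :: nat \<Rightarrow> nat)"
  by auto

text \<open>
  Relabelling is an involution that carries the two ideals into each other, so it maps a coset onto a coset.
\<close>

lemma yangian_relabel_class:
  assumes p: "1 \<le> p" "Suc p \<le> N"
  shows "yangian_relabel (transpose p (p + 1)) (yangian_class N (s \<circ> adj_swap p) x)
     = yangian_class N s (relabel_swap p x)"
proof -
  let ?s' = "s \<circ> adj_swap p"
  have cls: "yangian_class N t y = (\<lambda>g. g + y) ` yangian_ideal N t" for t y
    by (auto simp: yangian_class_def a_r_coset_def r_coset_def)
  have img: "relabel_swap p ` yangian_ideal N ?s' = yangian_ideal N s"
  proof (intro equalityI subsetI)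
    fix y assume y: "y \<in> yangian_ideal N s"
    then have "relabel_swap p y \<in> yangian_ideal N ?s'"
      using relabel_swap_ideal[OF p, of y ?s'] by (simp only: swap_twice)
    moreover have "y = relabel_swap p (relabel_swap p y)"
      using y presents_left_ideal[OF presents_regular, of N s] by (auto simp: left_ideal_def relabel_swap_swap)
    ultimately show "y \<in> relabel_swap p ` yangian_ideal N ?s'" by blast
  qed (use relabel_swap_ideal[OF p] in blast)
  have "yangian_relabel (transpose p (p + 1)) (yangian_class N ?s' x)
      = (\<lambda>g. relabel_swap p g + relabel_swap p x) ` yangian_ideal N ?s'"
    by (simp add: yangian_relabel_def cls image_image relabel_swap_simps flip: relabel_swap_def)
  also have "\<dots> = (\<lambda>g. g + relabel_swap p x) ` relabel_swap p ` yangian_ideal N ?s'"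
    by (simp only: image_image)
  finally show ?thesis unfolding img cls .
qed

section \<open>The odd reflection\<close>

text \<open>
  Both signs of the reflection at once: \<open>(- 1) ^ s p\<close> is \<open>- 1\<close> for the pair \<open>10\<close> and \<open>1\<close> for the pair \<open>01\<close>.
\<close>

definition reflected :: "nat \<Rightarrow> nat \<Rightarrow> (nat \<Rightarrow> nat) \<Rightarrow> (nat \<Rightarrow> complex fps) \<Rightarrow> (nat \<Rightarrow> complex) \<Rightarrow>
    (nat \<Rightarrow> complex) \<Rightarrow> nat \<Rightarrow> complex fps" where
  "reflected p k s lam a b =
     lam(p := weight_poly k (\<lambda>r. b r - (- 1) ^ s p), Suc p := weight_poly k (\<lambda>r. a r - (- 1) ^ s p))"

text \<open>
  The vector \<open>z\<close> is \<open>zeta\<close>; the set in the last two claims is its annihilator in the algebra of the swapped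
  sequence.
\<close>

lemma reflected_vector:
  assumes p: "1 \<le> p" "Suc p \<le> N" and parity: "s p = 0 \<and> s (Suc p) = 1 \<or> s p = 1 \<and> s (Suc p) = 0"
    and lam: "lam p = weight_poly k a" "lam (Suc p) = weight_poly k b"
    and no_common_root: "\<And>r t. r \<in> {1..k} \<Longrightarrow> t \<in> {1..k} \<Longrightarrow> a r \<noteq> b t"
    and proper: "1 \<notin> maximal_ideal N s lam"
  obtains z where "z \<in> falg N" "z \<notin> maximal_ideal N s lam"
    "verma_ideal N (s \<circ> adj_swap p) (reflected p k s lam a b) \<subseteq>
       {x \<in> falg N. relabel_swap p x * z \<in> maximal_ideal N s lam}"
    "left_ideal N {x \<in> falg N. relabel_swap p x * z \<in> maximal_ideal N s lam}"
proof -
  define \<epsilon> :: complex where "\<epsilon> = (- 1) ^ s p"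
  have \<epsilon>: "\<epsilon> = 1 \<or> \<epsilon> = - 1" using parity by (auto simp: \<epsilon>_def)
  \<comment> \<open>sorted by \<open>key\<close>, a later entry minus an earlier one is never \<open>\<epsilon>\<close>, because its real part does not have the sign of \<open>\<epsilon>\<close>\<close>
  define key where "key c = - Re (\<epsilon> * c)" for c
  define as where "as = sort_key key (map a [1..<Suc k])"
  define bs where "bs = sort_key key (map b [1..<Suc k])"
  have prod: "(\<Prod>c\<leftarrow>sort_key key cs. g c) = (\<Prod>c\<leftarrow>cs. g c)" for g :: "complex \<Rightarrow> complex" and cs
  proof -
    have "prod_mset (mset (map g (sort_key key cs))) = prod_mset (mset (map g cs))" by simp
    then show ?thesis by (simp only: prod_mset_prod_list)
  qed
  have order: "sorted_wrt (\<lambda>c r. r - c \<noteq> (- 1) ^ s p) (sort_key key cs)" for cs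
  proof -
    have "sorted_wrt (\<lambda>c r. key c \<le> key r) (sort_key key cs)"
      using sorted_sort_key[of key cs] by (simp add: sorted_map)
    then show ?thesis
    proof (rule sorted_wrt_mono_rel[rotated])
      fix c r assume "key c \<le> key r"
      then show "r - c \<noteq> (- 1) ^ s p"
        using \<epsilon> unfolding \<epsilon>_def[symmetric] key_def by (auto simp: complex_eq_iff)
    qed
  qed
  interpret highest_weight N s lam .
  interpret odd_pair N s lam p k as bs
  proof unfold_locales
    show "1 \<notin> Jmax" using proper by (simp add: Jmax_def)
    show "set as \<inter> set bs = {}" using no_common_root by (auto simp: as_def bs_def)
    show "(\<Sum>r\<le>k. u ^ (k - r) * fps_nth (lam p) r) = (\<Prod>a\<leftarrow>as. u + a)" for u
      unfolding lam(1) weight_poly_eval as_def prod ..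
    show "(\<Sum>r\<le>k. u ^ (k - r) * fps_nth (lam (Suc p)) r) = (\<Prod>a\<leftarrow>bs. u + a)" for u
      unfolding lam(2) weight_poly_eval bs_def prod ..
  qed (use p parity order in \<open>auto simp: lam weight_poly_tail as_def bs_def\<close>)
  let ?J = "maximal_ideal N s lam"
  have J: "Jmax = ?J" by (simp add: Jmax_def)
  let ?K = "{x \<in> falg N. relabel_swap p x * zeta \<in> ?J}"
  have zf: "zeta \<in> falg N" by (rule W_falg[OF zeta_W])
  have "left_ideal N ?K"
    using Jm.J_zero Jm.J_add Jm.J_mult[OF relabel_swap_closed[OF p]] unfolding J
    by (auto simp: left_ideal_def relabel_swap_simps distrib_right mult.assoc)
  moreover have "verma_ideal N (s \<circ> adj_swap p) (reflected p k s lam a b) \<subseteq> ?K"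
  proof (rule highest_weight.verma_minimal)
    show "left_ideal N ?K" by fact
    show "yangian_ideal N (s \<circ> adj_swap p) \<subseteq> ?K"
    proof
      fix x assume x: "x \<in> yangian_ideal N (s \<circ> adj_swap p)"
      then have "relabel_swap p x \<in> yangian_ideal N s" by (rule relabel_swap_ideal[OF p])
      then have "relabel_swap p x * zeta \<in> yangian_ideal N s"
        using ideal.I_r_closed[OF ideal_yangian _ zf] by simp
      then show "x \<in> ?K"
        using Jm.relations_J yangian_ideal_closed x unfolding J by blast
    qed
    have upper: "tcoeff a b r \<in> ?K" if ab: "1 \<le> a" "a < b" "b \<le> N" for a b r
    proof -
      have "tcoeff (adj_swap p a) (adj_swap p b) r * zeta \<in> Jmax"
      proof (cases "(a, b) = (p, Suc p)")
        case True
        then show ?thesis using zeta_lower by auto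
      next
        case False
        then have "1 \<le> adj_swap p a" "adj_swap p a < adj_swap p b"
            "adj_swap p b \<le> N" "(adj_swap p a, adj_swap p b) \<noteq> (p, Suc p)"
          using ab p by (auto simp: transpose_def)
        then show ?thesis by (rule W0_upper[OF W_W0[OF zeta_W]])
      qed
      then show ?thesis using ab by (auto simp: relabel_swap_tcoeff J)
    qed
    have diag: "tcoeff j j r - scalar (fps_nth (reflected p k s lam a b j) r) \<in> ?K" if j: "1 \<le> j" "j \<le> N" for j r
    proof -
      have shifted: "(\<Prod>c\<leftarrow>sort_key key (map f [1..<Suc k]). u + (c - \<epsilon>))
          = (\<Sum>r\<le>k. u ^ (k - r) * fps_nth (weight_poly k (\<lambda>r. f r - \<epsilon>)) r)" for f u
        unfolding prod weight_poly_eval by (simp add: comp_def)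
      have "tcoeff (adj_swap p j) (adj_swap p j) r * zeta - fps_nth (reflected p k s lam a b j) r \<star> zeta \<in> Jmax"
      proof -
        consider "j = p" | "j = Suc p" | "j \<notin> {p, Suc p}" by auto
        then show ?thesis
        proof cases
          case 1
          have "tcoeff q q r * zeta - fps_nth (weight_poly k (\<lambda>r. b r - \<epsilon>)) r \<star> zeta \<in> Jmax"
            by (rule zeta_weight[OF pq_mem(2) zeta_eigen(2)])
              (simp_all only: bs_def shifted weight_poly_tail flip: \<epsilon>_def)
          then show ?thesis using 1 by (simp add: reflected_def \<epsilon>_def)
        next
          case 2
          have "tcoeff p p r * zeta - fps_nth (weight_poly k (\<lambda>r. a r - \<epsilon>)) r \<star> zeta \<in> Jmax"
            by (rule zeta_weight[OF pq_mem(1) zeta_eigen(1)])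
              (simp_all only: as_def shifted weight_poly_tail flip: \<epsilon>_def)
          then show ?thesis using 2 by (simp add: reflected_def \<epsilon>_def)
        next
          case 3
          then show ?thesis using W0_diag[OF W_W0[OF zeta_W] j] by (auto simp: reflected_def)
        qed
      qed
      then show ?thesis
        using j by (auto simp: relabel_swap_tcoeff relabel_swap_simps J left_diff_distrib cscale_def)
    qed
    show "verma_gens N (reflected p k s lam a b) \<subseteq> ?K"
      unfolding verma_gens_def using upper diag by blast
  qed
  ultimately show thesis using that[of zeta] zf zeta_notin unfolding J by blast
qed

text \<open>
  A nonzero module of the original weight contains a nonzero highest vector for the new weight, so the
  Verma module of the new weight is nonzero.
\<close>

lemma reflected_proper:
  assumes p: "1 \<le> p" "Suc p \<le> N" and parity: "s p = 0 \<and> s (Suc p) = 1 \<or> s p = 1 \<and> s (Suc p) = 0"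
    and lam: "lam p = weight_poly k a" "lam (Suc p) = weight_poly k b"
    and no_common_root: "\<And>r t. r \<in> {1..k} \<Longrightarrow> t \<in> {1..k} \<Longrightarrow> a r \<noteq> b t"
    and proper: "1 \<notin> maximal_ideal N s lam"
  shows "1 \<notin> maximal_ideal N (s \<circ> adj_swap p) (reflected p k s lam a b)"
proof -
  let ?J = "maximal_ideal N s lam" and ?s' = "s \<circ> adj_swap p" and ?lam' = "reflected p k s lam a b"
  interpret L': highest_weight N ?s' ?lam' .
  obtain z where z: "z \<in> falg N" "z \<notin> ?J" "verma_ideal N ?s' ?lam' \<subseteq> {x \<in> falg N. relabel_swap p x * z \<in> ?J}"
    by (rule reflected_vector[OF p parity lam no_common_root proper])
  then have "1 \<notin> verma_ideal N ?s' ?lam'" by (auto simp: relabel_swap_simps)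
  then show ?thesis using L'.one_Jmax_iff by (simp add: L'.Jmax_def)
qed

lemma reflected_reflected:
  assumes parity: "s p = 0 \<and> s (Suc p) = 1 \<or> s p = 1 \<and> s (Suc p) = 0"
    and lam: "lam p = weight_poly k a" "lam (Suc p) = weight_poly k b"
  shows "reflected p k (s \<circ> adj_swap p) (reflected p k s lam a b)
     (\<lambda>r. b r - (- 1) ^ s p) (\<lambda>r. a r - (- 1) ^ s p) = lam"
proof
  fix j
  have "(- 1) ^ (s \<circ> adj_swap p) p = - ((- 1) ^ s p :: complex)" using parity by auto
  then show "reflected p k (s \<circ> adj_swap p) (reflected p k s lam a b)
     (\<lambda>r. b r - (- 1) ^ s p) (\<lambda>r. a r - (- 1) ^ s p) j = lam j"
    unfolding reflected_def using lam by auto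
qed

text \<open>
  The annihilator \<open>K\<close> of the reflected vector is a maximal left ideal above the Verma ideal of the new weight,
  and all proper left ideals above the Verma ideal lie in \<open>maximal_ideal\<close>. If \<open>L(\<lambda>)\<close> is zero, both
  modules are zero by reflecting back.
\<close>

theorem odd_reflection:
  assumes p: "1 \<le> p" "Suc p \<le> N" and parity: "s p = 0 \<and> s (Suc p) = 1 \<or> s p = 1 \<and> s (Suc p) = 0"
    and lam: "lam p = weight_poly k a" "lam (Suc p) = weight_poly k b"
    and no_common_root: "\<And>r t. r \<in> {1..k} \<Longrightarrow> t \<in> {1..k} \<Longrightarrow> a r \<noteq> b t"
  shows "isomorphic_after_swap N p s lam (s \<circ> adj_swap p) (reflected p k s lam a b)"
proof -
  let ?s' = "s \<circ> adj_swap p" and ?lam' = "reflected p k s lam a b"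
  let ?J = "maximal_ideal N s lam" and ?J' = "maximal_ideal N ?s' ?lam'"
  interpret L: highest_weight N s lam .
  interpret L': highest_weight N ?s' ?lam' .
  have J: "L.Jmax = ?J" "L'.Jmax = ?J'" by (simp_all add: L.Jmax_def L'.Jmax_def)
  obtain f where f: "presents N s (irreducible_hw_module N s lam) f ?J" using presents_irreducible by blast
  obtain f' where f': "presents N ?s' (irreducible_hw_module N ?s' ?lam') f' ?J'" using presents_irreducible by blast
  have closed: "relabel_swap p x \<in> falg N" if "x \<in> falg N" for x using relabel_swap_closed[OF p that] .
  have "\<exists>z\<in>falg N. (\<forall>x\<in>falg N. relabel_swap p x * z \<in> ?J \<longleftrightarrow> x \<in> ?J') \<and>
      (\<forall>y\<in>falg N. \<exists>x\<in>falg N. y - relabel_swap p x * z \<in> ?J)"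
  proof (cases "1 \<in> ?J")
    case True
    have "1 \<in> ?J'"
    proof (rule ccontr)
      assume *: "1 \<notin> ?J'"
      have "1 \<notin> maximal_ideal N (?s' \<circ> adj_swap p) (reflected p k ?s' ?lam' (\<lambda>r. b r - (- 1) ^ s p) (\<lambda>r. a r - (- 1) ^ s p))"
      proof (rule reflected_proper[OF p _ _ _ _ *])
        show "?s' p = 0 \<and> ?s' (Suc p) = 1 \<or> ?s' p = 1 \<and> ?s' (Suc p) = 0" using parity by auto
        show "?lam' p = weight_poly k (\<lambda>r. b r - (- 1) ^ s p)" "?lam' (Suc p) = weight_poly k (\<lambda>r. a r - (- 1) ^ s p)"
          by (simp_all add: reflected_def)
        show "b r - (- 1) ^ s p \<noteq> a t - (- 1) ^ s p" if "r \<in> {1..k}" "t \<in> {1..k}" for r t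
          using no_common_root[OF that(2,1)] by auto
      qed
      then show False using True unfolding swap_twice reflected_reflected[OF parity lam] by contradiction
    qed
    then have "?J' = falg N" "?J = falg N"
      using True L.Jm.J_full_iff L'.Jm.J_full_iff by (simp_all add: J)
    then show ?thesis using closed by (intro bexI[of _ 1]) auto
  next
    case False
    interpret L: proper_highest_weight N s lam by unfold_locales (simp add: J False)
    obtain z where z: "z \<in> falg N" "z \<notin> ?J" "verma_ideal N ?s' ?lam' \<subseteq> {x \<in> falg N. relabel_swap p x * z \<in> ?J}"
        "left_ideal N {x \<in> falg N. relabel_swap p x * z \<in> ?J}"
      by (rule reflected_vector[OF p parity lam no_common_root False])
    let ?K = "{x \<in> falg N. relabel_swap p x * z \<in> ?J}"
    have one_K: "1 \<notin> ?K" using z(2) by (simp add: relabel_swap_simps)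
    have "?K \<noteq> falg N" using one_K by (metis free_algebra_closed(2))
    then have K_J': "?K \<subseteq> ?J'" using L'.Jmax_proper[OF z(4,3)] by (simp add: J)
    have one_J': "1 \<notin> ?J'" by (rule reflected_proper[OF p parity lam no_common_root False])
    have "x \<in> ?K" if x: "x \<in> falg N" "x \<in> ?J'" for x
    proof (rule ccontr)
      assume "x \<notin> ?K"
      then have "relabel_swap p x * z \<notin> ?J" using x by simp
      then obtain y where y: "y \<in> falg N" "y * (relabel_swap p x * z) - 1 \<in> ?J"
        using L.Jmax_cyclic[of "relabel_swap p x * z"] closed x z(1) unfolding J by auto
      \<comment> \<open>the factor \<open>z\<close> turns a multiple of \<open>1\<close> into a multiple of \<open>z\<close>, that is, into an element of \<open>K\<close>\<close>
      let ?w = "relabel_swap p (z * y)"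
      have w: "?w \<in> falg N" using closed z(1) y(1) by simp
      have "z * (y * (relabel_swap p x * z) - 1) \<in> ?J" using L.Jm.J_mult z(1) y(2) unfolding J by blast
      moreover have "relabel_swap p (?w * x - 1) * z = z * (y * (relabel_swap p x * z) - 1)"
        using relabel_swap_swap[OF z(1), of p] relabel_swap_swap[OF y(1), of p]
        by (simp add: relabel_swap_simps algebra_simps)
      ultimately have "?w * x - 1 \<in> ?K" using w x by simp
      then have "?w * x - 1 \<in> ?J'" using K_J' by blast
      moreover have "?w * x \<in> ?J'" using L'.Jm.J_mult w x unfolding J by blast
      ultimately have "?w * x - (?w * x - 1) \<in> ?J'" using L'.Jm.J_diff unfolding J by blast
      then show False using one_J' by simp
    qed
    then have ker: "\<forall>x\<in>falg N. relabel_swap p x * z \<in> ?J \<longleftrightarrow> x \<in> ?J'" using K_J' by blast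
    obtain t where t: "t \<in> falg N" "t * z - 1 \<in> ?J"
      using L.Jmax_cyclic[of z] z unfolding J by auto
    have "y - relabel_swap p (relabel_swap p (y * t)) * z \<in> ?J" if y: "y \<in> falg N" for y
    proof -
      have "- (y * (t * z - 1)) \<in> ?J"
        using L.Jm.J_uminus[OF L.Jm.J_mult[OF y, of "t * z - 1"]] t(2) unfolding J by blast
      then show ?thesis using y t(1) relabel_swap_swap[of "y * t" N p] by (simp add: algebra_simps)
    qed
    then have "\<forall>y\<in>falg N. \<exists>x\<in>falg N. y - relabel_swap p x * z \<in> ?J"
      using closed t(1) by (meson free_algebra_closed(4))
    then show ?thesis using ker z(1) by blast
  qed
  then obtain z where z: "z \<in> falg N" "\<And>x. x \<in> falg N \<Longrightarrow> relabel_swap p x * z \<in> ?J \<longleftrightarrow> x \<in> ?J'"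
      "\<And>y. y \<in> falg N \<Longrightarrow> \<exists>x\<in>falg N. y - relabel_swap p x * z \<in> ?J" by blast
  show ?thesis
    unfolding isomorphic_after_swap_def
    by (rule module_iso_if_same_kernel[OF f f' closed _ _ _ _ z])
      (simp_all add: relabel_swap_simps yangian_relabel_class[OF p, simplified])
qed

theorem corollary4p6:
  fixes m n i k :: nat
    and s :: "nat \<Rightarrow> nat"
    and lam :: "nat \<Rightarrow> complex fps"
    and a b :: "nat \<Rightarrow> complex"
  assumes "parity_sequence m n s"
    and "\<And>j. j \<in> {1..m + n} \<Longrightarrow> fps_nth (lam j) 0 = 1"
    and "1 \<le> i" and "i + 1 \<le> m + n"
    and "lam i = weight_poly k a"
    and "lam (i + 1) = weight_poly k b"
    and "\<And>p q. p \<in> {1..k} \<Longrightarrow> q \<in> {1..k} \<Longrightarrow> a p \<noteq> b q"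
  shows "(s i = 1 \<and> s (i + 1) = 0 \<longrightarrow>
            isomorphic_after_swap (m + n) i s lam
              (s(i := 0, i + 1 := 1))
              (lam(i := weight_poly k (\<lambda>r. b r + 1), i + 1 := weight_poly k (\<lambda>r. a r + 1)))) \<and>
         (s i = 0 \<and> s (i + 1) = 1 \<longrightarrow>
            isomorphic_after_swap (m + n) i s lam
              (s(i := 1, i + 1 := 0))
              (lam(i := weight_poly k (\<lambda>r. b r - 1), i + 1 := weight_poly k (\<lambda>r. a r - 1))))"
proof (intro conjI impI)
  have reflect: "isomorphic_after_swap (m + n) i s lam (s \<circ> transpose i (Suc i)) (reflected i k s lam a b)"
    if "s i = 0 \<and> s (Suc i) = 1 \<or> s i = 1 \<and> s (Suc i) = 0"
    using odd_reflection[of i "m + n" s lam k a b] that assms by simp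
  have swap: "s \<circ> transpose i (Suc i) = s(i := s (Suc i), Suc i := s i)"
    by (auto simp: transpose_def fun_eq_iff)
  {
    assume s: "s i = 1 \<and> s (i + 1) = 0"
    then show "isomorphic_after_swap (m + n) i s lam (s(i := 0, i + 1 := 1))
        (lam(i := weight_poly k (\<lambda>r. b r + 1), i + 1 := weight_poly k (\<lambda>r. a r + 1)))"
      using reflect by (simp add: swap reflected_def)
  next
    assume s: "s i = 0 \<and> s (i + 1) = 1"
    then show "isomorphic_after_swap (m + n) i s lam (s(i := 1, i + 1 := 0))
        (lam(i := weight_poly k (\<lambda>r. b r - 1), i + 1 := weight_poly k (\<lambda>r. a r - 1)))"
      using reflect by (simp add: swap reflected_def)
  }
qed

end
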